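(* Let $d\ge 2$ and let $M$ be a closed connected PL $d$-manifold. Every vertex of the component graph $\mathcal C$ of $M$ has out-degree one. Equivalently, for every $n$, if $U\in C(n)$ and $P,Q\in U$, then every element of $L(P)$ and every element of $L(Q)$ lie in the same connected component of $G(n+1)$.
   Context: Let $d\ge2$ and let $M$ be a closed connected PL $d$-manifold. A triangulation of $M$ is a finite simplicial complex whose geometric realization is PL-homeomorphic to $M$; isomorphic triangulations are identified. A facet is a $d$-simplex. For a simplex $\alpha\in T$, $\operatorname{lk}_T(\alpha)=\{\gamma\in T:\gamma\cap\alpha=\varnothing,\ \gamma\cup\alpha\in T\}$; $\partial\alpha$ is the boundary complex of $\alpha$, $A*B$ is the simplicial join, and $|\alpha|$ is the number of vertices of $\alpha$. Bistellar moves: let $\alpha,\beta$ be disjoint simplices with $|\alpha|+|\beta|=d+2$, $\alpha\in T$, $\beta\notin T$ and $\operatorname{lk}_T(\alpha)=\partial\beta$. The bistellar move replaces the ball $\alpha*\partial\beta$ by $\partial\alpha*\beta$. If $|\beta|=p$ and $|\alpha|=q$ it is called a $p$--$q$ move (it removes $p$ facets and inserts $q$ facets). The $1$--$(d+1)$ move is stellar subdivision of a facet $\alpha$ with a new vertex $\beta$ (a facet subdivision); its inverse is the $(d+1)$--$1$ move, which deletes a vertex. The other moves ($2\le p,q\le d$) are called proper, or vertex-preserving. $G(n)$ is the graph whose vertices are the triangulations of $M$ with $n$ vertices (up to isomorphism), with an edge for each proper bistellar move (loops are allowed). $C(n)=\pi_0(G(n))$ is its set of connected components; $P\in U$ for $U\in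 C(n)$ means that the triangulation $P$ is a vertex of the component $U$. For a triangulation $T$ with $n$ vertices and a facet $\sigma$ of $T$, $T^\sigma$ is the triangulation obtained by stellarly subdividing $\sigma$ with a new vertex, and the lift fiber of $T$ is $L(T)=\{T^\sigma:\sigma\text{ a facet of }T\}\subseteq V(G(n+1))$. The component graph $\mathcal C$ is the directed graph whose vertices are the elements of $C(n)$, over all $n$, with a directed edge from $U\in C(n)$ to $V\in C(n+1)$ if some facet subdivision of some triangulation in $U$ belongs to $V$. *)

theory Defs
  imports
    "HOL-Analysis.Analysis"
    "HOL-Analysis.Finite_Function_Topology"
    "Graph_Theory.Pair_Digraph"
begin

section \<open>Piecewise linear topology\<close>

definition affine_map_on :: "'a::real_vector set \<Rightarrow> ('a \<Rightarrow> 'b::real_vector) \<Rightarrow> bool" where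
  "affine_map_on C f \<longleftrightarrow>
     (\<forall>x\<in>C. \<forall>y\<in>C. \<forall>t\<in>{0..1}.
        f ((1 - t) *\<^sub>R x + t *\<^sub>R y) = (1 - t) *\<^sub>R f x + t *\<^sub>R f y)"

text \<open>
  The condition is local, so that it makes sense for compact polyhedra and for open subsets of
  them alike. Taking for \<open>f\<close> the identity, it says that \<open>S\<close> is a polyhedron; hence being
  a PL map includes that the domain is a polyhedron.
\<close>

definition pl_map_on ::
    "'a::real_normed_vector set \<Rightarrow> ('a \<Rightarrow> 'b::real_normed_vector) \<Rightarrow> bool" where
  "pl_map_on S f \<longleftrightarrow>
     (\<forall>x\<in>S. \<exists>F U. finite F \<and> (\<forall>C\<in>F. polytope C \<and> C \<subseteq> S \<and> affine_map_on C f) \<and>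
        openin (top_of_set S) U \<and> x \<in> U \<and> U \<subseteq> \<Union>F)"

definition pl_homeomorphic ::
    "'a::real_normed_vector set \<Rightarrow> 'b::real_normed_vector set \<Rightarrow> bool" where
  "pl_homeomorphic S T \<longleftrightarrow>
     (\<exists>f g. homeomorphism S T f g \<and> pl_map_on S f \<and> pl_map_on T g)"

text \<open>
  Finitely supported functions \<open>nat \<Rightarrow>\<^sub>0 real\<close> serve as the union of all \<open>\<real>\<^sup>d\<close>; on each
  \<open>real_space d\<close> their norm is the \<open>l\<^sub>1\<close> norm and induces the usual topology.
\<close>

definition real_space :: "nat \<Rightarrow> (nat \<Rightarrow>\<^sub>0 real) set" where
  "real_space d = {x. Poly_Mapping.keys x \<subseteq> {..<d}}"

text \<open>
  PL manifolds are polyhedra in some Euclidean space. The charts take values in all of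
  \<open>\<real>\<^sup>d\<close>, so the manifolds have no boundary, and a closed manifold is a compact one.
\<close>

definition pl_manifold :: "nat \<Rightarrow> 'a::euclidean_space set \<Rightarrow> bool" where
  "pl_manifold d M \<longleftrightarrow>
     (\<forall>x\<in>M. \<exists>U V. openin (top_of_set M) U \<and> x \<in> U \<and>
        openin (top_of_set (real_space d)) V \<and> pl_homeomorphic U V)"

definition closed_connected_pl_manifold :: "nat \<Rightarrow> 'a::euclidean_space set \<Rightarrow> bool" where
  "closed_connected_pl_manifold d M \<longleftrightarrow>
     pl_manifold d M \<and> compact M \<and> connected M \<and> M \<noteq> {}"


section \<open>Simplicial complexes and triangulations\<close>

text \<open>
  Complexes contain the empty simplex. Vertices are labelled by natural numbers, which is no
  restriction for finite complexes up to isomorphism.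
\<close>

definition finite_complex :: "'v set set \<Rightarrow> bool" where
  "finite_complex K \<longleftrightarrow>
     finite K \<and> {} \<in> K \<and> (\<forall>s\<in>K. finite s \<and> (\<forall>t. t \<subseteq> s \<longrightarrow> t \<in> K))"

definition realization :: "'v set set \<Rightarrow> ('v \<Rightarrow>\<^sub>0 real) set" where
  "realization K = (\<Union>s\<in>K. convex hull ((\<lambda>v. Poly_Mapping.single v 1) ` s))"

definition triangulation :: "'a::euclidean_space set \<Rightarrow> nat set set \<Rightarrow> bool" where
  "triangulation M T \<longleftrightarrow> finite_complex T \<and> pl_homeomorphic (realization T) M"

definition isomorphic_complex :: "'v set set \<Rightarrow> 'w set set \<Rightarrow> bool" where
  "isomorphic_complex S T \<longleftrightarrow> (\<exists>f. bij_betw f (\<Union>S) (\<Union>T) \<and> T = (`) f ` S)"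

definition iso_class :: "nat set set \<Rightarrow> nat set set set" where
  "iso_class T = {T'. isomorphic_complex T T'}"

definition facet :: "nat \<Rightarrow> 'v set set \<Rightarrow> 'v set \<Rightarrow> bool" where
  "facet d T \<sigma> \<longleftrightarrow> \<sigma> \<in> T \<and> card \<sigma> = d + 1"

definition link :: "'v set set \<Rightarrow> 'v set \<Rightarrow> 'v set set" where
  "link T \<alpha> = {\<gamma> \<in> T. \<gamma> \<inter> \<alpha> = {} \<and> \<gamma> \<union> \<alpha> \<in> T}"

definition boundary :: "'v set \<Rightarrow> 'v set set" where
  "boundary \<alpha> = {s. s \<subset> \<alpha>}"

definition simplicial_join :: "'v set set \<Rightarrow> 'v set set \<Rightarrow> 'v set set" where
  "simplicial_join A B = {s \<union> t |s t. s \<in> A \<and> t \<in> B}"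


section \<open>Bistellar moves\<close>

definition bistellar_pair :: "nat \<Rightarrow> 'v set set \<Rightarrow> 'v set \<Rightarrow> 'v set \<Rightarrow> bool" where
  "bistellar_pair d T \<alpha> \<beta> \<longleftrightarrow>
     finite \<alpha> \<and> finite \<beta> \<and> \<alpha> \<noteq> {} \<and> \<beta> \<noteq> {} \<and> \<alpha> \<inter> \<beta> = {} \<and> card \<alpha> + card \<beta> = d + 2 \<and>
     \<alpha> \<in> T \<and> \<beta> \<notin> T \<and> link T \<alpha> = boundary \<beta>"

text \<open>
  The common boundary \<open>simplicial_join (boundary \<alpha>) (boundary \<beta>)\<close> of the two balls is removed
  with the old ball and comes back with the new one. A simplex as a complex is its power set.
\<close>

definition bistellar_move :: "'v set set \<Rightarrow> 'v set \<Rightarrow> 'v set \<Rightarrow> 'v set set" where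
  "bistellar_move T \<alpha> \<beta> =
     (T - simplicial_join (Pow \<alpha>) (boundary \<beta>)) \<union> simplicial_join (boundary \<alpha>) (Pow \<beta>)"

definition proper_move :: "nat \<Rightarrow> 'v set set \<Rightarrow> 'v set set \<Rightarrow> bool" where
  "proper_move d T T' \<longleftrightarrow>
     (\<exists>\<alpha> \<beta>. bistellar_pair d T \<alpha> \<beta> \<and> card \<alpha> \<in> {2..d} \<and> card \<beta> \<in> {2..d} \<and>
        T' = bistellar_move T \<alpha> \<beta>)"

definition facet_subdivision :: "'v set set \<Rightarrow> 'v set \<Rightarrow> 'v \<Rightarrow> 'v set set" where
  "facet_subdivision T \<sigma> v = bistellar_move T \<sigma> {v}"


section \<open>Flip graphs and the component graph\<close>

definition triangulation_classes :: "'a::euclidean_space set \<Rightarrow> nat \<Rightarrow> nat set set set set" where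
  "triangulation_classes M n = {iso_class T |T. triangulation M T \<and> card (\<Union>T) = n}"

text \<open>\<open>G(n)\<close>; an undirected edge is a pair of opposite arcs.\<close>

definition flip_graph ::
    "nat \<Rightarrow> 'a::euclidean_space set \<Rightarrow> nat \<Rightarrow> nat set set set pair_pre_digraph" where
  "flip_graph d M n =
     \<lparr>pverts = triangulation_classes M n,
      parcs = {(P, Q). P \<in> triangulation_classes M n \<and> Q \<in> triangulation_classes M n \<and>
        (\<exists>S\<in>P. \<exists>T\<in>Q. proper_move d S T \<or> proper_move d T S)}\<rparr>"

text \<open>\<open>C(n)\<close>\<close>

definition flip_components :: "nat \<Rightarrow> 'a::euclidean_space set \<Rightarrow> nat \<Rightarrow> nat set set set set set" where
  "flip_components d M n = pverts (flip_graph d M n) // (parcs (flip_graph d M n))\<^sup>*"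

text \<open>
  \<open>L(P)\<close> for the isomorphism class \<open>P\<close> of a triangulation. Choosing a different
  representative or a different new vertex \<open>v\<close> does not give further classes.
\<close>

definition lift_fiber :: "nat \<Rightarrow> nat set set set \<Rightarrow> nat set set set set" where
  "lift_fiber d P =
     {iso_class (facet_subdivision T \<sigma> v) |T \<sigma> v. T \<in> P \<and> facet d T \<sigma> \<and> v \<notin> \<Union>T}"

definition component_graph ::
    "nat \<Rightarrow> 'a::euclidean_space set \<Rightarrow> nat set set set set pair_pre_digraph" where
  "component_graph d M =
     \<lparr>pverts = (\<Union>n. flip_components d M n),
      parcs = {(U, V). \<exists>n. U \<in> flip_components d M n \<and> V \<in> flip_components d M (n + 1) \<and>
        (\<exists>P\<in>U. lift_fiber d P \<inter> V \<noteq> {})}\<rparr>"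

end

theory Submission
  imports Defs "HOL-Homology.Invariance_of_Domain"
begin

text \<open>
  Two facets that share a ridge have subdivisions with a common neighbour: flipping the ridge in
  either subdivision gives the stellar subdivision of the ridge. Since the facets of a connected
  closed manifold are strongly connected, each lift fiber lies in one component. A proper move
  \<open>T \<rightarrow> T'\<close> leaves some facet untouched, because in a closed manifold the ball
  \<open>\<alpha> * \<partial>\<beta>\<close> cannot be everything; subdividing that facet commutes with the move, which links
  \<open>L(T)\<close> to \<open>L(T')\<close>.

  The required facts about triangulations come from invariance of domain (pureness, and exactly two
  facets at each ridge) and from a general position argument in a PL chart (strong connectivity):
  if the facets split into two classes meeting only in codimension two, then a generic segment in a
  chart around a common point avoids the intersection, which contradicts its connectedness. Stellar
  subdivisions of a triangulation are again triangulations, by moving the new vertex linearly to the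
  barycentre.
\<close>

section \<open>Coordinate subspaces of finitely supported functions\<close>

text \<open>Edges of the flip graph join complexes that must themselves triangulate
  \<open>M\<close>. Every complex introduced on the way is therefore chosen to be a stellar
  subdivision of a given triangulation, at a facet or at a ridge, and the PL type has to be verified
  for stellar subdivisions only. The flip of a ridge replaces a simplex with \<open>d\<close>
  vertices by an edge from the new vertex to the opposite vertex of the neighbouring facet. Both
  sizes lie between 2 and \<open>d\<close> exactly because \<open>d \<ge> 2\<close>, so the flip
  preserves the vertex set. Its result mentions only the ridge, which is why it is the same from
  both sides. Realizations live in an infinite-dimensional normed space. All topology is therefore
  done in the subspaces spanned by finitely many coordinates, where linear maps are continuous and
  invariance of domain can be transferred, and the facts about polytopes are obtained by algebra
  that does not refer to dimension.\<close>

definition unit_vec :: "'v \<Rightarrow> 'v \<Rightarrow>\<^sub>0 real" where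
  "unit_vec v = Poly_Mapping.single v 1"

text \<open>The index type is arbitrary, so that \<open>real_space\<close> and the coordinate
  subspaces that carry the simplices of a complex fall under the same lemmas.\<close>

definition coord_space :: "'v set \<Rightarrow> ('v \<Rightarrow>\<^sub>0 real) set" where
  "coord_space I = {x. Poly_Mapping.keys x \<subseteq> I}"

lemma real_space_eq: "real_space d = coord_space {..<d}"
  by (simp add: real_space_def coord_space_def)

lemma lookup_unit_vec: "Poly_Mapping.lookup (unit_vec v) i = (if i = v then 1 else 0)"
  by (simp add: unit_vec_def lookup_single when_def)

lemma lookup_scaleR [simp]:
  fixes x :: "'v \<Rightarrow>\<^sub>0 real"
  shows "Poly_Mapping.lookup (r *\<^sub>R x) i = r * Poly_Mapping.lookup x i"
proof -
  have "finite {i. r *\<^sub>R Poly_Mapping.lookup x i \<noteq> 0}"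
    by (rule finite_subset [of _ "Poly_Mapping.keys x"]) (auto simp: in_keys_iff)
  then show ?thesis
    by (simp add: scaleR_poly_mapping_def)
qed

lemma lookup_sum_scaleR:
  fixes f :: "'b \<Rightarrow> 'v \<Rightarrow>\<^sub>0 real"
  shows "Poly_Mapping.lookup (\<Sum>j\<in>J. f j) i = (\<Sum>j\<in>J. Poly_Mapping.lookup (f j) i)"
  by (induction J rule: infinite_finite_induct) (auto simp: lookup_add)

lemma sum_unit_vec_lookup:
  assumes "finite I"
  shows "Poly_Mapping.lookup (\<Sum>j\<in>I. c j *\<^sub>R unit_vec j) i = (if i \<in> I then c i else 0)"
  using assms by (simp add: lookup_sum_scaleR lookup_unit_vec if_distrib cong: if_cong)

lemma sum_unit_vec:
  assumes "finite I" "Poly_Mapping.keys x \<subseteq> I"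
  shows "(\<Sum>i\<in>I. Poly_Mapping.lookup x i *\<^sub>R unit_vec i) = x"
  using assms by (intro poly_mapping_eqI) (auto simp: sum_unit_vec_lookup in_keys_iff)

lemma coord_space_iff: "x \<in> coord_space I \<longleftrightarrow> (\<forall>i. i \<notin> I \<longrightarrow> Poly_Mapping.lookup x i = 0)"
  by (auto simp: coord_space_def in_keys_iff)

lemma subspace_coord_space: "subspace (coord_space I)"
  by (auto simp: subspace_def coord_space_iff lookup_add)

lemma abs_lookup_le_norm:
  fixes x :: "'v \<Rightarrow>\<^sub>0 real"
  shows "\<bar>Poly_Mapping.lookup x i\<bar> \<le> norm x"
proof (cases "i \<in> Poly_Mapping.keys x")
  case True
  then have "\<bar>Poly_Mapping.lookup x i\<bar> \<le> (\<Sum>i\<in>Poly_Mapping.keys x. \<bar>Poly_Mapping.lookup x i\<bar>)"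
    by (intro member_le_sum) auto
  then show ?thesis
    by (simp add: norm_poly_mapping_def dist_poly_mapping_def)
qed (simp add: in_keys_iff)

lemma continuous_on_lookup [continuous_intros]:
  fixes f :: "'a::topological_space \<Rightarrow> 'v \<Rightarrow>\<^sub>0 real"
  assumes "continuous_on S f"
  shows "continuous_on S (\<lambda>x. Poly_Mapping.lookup (f x) i)"
proof -
  have "bounded_linear (\<lambda>x::'v \<Rightarrow>\<^sub>0 real. Poly_Mapping.lookup x i)"
    by (rule bounded_linear_intro [where K = 1]) (auto simp: lookup_add abs_lookup_le_norm)
  then show ?thesis
    using assms by (rule bounded_linear.continuous_on)
qed

text \<open>Lets a point of a relatively open set move a little in a chosen direction. This refutes
  openness of images that are too thin, finds points inside a facet near a given point, and supplies
  the lines of the general position arguments.\<close>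

lemma openin_subspace_line:
  fixes V :: "'a::real_normed_vector set"
  assumes "openin (top_of_set E) V" "subspace E" "z \<in> V" "w \<in> E"
  obtains e where "e > 0" "\<And>t. \<bar>t\<bar> < e \<Longrightarrow> z + t *\<^sub>R w \<in> V"
proof -
  have "z \<in> E"
    using assms openin_imp_subset by blast
  obtain r where r: "r > 0" "ball z r \<inter> E \<subseteq> V"
    using assms by (meson openin_contains_ball)
  show ?thesis
  proof (rule that [of "r / (norm w + 1)"])
    show "r / (norm w + 1) > 0"
      using r by (simp add: add_nonneg_pos)
    fix t assume t: "\<bar>t\<bar> < r / (norm w + 1)"
    have "\<bar>t\<bar> * norm w \<le> \<bar>t\<bar> * (norm w + 1)"
      by (simp add: mult_left_mono)
    also have "\<dots> < r"
      using t by (simp add: pos_less_divide_eq add_nonneg_pos)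
    finally have "z + t *\<^sub>R w \<in> ball z r"
      by (simp add: dist_norm)
    moreover have "z + t *\<^sub>R w \<in> E"
      using assms \<open>z \<in> E\<close> by (simp add: subspace_add subspace_scale)
    ultimately show "z + t *\<^sub>R w \<in> V"
      using r by blast
  qed
qed

section \<open>Invariance of domain\<close>

text \<open>An enumeration of \<open>I\<close> carries invariance of domain over from
  \<open>Euclidean_space n\<close>, whose points are sequences, to finitely supported
  functions.\<close>

lemma homeomorphic_maps_Euclidean_coord_space:
  fixes I :: "'v set"
  assumes "finite I"
  obtains f g where "homeomorphic_maps (Euclidean_space (card I)) (top_of_set (coord_space I)) f g"
proof -
  define n where "n = card I"
  obtain e where e: "bij_betw e {..<n} I"
    using assms ex_bij_betw_nat_finite unfolding n_def by (metis atLeast0LessThan)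
  define f where "f = (\<lambda>y. \<Sum>k<n. y k *\<^sub>R unit_vec (e k))"
  define g where "g = (\<lambda>x k. if k < n then Poly_Mapping.lookup x (e k) else (0::real))"
  have lookup_f: "Poly_Mapping.lookup (f y) (e k) = y k" if "k < n" for y k
  proof -
    have "Poly_Mapping.lookup (f y) (e k) = (\<Sum>j<n. if k = j then y j else 0)"
      unfolding f_def lookup_sum_scaleR
      using e that by (intro sum.cong) (auto simp: lookup_unit_vec bij_betw_def inj_on_def)
    then show ?thesis
      using that by simp
  qed
  have f_in: "f y \<in> coord_space I" for y
    unfolding f_def using e
    by (intro subspace_sum subspace_coord_space subspace_scale)
      (auto simp: coord_space_iff lookup_unit_vec bij_betw_def)
  have 1: "continuous_map (Euclidean_space n) (top_of_set (coord_space I)) f"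
  proof -
    have "continuous_on T (\<lambda>y::nat \<Rightarrow> real. y k)" for T k
      by (rule continuous_on_subset [OF continuous_on_product_coordinates subset_UNIV])
    then have "continuous_on (topspace (Euclidean_space n)) f"
      unfolding f_def by (intro continuous_intros)
    then show ?thesis
      using f_in by (simp add: continuous_map_in_subtopology continuous_map_Euclidean_space_iff)
  qed
  have 2: "continuous_map (top_of_set (coord_space I)) (Euclidean_space n) g"
    unfolding g_def continuous_map_componentwise_Euclidean_space
    by (auto intro!: continuous_intros)
  have 3: "g (f y) = y" if "y \<in> topspace (Euclidean_space n)" for y
    using that by (auto simp: g_def lookup_f topspace_Euclidean_space fun_eq_iff)
  have 4: "f (g x) = x" if "x \<in> coord_space I" for x
  proof (rule poly_mapping_eqI)
    fix i
    show "Poly_Mapping.lookup (f (g x)) i = Poly_Mapping.lookup x i"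
    proof (cases "i \<in> I")
      case True
      then obtain k where "k < n" "i = e k"
        using e by (auto simp: bij_betw_def)
      then show ?thesis
        by (simp add: lookup_f g_def)
    next
      case False
      then show ?thesis
        using that f_in [of "g x"] by (simp add: coord_space_iff)
    qed
  qed
  show ?thesis
    using that [of f g] 1 2 3 4 unfolding homeomorphic_maps_def n_def by simp
qed

lemma invariance_of_domain_coord_space:
  fixes f :: "('v \<Rightarrow>\<^sub>0 real) \<Rightarrow> ('w \<Rightarrow>\<^sub>0 real)"
  assumes fin: "finite I" "finite J" and card: "card J \<le> card I"
    and V: "openin (top_of_set (coord_space I)) V"
    and f: "continuous_on V f" "f \<in> V \<rightarrow> coord_space J" "inj_on f V"
  shows "openin (top_of_set (coord_space J)) (f ` V)"
proof -
  obtain a b where ab: "homeomorphic_maps (Euclidean_space (card I)) (top_of_set (coord_space I)) a b"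
    using homeomorphic_maps_Euclidean_coord_space fin by blast
  obtain a' b' where ab': "homeomorphic_maps (Euclidean_space (card J)) (top_of_set (coord_space J)) a' b'"
    using homeomorphic_maps_Euclidean_coord_space fin by blast
  have VI: "V \<subseteq> coord_space I"
    using V openin_imp_subset by blast
  have b: "homeomorphic_map (top_of_set (coord_space I)) (Euclidean_space (card I)) b"
    and a: "homeomorphic_map (Euclidean_space (card J)) (top_of_set (coord_space J)) a'"
    using ab ab' homeomorphic_maps_map by blast+
  have open_bV: "openin (Euclidean_space (card I)) (b ` V)"
    using homeomorphic_map_openness_eq [OF b] V by blast
  have aV: "a ` (b ` V) \<subseteq> V" "\<And>y. y \<in> b ` V \<Longrightarrow> b (a y) = y"
    using ab VI by (auto simp: homeomorphic_maps_def image_iff)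
  have cm_a: "continuous_map (subtopology (Euclidean_space (card I)) (b ` V)) (top_of_set V) a"
    using ab aV unfolding homeomorphic_maps_def
    by (auto simp: continuous_map_in_subtopology continuous_map_from_subtopology)
  have cm_f: "continuous_map (top_of_set V) (top_of_set (coord_space J)) f"
    using f by simp
  have cm_b': "continuous_map (top_of_set (coord_space J)) (Euclidean_space (card J)) b'"
    using ab' by (simp add: homeomorphic_maps_def)
  have cm: "continuous_map (subtopology (Euclidean_space (card I)) (b ` V)) (Euclidean_space (card J)) (b' \<circ> f \<circ> a)"
    using continuous_map_compose [OF continuous_map_compose [OF cm_a cm_f] cm_b']
    by (simp add: comp_assoc)
  have inj_b': "inj_on b' (coord_space J)"
    using ab' by (auto simp: homeomorphic_maps_def intro: inj_on_inverseI)
  have inj: "inj_on (b' \<circ> f \<circ> a) (b ` V)"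
    using f aV inj_b'
    by (intro comp_inj_on inj_on_inverseI [of _ b])
      (auto intro!: inj_on_subset [OF inj_b'] intro: inj_on_subset [of f V])
  have "openin (Euclidean_space (card J)) ((b' \<circ> f \<circ> a) ` (b ` V))"
    using invariance_of_domain_Euclidean_space_gen card open_bV cm inj by blast
  then have "openin (top_of_set (coord_space J)) (a' ` ((b' \<circ> f \<circ> a) ` (b ` V)))"
    using homeomorphic_map_openness_eq [OF a] by blast
  moreover have "a' ` ((b' \<circ> f \<circ> a) ` (b ` V)) = f ` V"
  proof -
    have "a (b x) = x" if "x \<in> V" for x
      using ab VI that by (auto simp: homeomorphic_maps_def)
    moreover have "a' (b' (f x)) = f x" if "x \<in> V" for x
      using ab' f that by (auto simp: homeomorphic_maps_def)
    ultimately show ?thesis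
      by (simp add: image_image cong: image_cong)
  qed
  ultimately show ?thesis
    by simp
qed

text \<open>If \<open>J\<close> were smaller than \<open>I\<close>, fresh coordinates
  \<open>K\<close> could be added to it until the dimensions agree. By invariance of domain the
  image of \<open>V\<close> would be open in the larger space, although all its points vanish on
  \<open>K\<close>.\<close>

lemma invariance_of_dimension_coord_space:
  fixes f :: "('v \<Rightarrow>\<^sub>0 real) \<Rightarrow> (nat \<Rightarrow>\<^sub>0 real)"
  assumes fin: "finite I" "finite J"
    and V: "openin (top_of_set (coord_space I)) V" "V \<noteq> {}"
    and f: "continuous_on V f" "f \<in> V \<rightarrow> coord_space J" "inj_on f V"
  shows "card I \<le> card J"
proof (rule ccontr)
  assume "\<not> card I \<le> card J"
  then have lt: "card J < card I"
    by simp
  obtain K where K: "K \<subseteq> - J" "finite K" "card K = card I - card J"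
    using infinite_arbitrarily_large [of "- J" "card I - card J"] fin by (auto simp: finite_compl)
  then have card: "card (J \<union> K) = card I"
    using lt fin by (subst card_Un_disjoint) auto
  obtain k where k: "k \<in> K"
    using K lt by fastforce
  have op: "openin (top_of_set (coord_space (J \<union> K))) (f ` V)"
    using f K fin card V
    by (intro invariance_of_domain_coord_space [of I]) (auto simp: coord_space_iff Pi_iff)
  obtain z where z: "z \<in> f ` V"
    using V by blast
  obtain e where e: "e > 0" "\<And>t. \<bar>t\<bar> < e \<Longrightarrow> z + t *\<^sub>R unit_vec k \<in> f ` V"
    by (rule openin_subspace_line [OF op subspace_coord_space z, of "unit_vec k"])
       (use k in \<open>auto simp: coord_space_iff lookup_unit_vec\<close>)
  have "z + (e/2) *\<^sub>R unit_vec k \<in> coord_space J"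
    using e(2) [of "e/2"] e(1) f by auto
  moreover have "z \<in> coord_space J" "k \<notin> J"
    using z f k K by auto
  ultimately show False
    using e(1) by (auto simp: coord_space_iff lookup_add lookup_unit_vec)
qed

section \<open>Polytopes and piecewise linear maps\<close>

lemma nonneg_solution_boundary:
  fixes c w :: "'i \<Rightarrow>\<^sub>0 real"
  assumes c: "\<And>i. Poly_Mapping.lookup c i \<ge> 0"
    and w: "Poly_Mapping.keys w \<subseteq> Poly_Mapping.keys c"
    and neg: "Poly_Mapping.lookup w j < 0"
  obtains t where "t > 0" "\<And>i. Poly_Mapping.lookup (c + t *\<^sub>R w) i \<ge> 0"
    "Poly_Mapping.keys (c + t *\<^sub>R w) \<subset> Poly_Mapping.keys c"
proof -
  define N where "N = {i. Poly_Mapping.lookup w i < 0}"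
  have N: "N \<subseteq> Poly_Mapping.keys w" "j \<in> N"
    using neg by (auto simp: N_def in_keys_iff)
  then have "finite N"
    by (metis N(1) finite_keys finite_subset)
  \<comment> \<open>Ratio test of the simplex method: moving from \<open>c\<close> along
    \<open>w\<close>, the coordinate \<open>i\<close> reaches zero at time \<open>r i\<close>.
    Stopping at the smallest such time keeps every coordinate nonnegative and removes
    \<open>k\<close> from the support.\<close>
  define r where "r = (\<lambda>i. Poly_Mapping.lookup c i / - Poly_Mapping.lookup w i)"
  obtain k where k: "k \<in> N" "\<And>i. i \<in> N \<Longrightarrow> r k \<le> r i"
    using arg_min_if_finite [OF \<open>finite N\<close>, of r] N(2)
    by (metis empty_iff linorder_not_le)
  show ?thesis
  proof (rule that [of "r k"])
    have "Poly_Mapping.lookup c k \<noteq> 0"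
      using k N w by (auto simp: in_keys_iff)
    with c [of k] have "Poly_Mapping.lookup c k > 0"
      by linarith
    then show pos: "r k > 0"
      using k by (simp add: r_def N_def divide_pos_neg)
    show "Poly_Mapping.lookup (c + r k *\<^sub>R w) i \<ge> 0" for i
    proof (cases "i \<in> N")
      case True
      have "r k * - Poly_Mapping.lookup w i \<le> r i * - Poly_Mapping.lookup w i"
        using True k by (intro mult_right_mono) (auto simp: N_def)
      also have "\<dots> = Poly_Mapping.lookup c i"
        using True by (simp add: r_def N_def)
      finally show ?thesis
        by (simp add: lookup_add)
    next
      case False
      then show ?thesis
        using c [of i] pos by (simp add: lookup_add N_def)
    qed
    have "Poly_Mapping.lookup (c + r k *\<^sub>R w) k = 0"
      using k by (simp add: lookup_add lookup_minus r_def N_def)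
    then have "k \<notin> Poly_Mapping.keys (c + r k *\<^sub>R w)"
      by (simp add: in_keys_iff)
    moreover have "k \<in> Poly_Mapping.keys c"
      using k N w by auto
    moreover have "Poly_Mapping.keys (c + r k *\<^sub>R w) \<subseteq> Poly_Mapping.keys c"
      using w by (auto simp: in_keys_iff lookup_add subset_iff)
    ultimately show "Poly_Mapping.keys (c + r k *\<^sub>R w) \<subset> Poly_Mapping.keys c"
      by blast
  qed
qed

lemma linear_sum_lookup: "linear (\<lambda>c :: 'i \<Rightarrow>\<^sub>0 real. \<Sum>i\<in>I. Poly_Mapping.lookup c i)"
  by (rule linearI) (auto simp: lookup_add sum.distrib sum_distrib_left)

text \<open>A solution whose support contains that of another one can be pushed along the difference
  in both directions until a coordinate vanishes. It lies between the two end points, whose supports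
  are smaller, and induction on the size of the support ends at finitely many solutions. The
  prescribed total \<open>t\<close> keeps the set bounded.\<close>

lemma polytope_nonneg_solutions:
  fixes L :: "('i \<Rightarrow>\<^sub>0 real) \<Rightarrow> 'b::real_vector" and z :: 'b and t :: real
  assumes I: "finite I" and L: "linear L"
  defines "P \<equiv> {c. Poly_Mapping.keys c \<subseteq> I \<and> (\<forall>i. Poly_Mapping.lookup c i \<ge> 0) \<and> L c = z \<and>
      (\<Sum>i\<in>I. Poly_Mapping.lookup c i) = t}"
  shows "polytope P"
proof -
  interpret L: linear L by (rule L)
  interpret S: linear "\<lambda>c :: 'i \<Rightarrow>\<^sub>0 real. \<Sum>i\<in>I. Poly_Mapping.lookup c i" by (rule linear_sum_lookup)
  \<comment> \<open>The vertices of \<open>P\<close> are the solutions that are determined by their support.\<close>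
  define E where "E = {c \<in> P. \<forall>c'\<in>P. Poly_Mapping.keys c' \<subseteq> Poly_Mapping.keys c \<longrightarrow> c' = c}"
  have "inj_on Poly_Mapping.keys E"
    unfolding E_def by (rule inj_onI) blast
  moreover have "Poly_Mapping.keys ` E \<subseteq> Pow I"
    by (auto simp: E_def P_def)
  ultimately have "finite E"
    using I by (meson finite_Pow_iff finite_subset inj_on_finite)
  \<comment> \<open>Only the linear equations are asked of \<open>c'\<close>, not nonnegativity, so
    that the step also applies to the reflected point \<open>c''\<close> below.\<close>
  have step: "\<exists>s>0. c + s *\<^sub>R (c' - c) \<in> P \<and> Poly_Mapping.keys (c + s *\<^sub>R (c' - c)) \<subset> Poly_Mapping.keys c"
    if cc': "c \<in> P" "Poly_Mapping.keys c' \<subseteq> Poly_Mapping.keys c" "c' \<noteq> c"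
      and L': "L c' = z" and s': "(\<Sum>i\<in>I. Poly_Mapping.lookup c' i) = t" for c c'
  proof -
    let ?w = "c' - c"
    have wI: "Poly_Mapping.keys ?w \<subseteq> Poly_Mapping.keys c"
      using cc' by (auto simp: in_keys_iff lookup_minus subset_iff)
    have w0: "(\<Sum>i\<in>I. Poly_Mapping.lookup ?w i) = 0"
      using S.diff [of c' c] cc'(1) s' by (simp add: P_def)
    have Lw: "L ?w = 0"
      using cc' L' by (simp add: P_def L.diff)
    \<comment> \<open>The entries of \<open>?w\<close> sum to zero, so one of them is negative
      unless all vanish.\<close>
    have "\<exists>j. Poly_Mapping.lookup ?w j < 0"
    proof (rule ccontr)
      assume "\<not> ?thesis"
      then have nn: "Poly_Mapping.lookup ?w j \<ge> 0" for j
        by (simp add: not_less)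
      have "Poly_Mapping.lookup ?w i = 0" if "i \<in> I" for i
        using w0 sum_nonneg_eq_0_iff [OF I, of "Poly_Mapping.lookup ?w"] nn that by blast
      moreover have "Poly_Mapping.lookup ?w i = 0" if "i \<notin> I" for i
        using that wI cc'(1) by (auto simp: P_def in_keys_iff subset_iff)
      ultimately have "?w = 0"
        by (intro poly_mapping_eqI) (metis lookup_zero)
      then show False
        using cc' by simp
    qed
    then obtain j where "Poly_Mapping.lookup ?w j < 0" ..
    moreover have "Poly_Mapping.lookup c i \<ge> 0" for i
      using cc' by (simp add: P_def)
    ultimately obtain s where s: "s > 0" "\<And>i. Poly_Mapping.lookup (c + s *\<^sub>R ?w) i \<ge> 0"
        "Poly_Mapping.keys (c + s *\<^sub>R ?w) \<subset> Poly_Mapping.keys c"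
      using nonneg_solution_boundary wI by metis
    moreover have "c + s *\<^sub>R ?w \<in> P"
    proof -
      have "(\<Sum>i\<in>I. Poly_Mapping.lookup (c + s *\<^sub>R ?w) i) = t"
        unfolding S.add S.scaleR w0 using cc' by (simp add: P_def)
      moreover have "L (c + s *\<^sub>R ?w) = z"
        unfolding L.add L.scaleR Lw using cc' by (simp add: P_def)
      moreover have "Poly_Mapping.keys (c + s *\<^sub>R ?w) \<subseteq> I"
        using s(3) cc'(1) by (auto simp: P_def)
      ultimately show ?thesis
        using s(2) by (simp add: P_def)
    qed
    ultimately show ?thesis by blast
  qed
  have "c \<in> convex hull E" if "c \<in> P" for c
    using that
  proof (induction "card (Poly_Mapping.keys c)" arbitrary: c rule: less_induct)
    case less
    show ?case
    proof (cases "c \<in> E")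
      case True
      then show ?thesis
        by (rule hull_inc)
    next
      case False
      then obtain c' where c': "c' \<in> P" "Poly_Mapping.keys c' \<subseteq> Poly_Mapping.keys c" "c' \<noteq> c"
        using less.prems by (auto simp: E_def)
      obtain s where s: "s > 0" "c + s *\<^sub>R (c' - c) \<in> P"
          "Poly_Mapping.keys (c + s *\<^sub>R (c' - c)) \<subset> Poly_Mapping.keys c"
        using step [of c c'] less.prems c' by (auto simp: P_def)
      define c'' where "c'' = c - (c' - c)"
      have "Poly_Mapping.keys c'' \<subseteq> Poly_Mapping.keys c" "c'' \<noteq> c"
        using c'(2,3) by (auto simp: c''_def in_keys_iff lookup_minus subset_iff)
      moreover have "L c'' = z" "(\<Sum>i\<in>I. Poly_Mapping.lookup c'' i) = t"
        unfolding c''_def L.diff S.diff using c'(1) less.prems by (auto simp: P_def)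
      ultimately obtain s' where s': "s' > 0" "c + s' *\<^sub>R (c'' - c) \<in> P"
          "Poly_Mapping.keys (c + s' *\<^sub>R (c'' - c)) \<subset> Poly_Mapping.keys c"
        using step [of c c''] less.prems by blast
      have hull: "c + s *\<^sub>R (c' - c) \<in> convex hull E" "c + s' *\<^sub>R (c'' - c) \<in> convex hull E"
        using s s' by (auto intro!: less.hyps psubset_card_mono)
      \<comment> \<open>The weights are inversely proportional to the distances \<open>s\<close> and
        \<open>s'\<close> travelled in the two opposite directions.\<close>
      have "c = (s' / (s + s')) *\<^sub>R (c + s *\<^sub>R (c' - c)) + (s / (s + s')) *\<^sub>R (c + s' *\<^sub>R (c'' - c))"
      proof (rule poly_mapping_eqI)
        fix i
        show "Poly_Mapping.lookup c i = Poly_Mapping.lookup ((s' / (s + s')) *\<^sub>R (c + s *\<^sub>R (c' - c)) + (s / (s + s')) *\<^sub>R (c + s' *\<^sub>R (c'' - c))) i"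
          using s(1) s'(1) by (simp add: c''_def lookup_add lookup_minus divide_simps) (simp add: algebra_simps)
      qed
      also have "\<dots> \<in> convex hull E"
        using s s' hull by (intro convexD [OF convex_convex_hull]) (auto simp: add_divide_distrib [symmetric])
      finally show ?thesis .
    qed
  qed
  moreover have "convex hull E \<subseteq> P"
  proof (rule hull_minimal)
    show "E \<subseteq> P"
      by (auto simp: E_def)
    show "convex P"
    proof (rule convexI)
      fix x y and u v :: real
      assume xy: "x \<in> P" "y \<in> P" and uv: "u \<ge> 0" "v \<ge> 0" "u + v = 1"
      have "(\<Sum>i\<in>I. Poly_Mapping.lookup (u *\<^sub>R x + v *\<^sub>R y) i) = u * t + v * t"
        unfolding S.add S.scaleR using xy by (simp add: P_def)
      moreover have "L (u *\<^sub>R x + v *\<^sub>R y) = u *\<^sub>R z + v *\<^sub>R z"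
        unfolding L.add L.scaleR using xy by (simp add: P_def)
      moreover have "Poly_Mapping.keys (u *\<^sub>R x + v *\<^sub>R y) \<subseteq> I"
      proof
        fix i assume "i \<in> Poly_Mapping.keys (u *\<^sub>R x + v *\<^sub>R y)"
        then have "i \<in> Poly_Mapping.keys x \<union> Poly_Mapping.keys y"
          by (auto simp: in_keys_iff lookup_add)
        then show "i \<in> I"
          using xy by (auto simp: P_def)
      qed
      ultimately show "u *\<^sub>R x + v *\<^sub>R y \<in> P"
        using uv xy by (simp add: P_def lookup_add flip: distrib_right scaleR_left_distrib)
    qed
  qed
  ultimately have "P = convex hull E"
    by blast
  with \<open>finite E\<close> show ?thesis
    unfolding polytope_def by blast
qed

text \<open>A point of the intersection is given by two systems of barycentric coordinates, on
  \<open>V\<close> and on \<open>W\<close>, that describe the same point. Such pairs are the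
  nonnegative solutions of a linear system, hence form a polytope, and \<open>g\<close> maps it
  linearly onto the intersection. The statement covers the infinite-dimensional space of
  realizations.\<close>

lemma polytope_Int_real_vector:
  fixes C D :: "'a::real_vector set"
  assumes "polytope C" "polytope D"
  shows "polytope (C \<inter> D)"
proof -
  obtain V W where fin: "finite V" "finite W" and C: "C = convex hull V" and D: "D = convex hull W"
    using assms by (auto simp: polytope_def)
  define I :: "('a + 'a) set" where "I = V <+> W"
  define g :: "('a + 'a \<Rightarrow>\<^sub>0 real) \<Rightarrow> 'a" where "g = (\<lambda>c. \<Sum>v\<in>V. Poly_Mapping.lookup c (Inl v) *\<^sub>R v)"
  define h :: "('a + 'a \<Rightarrow>\<^sub>0 real) \<Rightarrow> 'a" where "h = (\<lambda>c. \<Sum>w\<in>W. Poly_Mapping.lookup c (Inr w) *\<^sub>R w)"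
  define L where "L = (\<lambda>c. (g c - h c, \<Sum>v\<in>V. Poly_Mapping.lookup c (Inl v), \<Sum>w\<in>W. Poly_Mapping.lookup c (Inr w)))"
  have lin: "linear g" "linear h"
    unfolding g_def h_def
    by (auto intro!: linearI simp: lookup_add algebra_simps sum.distrib scaleR_sum_right)
  have "linear L"
    unfolding L_def
    by (rule linearI)
      (auto simp: linear_add [OF lin(1)] linear_add [OF lin(2)] linear_scale [OF lin(1)]
        linear_scale [OF lin(2)] lookup_add sum.distrib sum_distrib_left algebra_simps)
  \<comment> \<open>The total is 2 because each of the two systems of coordinates sums to
    one.\<close>
  define P where "P = {c. Poly_Mapping.keys c \<subseteq> I \<and> (\<forall>i. Poly_Mapping.lookup c i \<ge> 0) \<and> L c = (0, 1, 1) \<and>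
      (\<Sum>i\<in>I. Poly_Mapping.lookup c i) = 2}"
  have "polytope P"
    unfolding P_def using fin \<open>linear L\<close> by (intro polytope_nonneg_solutions) (auto simp: I_def)
  then have "polytope (g ` P)"
    by (rule polytope_linear_image [OF lin(1)])
  moreover have "g ` P = C \<inter> D"
  proof
    show "g ` P \<subseteq> C \<inter> D"
    proof (rule image_subsetI)
      fix c assume "c \<in> P"
      then have nn: "\<And>i. Poly_Mapping.lookup c i \<ge> 0" and gh: "g c = h c"
        and "(\<Sum>v\<in>V. Poly_Mapping.lookup c (Inl v)) = 1" "(\<Sum>w\<in>W. Poly_Mapping.lookup c (Inr w)) = 1"
        by (auto simp: P_def L_def)
      then have "g c \<in> C" "h c \<in> D"
        unfolding C D convex_hull_finite [OF fin(1)] convex_hull_finite [OF fin(2)] g_def h_def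
        by (auto intro: exI [of _ "\<lambda>v. Poly_Mapping.lookup c (Inl v)"] exI [of _ "\<lambda>w. Poly_Mapping.lookup c (Inr w)"])
      then show "g c \<in> C \<inter> D"
        using gh by simp
    qed
    show "C \<inter> D \<subseteq> g ` P"
    proof
      fix x assume "x \<in> C \<inter> D"
      then obtain a b where a: "\<And>v. v \<in> V \<Longrightarrow> a v \<ge> 0" "sum a V = 1" "(\<Sum>v\<in>V. a v *\<^sub>R v) = x"
        and b: "\<And>w. w \<in> W \<Longrightarrow> b w \<ge> 0" "sum b W = 1" "(\<Sum>w\<in>W. b w *\<^sub>R w) = x"
        unfolding C D convex_hull_finite [OF fin(1)] convex_hull_finite [OF fin(2)] by auto
      define c where "c = (\<Sum>i\<in>I. case_sum a b i *\<^sub>R unit_vec i)"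
      have finI: "finite I"
        using fin by (simp add: I_def)
      have lc: "Poly_Mapping.lookup c i = (if i \<in> I then case_sum a b i else 0)" for i
        unfolding c_def by (rule sum_unit_vec_lookup [OF finI])
      have lV: "Poly_Mapping.lookup c (Inl v) = a v" if "v \<in> V" for v
        using that by (simp add: lc I_def InlI)
      have lW: "Poly_Mapping.lookup c (Inr w) = b w" if "w \<in> W" for w
        using that by (simp add: lc I_def InrI)
      have "Poly_Mapping.lookup c i \<ge> 0" for i
        using a b by (auto simp: lc I_def)
      moreover have "Poly_Mapping.keys c \<subseteq> I"
        by (auto simp: in_keys_iff lc split: if_splits)
      moreover have "(\<Sum>v\<in>V. Poly_Mapping.lookup c (Inl v)) = 1" "(\<Sum>w\<in>W. Poly_Mapping.lookup c (Inr w)) = 1"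
        using a b by (simp_all add: lV lW cong: sum.cong)
      moreover have gx: "g c = x" "h c = x"
        using a b by (simp_all add: g_def h_def lV lW cong: sum.cong)
      moreover have "(\<Sum>i\<in>I. Poly_Mapping.lookup c i) = (\<Sum>v\<in>V. Poly_Mapping.lookup c (Inl v)) + (\<Sum>w\<in>W. Poly_Mapping.lookup c (Inr w))"
        unfolding I_def using fin by (simp add: sum.Plus)
      ultimately have "c \<in> P"
        by (simp add: P_def L_def)
      then show "x \<in> g ` P"
        using gx by blast
    qed
  qed
  ultimately show ?thesis
    by simp
qed

section \<open>Affine maps on convex sets and composition of PL maps\<close>

lemma affine_map_on_subset: "affine_map_on C f \<Longrightarrow> D \<subseteq> C \<Longrightarrow> affine_map_on D f"
  unfolding affine_map_on_def by blast

lemma linear_imp_affine_map_on: "linear f \<Longrightarrow> affine_map_on C f"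
  by (simp add: affine_map_on_def linear_add linear_scale)

text \<open>The graph turns affinity into convexity: facts about convex combinations and convex
  hulls pass to affine maps by applying them to the graph.\<close>

lemma affine_map_on_graph_convex:
  assumes "convex C" "affine_map_on C f"
  shows "convex ((\<lambda>x. (x, f x)) ` C)"
  unfolding convex_alt
proof (intro ballI allI impI)
  fix p q and u :: real
  assume "p \<in> (\<lambda>x. (x, f x)) ` C" "q \<in> (\<lambda>x. (x, f x)) ` C" and u: "0 \<le> u \<and> u \<le> 1"
  then obtain x y where xy: "x \<in> C" "y \<in> C" and pq: "p = (x, f x)" "q = (y, f y)"
    by blast
  have "(1 - u) *\<^sub>R p + u *\<^sub>R q = ((1 - u) *\<^sub>R x + u *\<^sub>R y, f ((1 - u) *\<^sub>R x + u *\<^sub>R y))"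
    using assms(2) xy u pq by (simp add: affine_map_on_def)
  moreover have "(1 - u) *\<^sub>R x + u *\<^sub>R y \<in> C"
    using assms(1) xy u by (simp add: convex_alt)
  ultimately show "(1 - u) *\<^sub>R p + u *\<^sub>R q \<in> (\<lambda>x. (x, f x)) ` C"
    by blast
qed

lemma affine_map_on_convex_combination:
  assumes "convex C" "affine_map_on C f" "finite S" "sum a S = 1"
    and "\<And>i. i \<in> S \<Longrightarrow> a i \<ge> 0" "\<And>i. i \<in> S \<Longrightarrow> x i \<in> C"
  shows "f (\<Sum>i\<in>S. a i *\<^sub>R x i) = (\<Sum>i\<in>S. a i *\<^sub>R f (x i))"
proof -
  have "(\<Sum>i\<in>S. a i *\<^sub>R (x i, f (x i))) \<in> (\<lambda>x. (x, f x)) ` C"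
    using assms by (intro convex_sum affine_map_on_graph_convex) auto
  then have "snd (\<Sum>i\<in>S. a i *\<^sub>R (x i, f (x i))) = f (fst (\<Sum>i\<in>S. a i *\<^sub>R (x i, f (x i))))"
    by auto
  then show ?thesis
    by (simp add: fst_sum snd_sum)
qed

lemma polytope_affine_image:
  assumes "polytope C" "affine_map_on C f"
  shows "polytope (f ` C)"
proof -
  obtain V where V: "finite V" "C = convex hull V"
    using assms by (auto simp: polytope_def)
  \<comment> \<open>The hull of the graph points over \<open>V\<close> lies in the graph and
    projects onto all of \<open>C\<close>, so it is the whole graph. Its second projection is then a
    linear image of a polytope.\<close>
  let ?G = "(\<lambda>x. (x, f x)) ` C" and ?H = "convex hull ((\<lambda>x. (x, f x)) ` V)"
  have "?H \<subseteq> ?G"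
    using V assms by (intro hull_minimal affine_map_on_graph_convex image_mono hull_subset)
      (auto intro: hull_inc)
  moreover have "fst ` ?H = C"
    unfolding V(2) by (simp add: convex_hull_linear_image [OF linear_fst] image_image)
  ultimately have "?G = ?H"
    by (force simp: image_iff subset_iff)
  then have "f ` C = snd ` ?H"
    by (metis (no_types, lifting) image_cong image_image snd_conv)
  moreover have "polytope ?H"
    using V(1) by (simp add: polytope_convex_hull)
  ultimately show ?thesis
    using polytope_linear_image [OF linear_snd] by metis
qed

lemma affine_map_on_inverse:
  assumes "convex C" "affine_map_on C f" "\<And>x. x \<in> C \<Longrightarrow> g (f x) = x"
  shows "affine_map_on (f ` C) g"
  unfolding affine_map_on_def
proof (intro ballI)
  fix y z and t :: real
  assume "y \<in> f ` C" "z \<in> f ` C" and t: "t \<in> {0..1}"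
  then obtain u v where uv: "u \<in> C" "v \<in> C" "y = f u" "z = f v"
    by blast
  have "(1 - t) *\<^sub>R u + t *\<^sub>R v \<in> C"
    using assms(1) uv t by (simp add: convex_alt)
  then have "g (f ((1 - t) *\<^sub>R u + t *\<^sub>R v)) = (1 - t) *\<^sub>R u + t *\<^sub>R v"
    by (rule assms(3))
  then show "g ((1 - t) *\<^sub>R y + t *\<^sub>R z) = (1 - t) *\<^sub>R g y + t *\<^sub>R g z"
    using assms(2,3) uv t by (simp add: affine_map_on_def)
qed

lemma affine_map_on_compose:
  assumes "affine_map_on C f" "affine_map_on D g" "f ` C \<subseteq> D"
  shows "affine_map_on C (g \<circ> f)"
  using assms by (simp add: affine_map_on_def image_subset_iff)

lemma convex_affine_preimage:
  assumes "convex C" "affine_map_on C f" "convex D"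
  shows "convex {x \<in> C. f x \<in> D}"
  using assms unfolding convex_alt affine_map_on_def by auto

lemma pl_map_on_compose:
  assumes hom: "homeomorphism S T f f'" and f: "pl_map_on S f" and g: "pl_map_on T g"
  shows "pl_map_on S (g \<circ> f)"
  unfolding pl_map_on_def
proof
  fix x assume x: "x \<in> S"
  then obtain F U where F: "finite F" "\<And>C. C \<in> F \<Longrightarrow> polytope C \<and> C \<subseteq> S \<and> affine_map_on C f"
    and U: "openin (top_of_set S) U" "x \<in> U" "U \<subseteq> \<Union>F"
    using f unfolding pl_map_on_def by metis
  have "f x \<in> T"
    using hom x by (auto simp: homeomorphism_def)
  then obtain F' U' where F': "finite F'" "\<And>D. D \<in> F' \<Longrightarrow> polytope D \<and> D \<subseteq> T \<and> affine_map_on D g"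
    and U': "openin (top_of_set T) U'" "f x \<in> U'" "U' \<subseteq> \<Union>F'"
    using g unfolding pl_map_on_def by metis
  \<comment> \<open>Cells on which \<open>f\<close> is affine and is followed by a single affine
    piece of \<open>g\<close>. Such a cell is a polytope because it is the image under
    \<open>f'\<close>, which is affine on the image of \<open>C\<close>, of the intersection of that
    image with \<open>D\<close>.\<close>
  define F'' where "F'' = {{x \<in> C. f x \<in> D} |C D. C \<in> F \<and> D \<in> F'}"
  have "finite F''"
    using F F' by (simp add: F''_def finite_image_set2)
  moreover have "polytope E \<and> E \<subseteq> S \<and> affine_map_on E (g \<circ> f)" if EF: "E \<in> F''" for E
  proof -
    obtain C D where CD: "C \<in> F" "D \<in> F'" and E: "E = {x \<in> C. f x \<in> D}"
      using EF unfolding F''_def by blast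
    have inv: "f' (f x) = x" if "x \<in> C" for x
      using that F(2) [OF CD(1)] hom by (auto simp: homeomorphism_def)
    have "polytope (f ` C \<inter> D)"
      using F(2) [OF CD(1)] F'(2) [OF CD(2)] by (intro polytope_Int_real_vector polytope_affine_image) auto
    moreover have "affine_map_on (f ` C \<inter> D) f'"
      using F(2) [OF CD(1)] affine_map_on_inverse [of C f f'] inv
      by (meson affine_map_on_subset inf_le1 polytope_imp_convex)
    ultimately have "polytope (f' ` (f ` C \<inter> D))"
      by (rule polytope_affine_image)
    moreover have "f' ` (f ` C \<inter> D) = E"
      unfolding E using inv by force
    moreover have "affine_map_on E (g \<circ> f)"
      using F(2) [OF CD(1)] F'(2) [OF CD(2)]
      by (intro affine_map_on_compose [where D = D]) (auto simp: E intro: affine_map_on_subset)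
    moreover have "E \<subseteq> S"
      using F(2) [OF CD(1)] by (auto simp: E)
    ultimately show ?thesis
      by simp
  qed
  moreover have "openin (top_of_set S) (U \<inter> (S \<inter> f -` U'))"
  proof (rule openin_Int [OF U(1)])
    show "openin (top_of_set S) (S \<inter> f -` U')"
      using hom U'(1) unfolding homeomorphism_def by (metis continuous_on_open)
  qed
  moreover have "x \<in> U \<inter> (S \<inter> f -` U')"
    using x U U' by auto
  moreover have "U \<inter> (S \<inter> f -` U') \<subseteq> \<Union>F''"
  proof
    fix y assume "y \<in> U \<inter> (S \<inter> f -` U')"
    then obtain C D where "C \<in> F" "y \<in> C" "D \<in> F'" "f y \<in> D"
      using U(3) U'(3) by blast
    then show "y \<in> \<Union>F''"
      unfolding F''_def by blast
  qed
  ultimately show "\<exists>F U. finite F \<and> (\<forall>C\<in>F. polytope C \<and> C \<subseteq> S \<and> affine_map_on C (g \<circ> f)) \<and>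
      openin (top_of_set S) U \<and> x \<in> U \<and> U \<subseteq> \<Union>F"
    by blast
qed

lemma pl_homeomorphic_trans:
  assumes "pl_homeomorphic R S" "pl_homeomorphic S T"
  shows "pl_homeomorphic R T"
proof -
  obtain f f' where f: "homeomorphism R S f f'" "pl_map_on R f" "pl_map_on S f'"
    using assms(1) by (auto simp: pl_homeomorphic_def)
  obtain g g' where g: "homeomorphism S T g g'" "pl_map_on S g" "pl_map_on T g'"
    using assms(2) by (auto simp: pl_homeomorphic_def)
  have "homeomorphism R T (g \<circ> f) (f' \<circ> g')"
    using homeomorphism_compose f g by blast
  moreover have "pl_map_on R (g \<circ> f)" "pl_map_on T (f' \<circ> g')"
    using f g homeomorphism_sym by (blast intro: pl_map_on_compose)+
  ultimately show ?thesis
    unfolding pl_homeomorphic_def by blast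
qed

section \<open>Realizations and stellar subdivisions\<close>

definition mass :: "('v \<Rightarrow>\<^sub>0 real) \<Rightarrow> real" where
  "mass x = (\<Sum>i\<in>Poly_Mapping.keys x. Poly_Mapping.lookup x i)"

lemma mass_eq_sum:
  assumes "finite I" "Poly_Mapping.keys x \<subseteq> I"
  shows "mass x = (\<Sum>i\<in>I. Poly_Mapping.lookup x i)"
  unfolding mass_def using assms by (intro sum.mono_neutral_left) (auto simp: in_keys_iff)

lemma mass_add: "mass (x + y) = mass x + mass y"
proof -
  let ?I = "Poly_Mapping.keys x \<union> Poly_Mapping.keys y"
  have "mass (x + y) = (\<Sum>i\<in>?I. Poly_Mapping.lookup (x + y) i)"
    by (rule mass_eq_sum) (auto simp: in_keys_iff lookup_add)
  also have "\<dots> = mass x + mass y"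
    by (simp add: lookup_add sum.distrib mass_eq_sum [of ?I])
  finally show ?thesis .
qed

lemma mass_scaleR: "mass (r *\<^sub>R x) = r * mass x"
proof -
  have "mass (r *\<^sub>R x) = (\<Sum>i\<in>Poly_Mapping.keys x. Poly_Mapping.lookup (r *\<^sub>R x) i)"
    by (rule mass_eq_sum) (auto simp: in_keys_iff)
  then show ?thesis
    by (simp add: mass_def sum_distrib_left)
qed

lemma linear_mass: "linear mass"
  by (rule linearI) (simp_all add: mass_add mass_scaleR)

lemma mass_unit_vec [simp]: "mass (unit_vec v) = 1"
  by (subst mass_eq_sum [of "{v}"]) (auto simp: in_keys_iff lookup_unit_vec split: if_splits)

lemma keys_unit_vec [simp]: "Poly_Mapping.keys (unit_vec v) = {v}"
  by (auto simp: in_keys_iff lookup_unit_vec split: if_splits)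

lemma convex_hull_unit_vec:
  assumes "finite s"
  shows "convex hull (unit_vec ` s) =
    {x. Poly_Mapping.keys x \<subseteq> s \<and> (\<forall>i. Poly_Mapping.lookup x i \<ge> 0) \<and> mass x = 1}" (is "_ = ?S")
proof
  show "convex hull (unit_vec ` s) \<subseteq> ?S"
  proof (rule hull_minimal)
    show "unit_vec ` s \<subseteq> ?S"
      by (auto simp: lookup_unit_vec)
    show "convex ?S"
    proof (rule convexI)
      fix x y :: "'a \<Rightarrow>\<^sub>0 real" and u v :: real
      assume xy: "x \<in> ?S" "y \<in> ?S" and uv: "u \<ge> 0" "v \<ge> 0" "u + v = 1"
      have "Poly_Mapping.keys (u *\<^sub>R x + v *\<^sub>R y) \<subseteq> Poly_Mapping.keys x \<union> Poly_Mapping.keys y"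
        by (auto simp: in_keys_iff lookup_add)
      then show "u *\<^sub>R x + v *\<^sub>R y \<in> ?S"
        using xy uv by (auto simp: lookup_add mass_add mass_scaleR)
    qed
  qed
  show "?S \<subseteq> convex hull (unit_vec ` s)"
  proof
    fix x assume x: "x \<in> ?S"
    have "(\<Sum>i\<in>s. Poly_Mapping.lookup x i *\<^sub>R unit_vec i) \<in> convex hull (unit_vec ` s)"
      using assms x mass_eq_sum [of s x] by (intro convex_sum convex_convex_hull) (auto intro: hull_inc)
    then show "x \<in> convex hull (unit_vec ` s)"
      using assms x by (simp add: sum_unit_vec)
  qed
qed

lemma realization_eq: "realization K = (\<Union>s\<in>K. convex hull (unit_vec ` s))"
  by (simp add: realization_def unit_vec_def [abs_def])

lemma finite_complex_downward: "finite_complex K \<Longrightarrow> s \<in> K \<Longrightarrow> t \<subseteq> s \<Longrightarrow> t \<in> K"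
  by (auto simp: finite_complex_def)

lemma finite_complex_finite: "finite_complex K \<Longrightarrow> s \<in> K \<Longrightarrow> finite s"
  by (auto simp: finite_complex_def)

lemma finite_complex_vertices: "finite_complex K \<Longrightarrow> finite (\<Union>K)"
  by (auto simp: finite_complex_def)

text \<open>The support of a point is the smallest simplex that contains it. Incidence questions
  about points of the realization thereby become questions about
  \<open>Poly_Mapping.keys\<close>.\<close>

lemma mem_realization:
  assumes "finite_complex K"
  shows "x \<in> realization K \<longleftrightarrow>
    Poly_Mapping.keys x \<in> K \<and> (\<forall>i. Poly_Mapping.lookup x i \<ge> 0) \<and> mass x = 1"
proof -
  have "x \<in> convex hull (unit_vec ` s) \<longleftrightarrow>
      Poly_Mapping.keys x \<subseteq> s \<and> (\<forall>i. Poly_Mapping.lookup x i \<ge> 0) \<and> mass x = 1" if "s \<in> K" for s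
    using convex_hull_unit_vec [OF finite_complex_finite [OF assms that]] by simp
  then show ?thesis
    unfolding realization_eq using finite_complex_downward [OF assms] by auto
qed

lemma realization_subset_coord_space:
  "finite_complex K \<Longrightarrow> realization K \<subseteq> coord_space (\<Union>K)"
  by (auto simp: mem_realization coord_space_def)

lemma compact_realization: "finite_complex K \<Longrightarrow> compact (realization K)"
  unfolding realization_eq
  by (intro compact_UN finite_imp_compact_convex_hull) (auto simp: finite_complex_def)

text \<open>A linear map on the infinite-dimensional space may be discontinuous, but on finitely
  many coordinates it is a finite sum of coordinate functions times fixed vectors.\<close>

lemma continuous_on_linear_coord_space:
  fixes F :: "('v \<Rightarrow>\<^sub>0 real) \<Rightarrow> 'b::real_normed_vector"
  assumes "finite I" "linear F"
  shows "continuous_on (coord_space I) F"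
proof -
  have "F x = (\<Sum>i\<in>I. Poly_Mapping.lookup x i *\<^sub>R F (unit_vec i))" if "x \<in> coord_space I" for x
  proof -
    have "F x = F (\<Sum>i\<in>I. Poly_Mapping.lookup x i *\<^sub>R unit_vec i)"
      using assms(1) that by (simp add: sum_unit_vec coord_space_def)
    then show ?thesis
      by (simp add: linear_sum [OF assms(2)] linear_scale [OF assms(2)])
  qed
  moreover have "continuous_on (coord_space I) (\<lambda>x. \<Sum>i\<in>I. Poly_Mapping.lookup x i *\<^sub>R F (unit_vec i))"
    by (intro continuous_intros)
  ultimately show ?thesis
    by (simp cong: continuous_on_cong)
qed

text \<open>Compactness of the realization makes the inverse continuous. The simplices serve as
  affine cells for \<open>F\<close>, and their images as cells for the inverse.\<close>

lemma pl_homeomorphic_linear_image: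
  fixes F :: "('v \<Rightarrow>\<^sub>0 real) \<Rightarrow> 'b::real_normed_vector"
  assumes K: "finite_complex K" and F: "linear F" and inj: "inj_on F (realization K)"
  shows "pl_homeomorphic (realization K) (F ` realization K)"
proof -
  have "continuous_on (realization K) F"
    using continuous_on_linear_coord_space [OF finite_complex_vertices [OF K] F]
      realization_subset_coord_space [OF K] continuous_on_subset by blast
  then obtain G where G: "homeomorphism (realization K) (F ` realization K) F G"
    using homeomorphism_compact [OF compact_realization [OF K]] inj by blast
  let ?C = "\<lambda>s. convex hull (unit_vec ` s)"
  have pt: "polytope (?C s)" if "s \<in> K" for s
    using finite_complex_finite [OF K that] by (simp add: polytope_convex_hull)
  have sub: "?C s \<subseteq> realization K" if "s \<in> K" for s
    using that by (auto simp: realization_eq)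
  have "pl_map_on (realization K) F"
    unfolding pl_map_on_def
  proof
    fix x assume "x \<in> realization K"
    moreover have "finite (?C ` K)"
      using K by (simp add: finite_complex_def)
    ultimately show "\<exists>D U. finite D \<and> (\<forall>C\<in>D. polytope C \<and> C \<subseteq> realization K \<and> affine_map_on C F) \<and>
        openin (top_of_set (realization K)) U \<and> x \<in> U \<and> U \<subseteq> \<Union>D"
      using pt sub linear_imp_affine_map_on [OF F]
      by (intro exI [of _ "?C ` K"] exI [of _ "realization K"]) (auto simp: realization_eq)
  qed
  moreover have "pl_map_on (F ` realization K) G"
    unfolding pl_map_on_def
  proof
    fix y assume "y \<in> F ` realization K"
    moreover have "finite ((\<lambda>s. F ` ?C s) ` K)"
      using K by (simp add: finite_complex_def)
    moreover have "affine_map_on (F ` ?C s) G" if "s \<in> K" for s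
      using G sub [OF that] linear_imp_affine_map_on [OF F]
      by (intro affine_map_on_inverse) (auto simp: homeomorphism_def)
    moreover have "F ` ?C s \<subseteq> F ` realization K" if "s \<in> K" for s
      using sub [OF that] by (rule image_mono)
    moreover have "F ` realization K \<subseteq> \<Union>((\<lambda>s. F ` ?C s) ` K)"
      by (auto simp: realization_eq)
    ultimately show "\<exists>D U. finite D \<and> (\<forall>C\<in>D. polytope C \<and> C \<subseteq> F ` realization K \<and> affine_map_on C G) \<and>
        openin (top_of_set (F ` realization K)) U \<and> y \<in> U \<and> U \<subseteq> \<Union>D"
      using pt polytope_linear_image [OF F]
      by (intro exI [of _ "(\<lambda>s. F ` ?C s) ` K"] exI [of _ "F ` realization K"]) auto
  qed
  ultimately show ?thesis
    using G unfolding pl_homeomorphic_def by blast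
qed

lemma triangulation_cong:
  assumes "triangulation M T" "finite_complex K" "pl_homeomorphic (realization K) (realization T)"
  shows "triangulation M K"
  using assms pl_homeomorphic_trans unfolding triangulation_def by blast

lemma finite_complex_image: "finite_complex K \<Longrightarrow> finite_complex ((`) f ` K)"
  unfolding finite_complex_def by (auto simp: subset_image_iff)

text \<open>The relabelling extends to a linear map that sends unit vectors to unit vectors and
  therefore simplices onto simplices.\<close>

lemma pl_homeomorphic_relabel:
  assumes K: "finite_complex K" and f: "inj_on f (\<Union>K)"
  shows "pl_homeomorphic (realization K) (realization ((`) f ` K))"
proof -
  define F where "F = (\<lambda>x. \<Sum>i\<in>\<Union>K. Poly_Mapping.lookup x i *\<^sub>R unit_vec (f i))"
  have fin: "finite (\<Union>K)"
    by (rule finite_complex_vertices [OF K])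
  have lin: "linear F"
    unfolding F_def by (rule linearI) (auto simp: lookup_add algebra_simps sum.distrib scaleR_sum_right)
  have F_unit: "F (unit_vec i) = unit_vec (f i)" if "i \<in> \<Union>K" for i
  proof -
    have "F (unit_vec i) = (\<Sum>j\<in>\<Union>K. if j = i then unit_vec (f j) else 0)"
      unfolding F_def by (intro sum.cong) (auto simp: lookup_unit_vec)
    then show ?thesis
      using fin that by simp
  qed
  have lookup_F: "Poly_Mapping.lookup (F x) (f i) = Poly_Mapping.lookup x i" if "i \<in> \<Union>K" for x i
  proof -
    have "Poly_Mapping.lookup (F x) (f i) = (\<Sum>j\<in>\<Union>K. if j = i then Poly_Mapping.lookup x j else 0)"
      unfolding F_def lookup_sum_scaleR
      using f that by (intro sum.cong) (auto simp: lookup_unit_vec inj_on_def)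
    then show ?thesis
      using fin that by simp
  qed
  have "inj_on F (realization K)"
  proof (rule inj_onI, rule poly_mapping_eqI)
    fix x y i
    assume xy: "x \<in> realization K" "y \<in> realization K" "F x = F y"
    show "Poly_Mapping.lookup x i = Poly_Mapping.lookup y i"
    proof (cases "i \<in> \<Union>K")
      case True
      then show ?thesis
        using lookup_F xy by metis
    next
      case False
      then show ?thesis
        using xy realization_subset_coord_space [OF K] by (auto simp: coord_space_iff subset_iff)
    qed
  qed
  moreover have "F ` realization K = realization ((`) f ` K)"
  proof -
    have "F ` (convex hull (unit_vec ` s)) = convex hull (unit_vec ` f ` s)" if "s \<in> K" for s
    proof -
      have "F ` unit_vec ` s = unit_vec ` f ` s"
        unfolding image_image using F_unit that by (intro image_cong) auto
      then show ?thesis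
        by (simp add: convex_hull_linear_image [OF lin])
    qed
    then show ?thesis
      by (simp add: realization_eq image_UN)
  qed
  ultimately show ?thesis
    using pl_homeomorphic_linear_image [OF K lin] by simp
qed

lemma pl_homeomorphic_sym: "pl_homeomorphic S T \<Longrightarrow> pl_homeomorphic T S"
  unfolding pl_homeomorphic_def using homeomorphism_sym by blast

lemma triangulation_isomorphic:
  assumes "triangulation M T" "isomorphic_complex T T'"
  shows "triangulation M T'"
proof -
  obtain f where f: "bij_betw f (\<Union>T) (\<Union>T')" "T' = (`) f ` T"
    using assms(2) by (auto simp: isomorphic_complex_def)
  have T: "finite_complex T"
    using assms(1) by (simp add: triangulation_def)
  show ?thesis
  proof (rule triangulation_cong [OF assms(1)])
    show "finite_complex T'"
      using finite_complex_image [OF T] f by simp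
    show "pl_homeomorphic (realization T') (realization T)"
      using pl_homeomorphic_sym [OF pl_homeomorphic_relabel [OF T]] f by (auto simp: bij_betw_def)
  qed
qed

text \<open>The simplices outside the open star of \<alpha>, together with the cone from
  \<open>v\<close> over the join of the boundary of \<alpha> with its link: the simplices of this
  join are exactly the \<open>s\<close> with \<open>\<not> \<alpha> \<subseteq> s\<close> and
  \<open>s \<union> \<alpha> \<in> K\<close>. Both facets and ridges are subdivided below.\<close>

definition stellar_subdivision :: "'v set set \<Rightarrow> 'v set \<Rightarrow> 'v \<Rightarrow> 'v set set" where
  "stellar_subdivision K \<alpha> v =
     {s \<in> K. \<not> \<alpha> \<subseteq> s} \<union> insert v ` {s \<in> K. \<not> \<alpha> \<subseteq> s \<and> s \<union> \<alpha> \<in> K}"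

lemma finite_complex_stellar_subdivision:
  assumes K: "finite_complex K" and \<alpha>: "\<alpha> \<noteq> {}"
  shows "finite_complex (stellar_subdivision K \<alpha> v)"
proof -
  have "t \<in> stellar_subdivision K \<alpha> v" if "s \<in> stellar_subdivision K \<alpha> v" and ts: "t \<subseteq> s" for s t
    using that(1) unfolding stellar_subdivision_def
  proof (elim UnE imageE)
    assume "s \<in> {s \<in> K. \<not> \<alpha> \<subseteq> s}"
    then show "t \<in> {s \<in> K. \<not> \<alpha> \<subseteq> s} \<union> insert v ` {s \<in> K. \<not> \<alpha> \<subseteq> s \<and> s \<union> \<alpha> \<in> K}"
      using ts finite_complex_downward [OF K] by blast
  next
    fix r assume r: "s = insert v r" "r \<in> {s \<in> K. \<not> \<alpha> \<subseteq> s \<and> s \<union> \<alpha> \<in> K}"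
    then have "t - {v} \<subseteq> r"
      using ts by blast
    then have "t - {v} \<in> K" "\<not> \<alpha> \<subseteq> t - {v}" "t - {v} \<union> \<alpha> \<in> K"
      using r(2) finite_complex_downward [OF K, of r "t - {v}"]
        finite_complex_downward [OF K, of "r \<union> \<alpha>" "t - {v} \<union> \<alpha>"] by blast+
    moreover have "v \<notin> t \<Longrightarrow> t = t - {v}" "v \<in> t \<Longrightarrow> t = insert v (t - {v})"
      by auto
    ultimately show "t \<in> {s \<in> K. \<not> \<alpha> \<subseteq> s} \<union> insert v ` {s \<in> K. \<not> \<alpha> \<subseteq> s \<and> s \<union> \<alpha> \<in> K}"
      by (cases "v \<in> t") (metis (mono_tags, lifting) UnI2 image_eqI mem_Collect_eq, metis (mono_tags, lifting) UnI1 mem_Collect_eq)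
  qed
  moreover have "finite (stellar_subdivision K \<alpha> v)" "{} \<in> stellar_subdivision K \<alpha> v"
      "\<forall>s\<in>stellar_subdivision K \<alpha> v. finite s"
    using K \<alpha> by (auto simp: stellar_subdivision_def finite_complex_def)
  ultimately show ?thesis
    by (auto simp: finite_complex_def)
qed

text \<open>Every point of the subdivision has a vanishing coordinate in \<alpha>. This determines
  how much of its image under the linear map comes from \<open>v\<close>, and so makes the map
  injective.\<close>

lemma pl_homeomorphic_stellar_subdivision:
  assumes K: "finite_complex K" and \<alpha>: "\<alpha> \<in> K" "\<alpha> \<noteq> {}" and v: "v \<notin> \<Union>K"
  shows "pl_homeomorphic (realization (stellar_subdivision K \<alpha> v)) (realization K)"
proof -
  have fin: "finite \<alpha>" and card: "card \<alpha> > 0"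
    using K \<alpha> finite_complex_finite card_gt_0_iff by blast+
  have v\<alpha>: "v \<notin> \<alpha>"
    using v \<alpha> by blast
  have SK: "finite_complex (stellar_subdivision K \<alpha> v)"
    by (rule finite_complex_stellar_subdivision [OF K \<alpha>(2)])
  \<comment> \<open>The linear map that moves the new vertex to the barycentre of \<open>\<alpha>\<close>.\<close>
  define b :: "'a \<Rightarrow>\<^sub>0 real" where "b = (\<Sum>i\<in>\<alpha>. (1 / card \<alpha>) *\<^sub>R unit_vec i)"
  define F where "F = (\<lambda>x. x + Poly_Mapping.lookup x v *\<^sub>R (b - unit_vec v))"
  have lookup_b: "Poly_Mapping.lookup b i = (if i \<in> \<alpha> then 1 / card \<alpha> else 0)" for i
    unfolding b_def by (rule sum_unit_vec_lookup [OF fin])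
  have mass_b: "mass b = 1"
  proof -
    have "mass b = (\<Sum>i\<in>\<alpha>. Poly_Mapping.lookup b i)"
      by (rule mass_eq_sum [OF fin]) (auto simp: in_keys_iff lookup_b split: if_splits)
    then show ?thesis
      using card by (simp add: lookup_b)
  qed
  have mass_diff: "mass (b - unit_vec v) = 0"
    using mass_b linear_diff [OF linear_mass, of b "unit_vec v"] by simp
  have lin: "linear F"
    unfolding F_def by (rule linearI) (simp_all add: lookup_add algebra_simps)
  have lookup_F: "Poly_Mapping.lookup (F x) i =
      (if i = v then 0 else if i \<in> \<alpha> then Poly_Mapping.lookup x i + Poly_Mapping.lookup x v / card \<alpha>
       else Poly_Mapping.lookup x i)" for x i
    using v\<alpha> by (simp add: F_def lookup_add lookup_minus lookup_b lookup_unit_vec)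
  have mass_F: "mass (F x) = mass x" for x
    by (simp add: F_def mass_add mass_scaleR mass_diff)
  have zero: "\<exists>i\<in>\<alpha>. Poly_Mapping.lookup x i = 0" if "x \<in> realization (stellar_subdivision K \<alpha> v)" for x
  proof -
    have "Poly_Mapping.keys x \<in> stellar_subdivision K \<alpha> v"
      using that by (simp add: mem_realization [OF SK])
    then have "\<not> \<alpha> \<subseteq> Poly_Mapping.keys x"
      using v\<alpha> by (auto simp: stellar_subdivision_def)
    then show ?thesis
      by (auto simp: in_keys_iff)
  qed
  have "inj_on F (realization (stellar_subdivision K \<alpha> v))"
  proof (rule inj_onI)
    \<comment> \<open>The two images are compared at a coordinate of \<alpha> where \<open>x\<close>
      vanishes: there the image of \<open>x\<close> shows only its share of the weight at
      \<open>v\<close>. Equality follows by exchanging \<open>x\<close> and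
      \<open>y\<close>.\<close>
    have *: "Poly_Mapping.lookup y v \<le> Poly_Mapping.lookup x v"
      if xy: "x \<in> realization (stellar_subdivision K \<alpha> v)" "y \<in> realization (stellar_subdivision K \<alpha> v)"
        "F x = F y" for x y
    proof -
      obtain i where i: "i \<in> \<alpha>" "Poly_Mapping.lookup x i = 0"
        using zero xy by blast
      then have "Poly_Mapping.lookup x v / card \<alpha> = Poly_Mapping.lookup y i + Poly_Mapping.lookup y v / card \<alpha>"
        using lookup_F [of x i] lookup_F [of y i] xy(3) v\<alpha> by (metis add_0)
      moreover have "Poly_Mapping.lookup y i \<ge> 0"
        using xy by (simp add: mem_realization [OF SK])
      ultimately have "Poly_Mapping.lookup y v / card \<alpha> \<le> Poly_Mapping.lookup x v / card \<alpha>"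
        by linarith
      then show ?thesis
        using card by (simp add: divide_le_cancel)
    qed
    fix x y
    assume xy: "x \<in> realization (stellar_subdivision K \<alpha> v)" "y \<in> realization (stellar_subdivision K \<alpha> v)"
        "F x = F y"
    then have eq: "Poly_Mapping.lookup x v = Poly_Mapping.lookup y v"
      using * by (metis order_antisym)
    show "x = y"
    proof (rule poly_mapping_eqI)
      fix i
      show "Poly_Mapping.lookup x i = Poly_Mapping.lookup y i"
        using lookup_F [of x i] lookup_F [of y i] xy(3) eq by (auto split: if_splits)
    qed
  qed
  moreover have "F ` realization (stellar_subdivision K \<alpha> v) = realization K"
  proof
    show "F ` realization (stellar_subdivision K \<alpha> v) \<subseteq> realization K"
    proof (rule image_subsetI)
      fix x assume x: "x \<in> realization (stellar_subdivision K \<alpha> v)"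
      then have nn: "\<And>i. Poly_Mapping.lookup x i \<ge> 0" and 1: "mass x = 1"
        and keys: "Poly_Mapping.keys x \<in> stellar_subdivision K \<alpha> v"
        by (simp_all add: mem_realization [OF SK])
      have "Poly_Mapping.keys (F x) \<in> K"
        using keys unfolding stellar_subdivision_def
      proof (elim UnE imageE)
        assume k: "Poly_Mapping.keys x \<in> {s \<in> K. \<not> \<alpha> \<subseteq> s}"
        then have "Poly_Mapping.lookup x v = 0"
          using v by (auto simp: in_keys_iff)
        then show ?thesis
          using k by (simp add: F_def)
      next
        fix s assume s: "Poly_Mapping.keys x = insert v s" "s \<in> {s \<in> K. \<not> \<alpha> \<subseteq> s \<and> s \<union> \<alpha> \<in> K}"
        have "Poly_Mapping.keys (F x) \<subseteq> s \<union> \<alpha>"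
        proof
          fix i assume "i \<in> Poly_Mapping.keys (F x)"
          then have "i \<noteq> v" "i \<in> \<alpha> \<or> Poly_Mapping.lookup x i \<noteq> 0"
            by (auto simp: in_keys_iff lookup_F split: if_splits)
          then show "i \<in> s \<union> \<alpha>"
            using s(1) by (auto simp flip: in_keys_iff)
        qed
        then show ?thesis
          using s finite_complex_downward [OF K] by blast
      qed
      moreover have "Poly_Mapping.lookup (F x) i \<ge> 0" for i
        using nn by (auto simp: lookup_F)
      ultimately show "F x \<in> realization K"
        using 1 by (simp add: mem_realization [OF K] mass_F)
    qed
    show "realization K \<subseteq> F ` realization (stellar_subdivision K \<alpha> v)"
    proof
      fix y assume "y \<in> realization K"
      then have nn: "\<And>i. Poly_Mapping.lookup y i \<ge> 0" and 1: "mass y = 1"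
        and keys: "Poly_Mapping.keys y \<in> K"
        by (simp_all add: mem_realization [OF K])
      have yv: "Poly_Mapping.lookup y v = 0"
        using v keys by (auto simp: in_keys_iff)
      obtain k where k: "k \<in> \<alpha>" "\<And>i. i \<in> \<alpha> \<Longrightarrow> Poly_Mapping.lookup y k \<le> Poly_Mapping.lookup y i"
        using arg_min_if_finite [OF fin \<alpha>(2), of "Poly_Mapping.lookup y"] by (metis linorder_not_le)
      \<comment> \<open>The inverse of \<open>F\<close>: the smallest weight \<open>m\<close> on
        \<alpha> is taken off every vertex of \<alpha>, and the collected weight
        \<open>m * card \<alpha>\<close> is put on \<open>v\<close>.\<close>
      define m where "m = Poly_Mapping.lookup y k"
      define x where "x = y - (m * card \<alpha>) *\<^sub>R (b - unit_vec v)"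
      have lookup_x: "Poly_Mapping.lookup x i = (if i = v then m * card \<alpha> else if i \<in> \<alpha> then Poly_Mapping.lookup y i - m
          else Poly_Mapping.lookup y i)" for i
        using v\<alpha> yv card by (simp add: x_def lookup_minus lookup_b lookup_unit_vec)
      have Fx: "F x = y"
        using yv card by (intro poly_mapping_eqI) (simp add: lookup_F lookup_x)
      have m0: "m \<ge> 0"
        using nn by (simp add: m_def)
      have "Poly_Mapping.lookup x i \<ge> 0" for i
        using nn m0 k by (auto simp: lookup_x m_def)
      moreover have "mass x = 1"
        using mass_F [of x] Fx 1 by simp
      moreover have "Poly_Mapping.keys x \<in> stellar_subdivision K \<alpha> v"
      proof (cases "m = 0")
        case True
        then have "x = y"
          by (simp add: x_def)
        moreover have "k \<notin> Poly_Mapping.keys y"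
          using True by (simp add: in_keys_iff m_def)
        ultimately show ?thesis
          using keys k by (auto simp: stellar_subdivision_def)
      next
        case False
        then have mpos: "m > 0"
          using m0 by simp
        \<comment> \<open>The vertices of \<alpha> where the minimum is attained are those that lose
          their whole weight.\<close>
        define s where "s = Poly_Mapping.keys y - {i \<in> \<alpha>. Poly_Mapping.lookup y i = m}"
        have sub: "\<alpha> \<subseteq> Poly_Mapping.keys y"
        proof
          fix i assume "i \<in> \<alpha>"
          then have "Poly_Mapping.lookup y i \<ge> m"
            using k by (simp add: m_def)
          then show "i \<in> Poly_Mapping.keys y"
            using mpos by (simp add: in_keys_iff)
        qed
        have "s \<union> \<alpha> = Poly_Mapping.keys y"
          using sub by (auto simp: s_def)
        then have "s \<union> \<alpha> \<in> K"
          using keys by simp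
        moreover have "\<not> \<alpha> \<subseteq> s"
          using k by (auto simp: s_def m_def)
        moreover have "s \<in> K"
          using finite_complex_downward [OF K keys] by (auto simp: s_def)
        moreover have "Poly_Mapping.keys x = insert v s"
        proof (rule Set.set_eqI)
          fix i
          have "i \<in> \<alpha> \<Longrightarrow> Poly_Mapping.lookup y i \<noteq> 0"
            using sub by (auto simp flip: in_keys_iff)
          then show "i \<in> Poly_Mapping.keys x \<longleftrightarrow> i \<in> insert v s"
            using mpos card by (cases "i = v") (auto simp: in_keys_iff lookup_x s_def)
        qed
        ultimately show ?thesis
          by (simp add: stellar_subdivision_def)
      qed
      ultimately have "x \<in> realization (stellar_subdivision K \<alpha> v)"
        by (simp add: mem_realization [OF SK])
      then show "y \<in> F ` realization (stellar_subdivision K \<alpha> v)"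
        using Fx by blast
    qed
  qed
  ultimately show ?thesis
    using pl_homeomorphic_linear_image [OF SK lin] by simp
qed

lemma triangulation_stellar_subdivision:
  assumes "triangulation M T" "\<alpha> \<in> T" "\<alpha> \<noteq> {}" "v \<notin> \<Union>T"
  shows "triangulation M (stellar_subdivision T \<alpha> v)"
  using assms triangulation_cong finite_complex_stellar_subdivision pl_homeomorphic_stellar_subdivision
  by (metis triangulation_def)

section \<open>Local structure of triangulated manifolds\<close>

definition bary :: "'v set \<Rightarrow> 'v \<Rightarrow>\<^sub>0 real" where
  "bary s = (\<Sum>i\<in>s. (1 / card s) *\<^sub>R unit_vec i)"

lemma lookup_bary: "finite s \<Longrightarrow> Poly_Mapping.lookup (bary s) i = (if i \<in> s then 1 / card s else 0)"
  unfolding bary_def by (rule sum_unit_vec_lookup)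

lemma keys_bary:
  assumes "finite s"
  shows "Poly_Mapping.keys (bary s) = s"
proof (rule Set.set_eqI)
  fix i
  show "i \<in> Poly_Mapping.keys (bary s) \<longleftrightarrow> i \<in> s"
    using assms by (cases "i \<in> s") (auto simp: in_keys_iff lookup_bary)
qed

lemma mass_bary: "finite s \<Longrightarrow> s \<noteq> {} \<Longrightarrow> mass (bary s) = 1"
  by (simp add: mass_def keys_bary lookup_bary)

lemma bary_mem_realization:
  assumes "finite_complex K" "s \<in> K" "s \<noteq> {}"
  shows "bary s \<in> realization K"
  using assms finite_complex_finite [OF assms(1,2)]
  by (simp add: mem_realization keys_bary mass_bary lookup_bary)

lemma continuous_on_mass: "finite I \<Longrightarrow> continuous_on (coord_space I) mass"
  by (rule continuous_on_linear_coord_space [OF _ linear_mass])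

lemma openin_coord_pos:
  assumes "finite s" "\<And>i. i \<in> s \<Longrightarrow> continuous_on S (f i)"
  shows "openin (top_of_set S) {x \<in> S. \<forall>i\<in>s. (f i x :: real) > 0}"
proof (cases "s = {}")
  case False
  have "openin (top_of_set S) (\<Inter>i\<in>s. S \<inter> f i -` {0<..})"
  proof (rule openin_INT2 [OF assms(1) False])
    fix i assume "i \<in> s"
    then show "openin (top_of_set S) (S \<inter> f i -` {0<..})"
      using assms(2) by (simp add: continuous_openin_preimage_gen)
  qed
  moreover have "(\<Inter>i\<in>s. S \<inter> f i -` {0<..}) = {x \<in> S. \<forall>i\<in>s. f i x > 0}"
    using False by auto
  ultimately show ?thesis
    by simp
qed simp

lemma mass_minus: "mass (x - y) = mass x - mass y"
  by (rule linear_diff [OF linear_mass])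

locale triangulated_manifold =
  fixes d :: nat and M :: "'a::euclidean_space set" and T :: "nat set set"
  assumes d2: "d \<ge> 2"
    and mfd: "closed_connected_pl_manifold d M"
    and tri: "triangulation M T"
begin

abbreviation X :: "(nat \<Rightarrow>\<^sub>0 real) set" where "X \<equiv> realization T"

lemma cpx: "finite_complex T"
  using tri by (simp add: triangulation_def)

lemma mem_X: "x \<in> X \<longleftrightarrow> Poly_Mapping.keys x \<in> T \<and> (\<forall>i. Poly_Mapping.lookup x i \<ge> 0) \<and> mass x = 1"
  by (rule mem_realization [OF cpx])

lemma X_connected: "connected X" and X_nonempty: "X \<noteq> {}"
proof -
  obtain f g where fg: "homeomorphism X M f g"
    using tri by (auto simp: triangulation_def pl_homeomorphic_def)
  then have g: "continuous_on M g" "g ` M = X"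
    by (simp_all add: homeomorphism_def)
  have "connected M" "M \<noteq> {}"
    using mfd by (simp_all add: closed_connected_pl_manifold_def)
  then show "connected X" "X \<noteq> {}"
    using connected_continuous_image [OF g(1)] g(2) by auto
qed

text \<open>The chart of \<open>M\<close> at the image of \<open>x\<close> is composed with the
  triangulating homeomorphism; near \<open>x\<close> the composite is affine on finitely many
  pieces. These are recorded only as convex sets, which is what the linear extension of affine maps
  works with.\<close>

lemma pl_chart:
  assumes "x \<in> X"
  obtains U W \<phi> \<psi> F where
    "openin (top_of_set X) U" "x \<in> U" "openin (top_of_set (real_space d)) (\<phi> ` U)"
    "homeomorphism U (\<phi> ` U) \<phi> \<psi>"
    "finite F" "\<And>D. D \<in> F \<Longrightarrow> convex D \<and> D \<subseteq> U \<and> affine_map_on D \<phi>"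
    "openin (top_of_set X) W" "x \<in> W" "W \<subseteq> \<Union>F"
proof -
  obtain f f' where f: "homeomorphism X M f f'" "pl_map_on X f"
    using tri by (auto simp: triangulation_def pl_homeomorphic_def)
  have fx: "f x \<in> M"
    using f assms by (auto simp: homeomorphism_def)
  then obtain UM V where UM: "openin (top_of_set M) UM" "f x \<in> UM"
    and V: "openin (top_of_set (real_space d)) V" and pl: "pl_homeomorphic UM V"
    using mfd unfolding closed_connected_pl_manifold_def pl_manifold_def by blast
  obtain c c' where c: "homeomorphism UM V c c'" "pl_map_on UM c"
    using pl by (auto simp: pl_homeomorphic_def)
  obtain F1 W1 where F1: "finite F1" "\<And>C. C \<in> F1 \<Longrightarrow> polytope C \<and> C \<subseteq> X \<and> affine_map_on C f"
    and W1: "openin (top_of_set X) W1" "x \<in> W1" "W1 \<subseteq> \<Union>F1"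
    using f(2) assms unfolding pl_map_on_def by metis
  obtain F2 W2 where F2: "finite F2" "\<And>C. C \<in> F2 \<Longrightarrow> polytope C \<and> C \<subseteq> UM \<and> affine_map_on C c"
    and W2: "openin (top_of_set UM) W2" "f x \<in> W2" "W2 \<subseteq> \<Union>F2"
    using c(2) UM unfolding pl_map_on_def by metis
  define U where "U = X \<inter> f -` UM"
  define F where "F = {{y \<in> C. f y \<in> E} |C E. C \<in> F1 \<and> E \<in> F2}"
  have cf: "continuous_on X f" "f ` X = M"
    using f by (auto simp: homeomorphism_def)
  have pre: "openin (top_of_set X) (X \<inter> f -` S)" if "openin (top_of_set M) S" for S
    using cf that by (simp add: continuous_on_open)
  have UMM: "UM \<subseteq> M"
    using UM openin_imp_subset by blast
  have fU: "f ` U = UM"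
    using cf UMM by (auto simp: U_def)
  have hU: "homeomorphism U UM f f'"
    by (rule homeomorphism_of_subsets [OF f(1)]) (use fU UMM in \<open>auto simp: U_def\<close>)
  have hc: "homeomorphism U V (c \<circ> f) (f' \<circ> c')"
    by (rule homeomorphism_compose [OF hU c(1)])
  then have img: "(c \<circ> f) ` U = V"
    by (simp add: homeomorphism_def)
  show ?thesis
  proof (rule that [of U "c \<circ> f" "f' \<circ> c'" F "W1 \<inter> (X \<inter> f -` W2)"])
    show "openin (top_of_set X) U"
      unfolding U_def by (rule pre [OF UM(1)])
    show "x \<in> U"
      using assms UM by (simp add: U_def)
    show "openin (top_of_set (real_space d)) ((c \<circ> f) ` U)"
      unfolding img by (rule V)
    show "homeomorphism U ((c \<circ> f) ` U) (c \<circ> f) (f' \<circ> c')"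
      unfolding img by (rule hc)
    show "finite F"
      using F1(1) F2(1) by (simp add: F_def finite_image_set2)
    show "convex D \<and> D \<subseteq> U \<and> affine_map_on D (c \<circ> f)" if DF: "D \<in> F" for D
    proof -
      obtain C E where CE: "C \<in> F1" "E \<in> F2" and D: "D = {y \<in> C. f y \<in> E}"
        using DF unfolding F_def by blast
      have "convex D"
        unfolding D using F1(2) [OF CE(1)] F2(2) [OF CE(2)]
        by (intro convex_affine_preimage) (auto simp: polytope_imp_convex)
      moreover have "D \<subseteq> U"
        using F1(2) [OF CE(1)] F2(2) [OF CE(2)] by (auto simp: D U_def)
      moreover have "affine_map_on D (c \<circ> f)"
        using F1(2) [OF CE(1)] F2(2) [OF CE(2)]
        by (intro affine_map_on_compose [where D = E]) (auto simp: D intro: affine_map_on_subset)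
      ultimately show ?thesis
        by blast
    qed
    show "openin (top_of_set X) (W1 \<inter> (X \<inter> f -` W2))"
      using W1(1) pre [OF openin_trans [OF W2(1) UM(1)]] by (rule openin_Int)
    show "x \<in> W1 \<inter> (X \<inter> f -` W2)"
      using assms W1 W2 by simp
    show "W1 \<inter> (X \<inter> f -` W2) \<subseteq> \<Union>F"
    proof
      fix y assume "y \<in> W1 \<inter> (X \<inter> f -` W2)"
      then obtain C E where "C \<in> F1" "y \<in> C" "E \<in> F2" "f y \<in> E"
        using W1(3) W2(3) by blast
      then show "y \<in> \<Union>F"
        unfolding F_def by blast
    qed
  qed
qed

text \<open>Composed with a chart, \<open>e\<close> becomes an injective continuous map between
  coordinate spaces, to which invariance of dimension and of domain apply. This bounds dimensions
  from above and shows that a patch of dimension \<open>d\<close> fills a neighbourhood.\<close>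

lemma embedding_open:
  fixes e :: "('v \<Rightarrow>\<^sub>0 real) \<Rightarrow> (nat \<Rightarrow>\<^sub>0 real)"
  assumes J: "finite J" and G: "openin (top_of_set (coord_space J)) G" "y0 \<in> G"
    and e: "continuous_on G e" "inj_on e G" "e ` G \<subseteq> X"
  shows "card J \<le> d"
    and "card J = d \<Longrightarrow> \<exists>N. openin (top_of_set X) N \<and> e y0 \<in> N \<and> N \<subseteq> e ` G"
proof -
  have "e y0 \<in> X"
    using G e by blast
  then obtain U W \<phi> \<psi> F where U: "openin (top_of_set X) U" "e y0 \<in> U"
    and V: "openin (top_of_set (real_space d)) (\<phi> ` U)" and hom: "homeomorphism U (\<phi> ` U) \<phi> \<psi>"
    using pl_chart by metis
  define G' where "G' = G \<inter> e -` U"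
  have "openin (top_of_set G) G'"
    unfolding G'_def using continuous_openin_preimage [OF e(1) _ U(1)] e(3) by auto
  then have G': "openin (top_of_set (coord_space J)) G'" "y0 \<in> G'" "G' \<subseteq> G"
    using G U by (auto simp: G'_def intro: openin_trans)
  have "\<phi> ` U \<subseteq> coord_space {..<d}"
    using V openin_imp_subset real_space_eq by metis
  then have \<phi>e: "(\<phi> \<circ> e) \<in> G' \<rightarrow> coord_space {..<d}"
    by (auto simp: G'_def)
  have cont: "continuous_on G' (\<phi> \<circ> e)"
    using e(1) hom by (intro continuous_on_compose) (auto simp: G'_def homeomorphism_def intro: continuous_on_subset)
  have inj: "inj_on (\<phi> \<circ> e) G'"
  proof (rule comp_inj_on)
    show "inj_on e G'"
      using e(2) G'(3) by (rule inj_on_subset)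
    have "inj_on \<phi> U"
      using hom by (auto simp: homeomorphism_def intro: inj_on_inverseI)
    then show "inj_on \<phi> (e ` G')"
      by (rule inj_on_subset) (auto simp: G'_def)
  qed
  show "card J \<le> d"
    using invariance_of_dimension_coord_space [OF J _ G'(1) _ cont \<phi>e inj] G'(2) by auto
  show "\<exists>N. openin (top_of_set X) N \<and> e y0 \<in> N \<and> N \<subseteq> e ` G" if "card J = d"
  proof (intro exI conjI)
    have op: "openin (top_of_set (coord_space {..<d})) ((\<phi> \<circ> e) ` G')"
      using invariance_of_domain_coord_space [OF J _ _ G'(1) cont \<phi>e inj] that by simp
    then have "openin (top_of_set (\<phi> ` U)) ((\<phi> \<circ> e) ` G')"
      by (rule openin_subset_trans) (use \<open>\<phi> ` U \<subseteq> coord_space {..<d}\<close> in \<open>auto simp: G'_def\<close>)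
    then have "openin (top_of_set U) (U \<inter> \<phi> -` ((\<phi> \<circ> e) ` G'))"
      using hom by (simp add: homeomorphism_def continuous_on_open)
    moreover have "U \<inter> \<phi> -` ((\<phi> \<circ> e) ` G') = e ` G'"
    proof -
      have "\<psi> (\<phi> u) = u" if "u \<in> U" for u
        using hom that by (simp add: homeomorphism_def)
      moreover have "e g \<in> U" if "g \<in> G'" for g
        using that by (simp add: G'_def)
      ultimately have "u = e g" if "u \<in> U" "g \<in> G'" "\<phi> u = \<phi> (e g)" for u g
        using that by metis
      then show ?thesis
        using \<open>\<And>g. g \<in> G' \<Longrightarrow> e g \<in> U\<close> by fastforce
    qed
    ultimately show "openin (top_of_set X) (e ` G')"
      using U(1) by (metis openin_trans)
    show "e y0 \<in> e ` G'" "e ` G' \<subseteq> e ` G"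
      using G' by auto
  qed
qed

text \<open>Counterpart of \<open>embedding_open\<close> for maps from \<open>X\<close> to
  coordinates, by composing with the inverse of a chart. It bounds dimensions from below and shows
  that \<open>d\<close> independent coordinates take all values near a given one.\<close>

lemma coordinates_open:
  fixes c :: "(nat \<Rightarrow>\<^sub>0 real) \<Rightarrow> (nat \<Rightarrow>\<^sub>0 real)"
  assumes J: "finite J" and N: "openin (top_of_set X) N" "x0 \<in> N"
    and c: "continuous_on N c" "inj_on c N" "c \<in> N \<rightarrow> coord_space J"
  shows "d \<le> card J"
    and "card J = d \<Longrightarrow> \<exists>G. openin (top_of_set (coord_space J)) G \<and> c x0 \<in> G \<and> G \<subseteq> c ` N"
proof -
  have "x0 \<in> X"
    using N openin_imp_subset by blast
  then obtain U W \<phi> \<psi> F where U: "openin (top_of_set X) U" "x0 \<in> U"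
    and V: "openin (top_of_set (real_space d)) (\<phi> ` U)" and hom: "homeomorphism U (\<phi> ` U) \<phi> \<psi>"
    using pl_chart by metis
  have inv: "\<psi> (\<phi> u) = u" if "u \<in> U" for u
    using hom that by (simp add: homeomorphism_def)
  define V' where "V' = \<phi> ` (U \<inter> N)"
  have UN: "openin (top_of_set U) (U \<inter> N)"
    using openin_subset_trans [OF openin_Int [OF U(1) N(1)] _ openin_imp_subset [OF U(1)]] by simp
  have "openin (top_of_set (\<phi> ` U)) V'"
    unfolding V'_def using homeomorphism_imp_open_map [OF hom UN] .
  then have V': "openin (top_of_set (coord_space {..<d})) V'"
    using V by (metis openin_trans real_space_eq)
  have \<psi>V: "\<psi> ` V' = U \<inter> N"
    unfolding V'_def image_image using inv by simp
  have cont: "continuous_on V' (c \<circ> \<psi>)"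
  proof (rule continuous_on_compose)
    show "continuous_on V' \<psi>"
      using hom by (auto simp: homeomorphism_def V'_def intro: continuous_on_subset)
    show "continuous_on (\<psi> ` V') c"
      using c(1) \<psi>V by (auto intro: continuous_on_subset)
  qed
  have inj: "inj_on (c \<circ> \<psi>) V'"
  proof (rule comp_inj_on)
    show "inj_on \<psi> V'"
      unfolding V'_def using inv by (auto simp: inj_on_def)
    show "inj_on c (\<psi> ` V')"
      unfolding \<psi>V using c(2) by (rule inj_on_subset) simp
  qed
  have maps: "(c \<circ> \<psi>) \<in> V' \<rightarrow> coord_space J"
  proof
    fix y assume "y \<in> V'"
    then have "\<psi> y \<in> N"
      using \<psi>V by blast
    then show "(c \<circ> \<psi>) y \<in> coord_space J"
      using c(3) by auto
  qed
  have x0V: "\<phi> x0 \<in> V'"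
    using N U by (simp add: V'_def)
  show "d \<le> card J"
    using invariance_of_dimension_coord_space [OF _ J V' _ cont maps inj] x0V by auto
  show "\<exists>G. openin (top_of_set (coord_space J)) G \<and> c x0 \<in> G \<and> G \<subseteq> c ` N" if "card J = d"
  proof (intro exI conjI)
    show "openin (top_of_set (coord_space J)) ((c \<circ> \<psi>) ` V')"
      using invariance_of_domain_coord_space [OF _ J _ V' cont maps inj] that by simp
    show "c x0 \<in> (c \<circ> \<psi>) ` V'"
      using x0V inv [OF U(2)] by force
    show "(c \<circ> \<psi>) ` V' \<subseteq> c ` N"
      using \<psi>V by auto
  qed
qed

lemma openin_star:
  assumes "finite s"
  shows "openin (top_of_set X) {x \<in> X. \<forall>i\<in>s. Poly_Mapping.lookup x i > 0}"
  using assms by (intro openin_coord_pos continuous_intros)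

text \<open>The open simplex on \<open>s\<close> is parametrised by all its coordinates but one,
  since the weight at \<open>p\<close> is what is missing to total mass one. So a space of dimension
  \<open>card s - 1\<close> embeds locally into \<open>X\<close>.\<close>

lemma card_le:
  assumes s: "s \<in> T"
  shows "card s \<le> d + 1"
proof (cases "s = {}")
  case False
  have fin: "finite s"
    using cpx s by (rule finite_complex_finite)
  obtain p where p: "p \<in> s"
    using False by blast
  define J where "J = s - {p}"
  have J: "finite J" "p \<notin> J" "s = insert p J"
    using fin p by (auto simp: J_def)
  define e where "e = (\<lambda>y. y + (1 - mass y) *\<^sub>R unit_vec p)"
  define G where "G = {y \<in> coord_space J. \<forall>i\<in>s. (if i = p then 1 - mass y else Poly_Mapping.lookup y i) > 0}"
  have lookup_e: "Poly_Mapping.lookup (e y) i = (if i = p then 1 - mass y else Poly_Mapping.lookup y i)"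
    if "y \<in> coord_space J" for y i
    using that J by (auto simp: e_def lookup_add lookup_unit_vec coord_space_iff)
  have G: "openin (top_of_set (coord_space J)) G"
    unfolding G_def
  proof (rule openin_coord_pos [OF fin])
    fix i assume "i \<in> s"
    show "continuous_on (coord_space J) (\<lambda>y. if i = p then 1 - mass y else Poly_Mapping.lookup y i)"
      using continuous_on_mass [OF J(1)] by (cases "i = p") (auto intro!: continuous_intros)
  qed
  have GJ: "G \<subseteq> coord_space J"
    by (auto simp: G_def)
  define y0 where "y0 = bary s - Poly_Mapping.lookup (bary s) p *\<^sub>R unit_vec p"
  have mass_y0: "mass y0 = 1 - 1 / card s"
    using fin False p by (simp add: y0_def mass_minus mass_scaleR mass_bary lookup_bary)
  have "y0 \<in> coord_space J"
    using fin J by (auto simp: y0_def coord_space_iff lookup_minus lookup_bary lookup_unit_vec)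
  then have y0: "y0 \<in> G"
    using fin False p by (auto simp: G_def mass_y0 card_gt_0_iff) (auto simp: y0_def lookup_minus lookup_bary lookup_unit_vec card_gt_0_iff)
  have "continuous_on G e"
    unfolding e_def using continuous_on_subset [OF continuous_on_mass [OF J(1)] GJ]
    by (intro continuous_intros)
  moreover have "inj_on e G"
  proof (rule inj_onI, rule poly_mapping_eqI)
    fix x y i assume xy: "x \<in> G" "y \<in> G" "e x = e y"
    then have "x \<in> coord_space J" "y \<in> coord_space J"
      using GJ by auto
    then show "Poly_Mapping.lookup x i = Poly_Mapping.lookup y i"
      using lookup_e [of x i] lookup_e [of y i] xy J by (cases "i = p") (auto simp: coord_space_iff)
  qed
  moreover have "e ` G \<subseteq> X"
  proof (rule image_subsetI)
    fix y assume y: "y \<in> G"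
    then have yJ: "y \<in> coord_space J" and pos: "\<And>i. i \<in> s \<Longrightarrow> Poly_Mapping.lookup (e y) i > 0"
      using GJ by (auto simp: G_def lookup_e)
    have out: "Poly_Mapping.lookup (e y) i = 0" if "i \<notin> s" for i
      using that yJ J by (auto simp: lookup_e coord_space_iff)
    have "Poly_Mapping.keys (e y) = s"
      using pos out by (auto simp: in_keys_iff) fastforce+
    moreover have "Poly_Mapping.lookup (e y) i \<ge> 0" for i
      using pos [of i] out [of i] by (cases "i \<in> s") auto
    moreover have "mass (e y) = 1"
      by (simp add: e_def mass_add mass_scaleR)
    ultimately show "e y \<in> X"
      using s by (simp add: mem_X)
  qed
  ultimately have "card J \<le> d"
    by (rule embedding_open(1) [OF J(1) G y0])
  then show ?thesis
    using J by simp
qed simp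

text \<open>Pureness. The open star of a maximal simplex contains only points with support
  \<open>s\<close>; near its barycentre the \<open>card s - 1\<close> coordinates other than
  \<open>p\<close> therefore determine a point, and there must be at least \<open>d\<close> of
  them.\<close>

lemma maximal_card:
  assumes s: "s \<in> T" and max: "\<And>t. t \<in> T \<Longrightarrow> s \<subseteq> t \<Longrightarrow> t = s"
  shows "card s = d + 1"
proof -
  have fin: "finite s"
    using cpx s by (rule finite_complex_finite)
  have "s \<noteq> {}"
  proof
    assume "s = {}"
    obtain x where x: "x \<in> X"
      using X_nonempty by blast
    then have "x = 0"
      using max [of "Poly_Mapping.keys x"] \<open>s = {}\<close> by (simp add: mem_X)
    then show False
      using x by (simp add: mem_X mass_def)
  qed
  then obtain p where p: "p \<in> s"
    by blast
  define N where "N = {x \<in> X. \<forall>i\<in>s. Poly_Mapping.lookup x i > 0}"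
  define c where "c = (\<lambda>x. x - Poly_Mapping.lookup x p *\<^sub>R unit_vec p)"
  have keysN: "Poly_Mapping.keys x = s" if "x \<in> N" for x
  proof -
    have "s \<subseteq> Poly_Mapping.keys x"
      using that by (force simp: N_def in_keys_iff)
    then show ?thesis
      using that max by (auto simp: N_def mem_X)
  qed
  have x0: "bary s \<in> N"
    using bary_mem_realization [OF cpx s \<open>s \<noteq> {}\<close>] fin \<open>s \<noteq> {}\<close> by (simp add: N_def lookup_bary card_gt_0_iff)
  have "continuous_on N c"
    unfolding c_def by (intro continuous_intros)
  moreover have "inj_on c N"
  proof (rule inj_onI)
    fix x y assume xy: "x \<in> N" "y \<in> N" "c x = c y"
    have "mass (c x) = 1 - Poly_Mapping.lookup x p" "mass (c y) = 1 - Poly_Mapping.lookup y p"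
      using xy(1,2) by (simp_all add: c_def mass_minus mass_scaleR N_def mem_X)
    then have "Poly_Mapping.lookup x p = Poly_Mapping.lookup y p"
      using xy(3) by simp
    then show "x = y"
      using xy(3) by (simp add: c_def)
  qed
  moreover have "c \<in> N \<rightarrow> coord_space (s - {p})"
  proof
    fix x assume "x \<in> N"
    then show "c x \<in> coord_space (s - {p})"
      using keysN [of x] in_keys_iff [of _ x] by (auto simp: c_def coord_space_iff lookup_minus lookup_unit_vec)
  qed
  ultimately have "d \<le> card (s - {p})"
    using fin x0 openin_star [OF fin] unfolding N_def by (intro coordinates_open(1)) auto
  then have "d + 1 \<le> card s"
    using card_Suc_Diff1 [OF fin p] by simp
  then show ?thesis
    using card_le [OF s] by simp
qed

lemma subset_facet:
  assumes "s \<in> T"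
  obtains \<sigma> where "facet d T \<sigma>" "s \<subseteq> \<sigma>"
proof -
  have "finite T"
    using cpx by (simp add: finite_complex_def)
  then obtain \<sigma> where \<sigma>: "\<sigma> \<in> T" "s \<subseteq> \<sigma>" "\<And>t. t \<in> T \<Longrightarrow> \<sigma> \<subseteq> t \<Longrightarrow> t = \<sigma>"
    using finite_has_maximal2 [OF _ assms] by metis
  then have "facet d T \<sigma>"
    using maximal_card [of \<sigma>] by (simp add: facet_def)
  then show ?thesis
    using that \<sigma>(2) by blast
qed

lemma facet_maximal:
  assumes "facet d T \<sigma>" "t \<in> T" "\<sigma> \<subseteq> t"
  shows "t = \<sigma>"
  using assms card_le [OF assms(2)] finite_complex_finite [OF cpx assms(2)]
  by (metis card_subset_eq card_mono facet_def order_antisym)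

text \<open>Near the barycentre of \<rho> every support is \<rho> or \<rho> with one further vertex
  from \<open>A\<close>. Pureness makes \<open>A\<close> nonempty, and comparing this star with a
  space of dimension \<open>d\<close> excludes a single element as well as a third one.\<close>

lemma ridge_facets:
  assumes \<rho>: "\<rho> \<in> T" "card \<rho> = d"
  obtains a b where "a \<noteq> b" "{x. x \<notin> \<rho> \<and> insert x \<rho> \<in> T} = {a, b}"
proof -
  define A where "A = {x. x \<notin> \<rho> \<and> insert x \<rho> \<in> T}"
  have fin: "finite \<rho>"
    using cpx \<rho>(1) by (rule finite_complex_finite)
  have ne: "\<rho> \<noteq> {}"
    using \<rho>(2) d2 by auto
  then obtain r where r: "r \<in> \<rho>"
    by blast
  define N where "N = {x \<in> X. \<forall>i\<in>\<rho>. Poly_Mapping.lookup x i > 0}"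
  have N: "openin (top_of_set X) N"
    unfolding N_def by (rule openin_star [OF fin])
  have x0: "bary \<rho> \<in> N"
    using bary_mem_realization [OF cpx \<rho>(1) ne] fin ne by (simp add: N_def lookup_bary card_gt_0_iff)
  have keysN: "Poly_Mapping.keys x = \<rho> \<or> (\<exists>a\<in>A. Poly_Mapping.keys x = insert a \<rho>)" if "x \<in> N" for x
  proof -
    have k: "Poly_Mapping.keys x \<in> T" "\<rho> \<subseteq> Poly_Mapping.keys x"
      using that by (force simp: N_def mem_X in_keys_iff)+
    have "card (Poly_Mapping.keys x - \<rho>) \<le> 1"
      using card_le [OF k(1)] \<rho>(2) k(2) fin by (simp add: card_Diff_subset)
    then have "Poly_Mapping.keys x - \<rho> = {} \<or> (\<exists>a. Poly_Mapping.keys x - \<rho> = {a})"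
      by (metis One_nat_def card_1_singletonE card_eq_0_iff finite_Diff finite_keys le_Suc_eq le_zero_eq)
    then show ?thesis
    proof (elim disjE exE)
      fix a assume "Poly_Mapping.keys x - \<rho> = {a}"
      then have "Poly_Mapping.keys x = insert a \<rho>" "a \<notin> \<rho>"
        using k(2) by auto
      then show ?thesis
        using k(1) by (auto simp: A_def)
    qed (use k(2) in auto)
  qed
  have cJ: "card (insert a (\<rho> - {r})) = d" if "a \<in> A" for a
    using that fin r \<rho>(2) card_Suc_Diff1 [OF fin r] by (simp add: A_def)
  define c where "c = (\<lambda>x. x - Poly_Mapping.lookup x r *\<^sub>R unit_vec r)"
  obtain a where a: "a \<in> A"
  proof -
    obtain \<sigma> where \<sigma>: "facet d T \<sigma>" "\<rho> \<subseteq> \<sigma>"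
      using subset_facet [OF \<rho>(1)] by blast
    then have "\<rho> \<noteq> \<sigma>"
      using \<rho>(2) by (metis Suc_eq_plus1 facet_def n_not_Suc_n)
    then obtain a where "a \<in> \<sigma>" "a \<notin> \<rho>"
      using \<sigma>(2) by blast
    moreover from this have "insert a \<rho> \<in> T"
      using \<sigma> finite_complex_downward [OF cpx, of \<sigma> "insert a \<rho>"] by (simp add: facet_def)
    ultimately show ?thesis
      using that by (auto simp: A_def)
  qed
  obtain b where b: "b \<in> A" "b \<noteq> a"
  proof (rule ccontr)
    \<comment> \<open>Otherwise the star of \<open>\<rho>\<close> is a half space.\<close>
    assume "\<not> thesis"
    then have A: "A = {a}"
      using that a by blast
    define J where "J = insert a (\<rho> - {r})"
    have "continuous_on N c"
      unfolding c_def by (intro continuous_intros)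
    moreover have "inj_on c N"
    proof (rule inj_onI)
      fix x y assume xy: "x \<in> N" "y \<in> N" "c x = c y"
      have "mass (c x) = 1 - Poly_Mapping.lookup x r" "mass (c y) = 1 - Poly_Mapping.lookup y r"
        using xy(1,2) by (simp_all add: c_def mass_minus mass_scaleR N_def mem_X)
      then have "Poly_Mapping.lookup x r = Poly_Mapping.lookup y r"
        using xy(3) by simp
      then show "x = y"
        using xy(3) by (simp add: c_def)
    qed
    moreover have "c \<in> N \<rightarrow> coord_space J"
    proof
      fix x assume "x \<in> N"
      then have "Poly_Mapping.keys x \<subseteq> insert a \<rho>"
        using keysN A by blast
      then show "c x \<in> coord_space J"
        using in_keys_iff [of _ x] r by (auto simp: c_def coord_space_iff lookup_minus lookup_unit_vec J_def)
    qed
    ultimately obtain G where G: "openin (top_of_set (coord_space J)) G" "c (bary \<rho>) \<in> G" "G \<subseteq> c ` N"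
      using coordinates_open(2) [of J N "bary \<rho>" c] N x0 cJ [OF a] fin by (auto simp: J_def)
    obtain e where e: "e > 0" "\<And>t. \<bar>t\<bar> < e \<Longrightarrow> c (bary \<rho>) + t *\<^sub>R unit_vec a \<in> G"
      by (rule openin_subspace_line [OF G(1) subspace_coord_space G(2), of "unit_vec a"])
        (auto simp: coord_space_iff lookup_unit_vec J_def)
    \<comment> \<open>Openness would allow a negative weight at \<open>a\<close>, which no point of
      the realization has.\<close>
    have "c (bary \<rho>) + (- e / 2) *\<^sub>R unit_vec a \<in> G"
      using e(1) by (intro e(2)) auto
    then obtain x where x: "x \<in> N" "c (bary \<rho>) + (- e / 2) *\<^sub>R unit_vec a = c x"
      using G(3) by blast
    have ar: "a \<noteq> r" "a \<notin> \<rho>"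
      using a r by (auto simp: A_def)
    have "Poly_Mapping.lookup (c x) a = - e / 2"
      using ar fin unfolding x(2) [symmetric] by (simp add: c_def lookup_add lookup_minus lookup_unit_vec lookup_bary)
    then have "Poly_Mapping.lookup x a < 0"
      using ar e(1) by (simp add: c_def lookup_minus lookup_unit_vec)
    then show False
      using x(1) by (auto simp: N_def mem_X not_less [symmetric])
  qed
  have "A \<subseteq> {a, b}"
  proof (rule ccontr)
    \<comment> \<open>The two facets containing \<open>a\<close> and \<open>b\<close> already form a neighbourhood of the barycentre of \<open>\<rho>\<close>,
      parametrised by folding the coordinate \<open>a\<close> over.\<close>
    assume "\<not> A \<subseteq> {a, b}"
    then obtain a' where a': "a' \<in> A" "a' \<noteq> a" "a' \<noteq> b"
      by blast
    define J where "J = insert a (\<rho> - {r})"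
    have finJ: "finite J"
      using fin by (simp add: J_def)
    have nin: "a \<notin> \<rho>" "b \<notin> \<rho>" "a' \<notin> \<rho>" "r \<noteq> a" "r \<noteq> b" "r \<notin> J" "b \<notin> J"
      using a b a' r by (auto simp: A_def J_def)
    \<comment> \<open>The weight at \<open>r\<close> that restores total mass one: after folding,
      the coordinate \<open>a\<close> contributes its absolute value and every other coordinate of
      \<open>J\<close> contributes itself.\<close>
    define rr where "rr = (\<lambda>y. 1 - (mass y - Poly_Mapping.lookup y a) - \<bar>Poly_Mapping.lookup y a\<bar>)"
    define e where "e = (\<lambda>y. y + (max (Poly_Mapping.lookup y a) 0 - Poly_Mapping.lookup y a) *\<^sub>R unit_vec a
        + max (- Poly_Mapping.lookup y a) 0 *\<^sub>R unit_vec b + rr y *\<^sub>R unit_vec r)"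
    have lookup_e: "Poly_Mapping.lookup (e y) i =
        (if i = a then max (Poly_Mapping.lookup y a) 0 else if i = b then max (- Poly_Mapping.lookup y a) 0
         else if i = r then rr y else Poly_Mapping.lookup y i)" if "y \<in> coord_space J" for y i
      using that nin b by (auto simp: e_def lookup_add lookup_unit_vec coord_space_iff)
    define G where "G = {y \<in> coord_space J. \<forall>i\<in>\<rho>. (if i = r then rr y else Poly_Mapping.lookup y i) > 0}"
    have cont_rr: "continuous_on (coord_space J) rr"
      unfolding rr_def by (intro continuous_intros continuous_on_mass [OF finJ])
    have G: "openin (top_of_set (coord_space J)) G"
      unfolding G_def
    proof (rule openin_coord_pos [OF fin])
      fix i assume "i \<in> \<rho>"
      show "continuous_on (coord_space J) (\<lambda>y. if i = r then rr y else Poly_Mapping.lookup y i)"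
        using cont_rr by (cases "i = r") (auto intro!: continuous_intros)
    qed
    have GJ: "G \<subseteq> coord_space J"
      by (auto simp: G_def)
    have "continuous_on G e"
      unfolding e_def by (intro continuous_intros continuous_on_subset [OF cont_rr GJ])
    moreover have "inj_on e G"
    proof (rule inj_onI, rule poly_mapping_eqI)
      fix x y i assume xy: "x \<in> G" "y \<in> G" "e x = e y"
      have J: "x \<in> coord_space J" "y \<in> coord_space J"
        using xy GJ by auto
      have eq: "Poly_Mapping.lookup (e x) j = Poly_Mapping.lookup (e y) j" for j
        using xy by simp
      have "max (Poly_Mapping.lookup x a) 0 = max (Poly_Mapping.lookup y a) 0"
        "max (- Poly_Mapping.lookup x a) 0 = max (- Poly_Mapping.lookup y a) 0"
        using eq [of a] eq [of b] b(2) by (simp_all add: lookup_e J)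
      then have "Poly_Mapping.lookup x a = Poly_Mapping.lookup y a"
        by (auto simp: max_def split: if_splits)
      then show "Poly_Mapping.lookup x i = Poly_Mapping.lookup y i"
        using eq [of i] J nin by (cases "i \<in> J") (auto simp: lookup_e coord_space_iff split: if_splits)
    qed
    moreover have keys_e: "Poly_Mapping.keys (e y) \<subseteq> insert a \<rho> \<or> Poly_Mapping.keys (e y) \<subseteq> insert b \<rho>" if "y \<in> G" for y
    proof -
      have yJ: "y \<in> coord_space J"
        using that GJ by blast
      have *: "i \<in> insert a (insert b \<rho>)" if "i \<in> Poly_Mapping.keys (e y)" for i
        using that yJ r by (auto simp: in_keys_iff lookup_e [OF yJ] coord_space_iff J_def split: if_splits)
      have "a \<notin> Poly_Mapping.keys (e y) \<or> b \<notin> Poly_Mapping.keys (e y)"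
        using b(2) by (auto simp: in_keys_iff lookup_e [OF yJ] max_def)
      then show ?thesis
        using * by blast
    qed
    moreover have "e ` G \<subseteq> X"
    proof (rule image_subsetI)
      fix y assume y: "y \<in> G"
      then have yJ: "y \<in> coord_space J"
        using GJ by blast
      have "Poly_Mapping.keys (e y) \<in> T"
        using keys_e [OF y] a b finite_complex_downward [OF cpx] by (auto simp: A_def)
      moreover have "Poly_Mapping.lookup (e y) i \<ge> 0" for i
      proof (cases "i \<in> \<rho>")
        case True
        then have "(if i = r then rr y else Poly_Mapping.lookup y i) > 0"
          using y by (simp add: G_def)
        then show ?thesis
          using True nin by (auto simp: lookup_e [OF yJ] split: if_splits)
      next
        case False
        then show ?thesis
          using yJ r by (auto simp: lookup_e [OF yJ] coord_space_iff J_def)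
      qed
      moreover have "mass (e y) = 1"
        by (simp add: e_def mass_add mass_scaleR rr_def max_def abs_real_def)
      ultimately show "e y \<in> X"
        by (simp add: mem_X)
    qed
    moreover
    have y0J: "c (bary \<rho>) \<in> coord_space J"
      using fin by (auto simp: c_def coord_space_iff lookup_minus lookup_bary lookup_unit_vec J_def)
    have y0a: "Poly_Mapping.lookup (c (bary \<rho>)) a = 0"
      using nin fin by (simp add: c_def lookup_minus lookup_bary lookup_unit_vec)
    have rr0: "rr (c (bary \<rho>)) = 1 / card \<rho>"
      using y0a fin ne r by (simp add: rr_def c_def mass_minus mass_scaleR mass_bary lookup_bary)
    have ey0: "e (c (bary \<rho>)) = bary \<rho>"
      using nin fin r rr0 y0a
      by (intro poly_mapping_eqI) (auto simp: lookup_e [OF y0J] lookup_bary, auto simp: c_def lookup_minus lookup_unit_vec lookup_bary)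
    have "c (bary \<rho>) \<in> G"
      using y0J rr0 fin ne by (auto simp: G_def card_gt_0_iff) (auto simp: c_def lookup_minus lookup_unit_vec lookup_bary card_gt_0_iff)
    ultimately obtain N' where N': "openin (top_of_set X) N'" "bary \<rho> \<in> N'" "N' \<subseteq> e ` G"
      using embedding_open(2) [OF finJ G, of "c (bary \<rho>)" e] cJ [OF a] ey0 by (auto simp: J_def)
    obtain O' where O': "open O'" "N' = X \<inter> O'"
      using N'(1) by (auto simp: openin_open)
    obtain \<epsilon> where \<epsilon>: "\<epsilon> > 0" "\<And>t. \<bar>t\<bar> < \<epsilon> \<Longrightarrow> bary \<rho> + t *\<^sub>R (unit_vec a' - bary \<rho>) \<in> O'"
      using openin_subspace_line [of UNIV O' "bary \<rho>" "unit_vec a' - bary \<rho>"] O' N'(2) by auto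
    define t where "t = min (\<epsilon> / 2) (1 / 2)"
    have t: "0 < t" "t < 1" "\<bar>t\<bar> < \<epsilon>"
      using \<epsilon>(1) by (auto simp: t_def)
    \<comment> \<open>A point of the third facet, slightly off the barycentre of \<rho> towards
      \<open>a'\<close>. It would have to lie in the image of \<open>e\<close>, whose points have no
      weight at \<open>a'\<close>.\<close>
    define x where "x = bary \<rho> + t *\<^sub>R (unit_vec a' - bary \<rho>)"
    have lookup_x: "Poly_Mapping.lookup x i = (if i = a' then t else if i \<in> \<rho> then (1 - t) / card \<rho> else 0)" for i
      using nin fin by (simp add: x_def lookup_add lookup_minus lookup_bary lookup_unit_vec right_diff_distrib diff_divide_distrib)
    have "Poly_Mapping.keys x \<subseteq> insert a' \<rho>"
      by (auto simp: in_keys_iff lookup_x split: if_splits)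
    then have "Poly_Mapping.keys x \<in> T"
      using a' finite_complex_downward [OF cpx, of "insert a' \<rho>"] by (simp add: A_def)
    moreover have "mass x = 1"
      using fin ne by (simp add: x_def mass_add mass_scaleR mass_minus mass_bary)
    moreover have "Poly_Mapping.lookup x i \<ge> 0" for i
      using t by (simp add: lookup_x)
    ultimately have "x \<in> N'"
      using \<epsilon>(2) [OF t(3)] O'(2) by (simp add: mem_X x_def)
    then obtain y where "y \<in> G" "x = e y"
      using N'(3) by blast
    moreover have "a' \<in> Poly_Mapping.keys x"
      using t by (simp add: in_keys_iff lookup_x)
    ultimately show False
      using keys_e [of y] a' nin by auto
  qed
  then have "A = {a, b}"
    using a b by blast
  then show ?thesis
    using that b(2) by (metis A_def)
qed

end

section \<open>Strong connectivity\<close>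

lemma affine_map_on_weighted_mean:
  assumes D: "convex D" "affine_map_on D \<phi>" and S: "finite S" and y: "y \<in> D"
    and w: "\<And>b. b \<in> S \<Longrightarrow> w b \<ge> 0" and x: "\<And>b. b \<in> S \<Longrightarrow> x b \<in> D"
  shows "\<phi> (inverse (1 + sum w S) *\<^sub>R (y + (\<Sum>b\<in>S. w b *\<^sub>R x b))) =
    inverse (1 + sum w S) *\<^sub>R (\<phi> y + (\<Sum>b\<in>S. w b *\<^sub>R \<phi> (x b)))"
proof -
  define N where "N = 1 + sum w S"
  have N: "N > 0"
    using sum_nonneg [of S w] w by (simp add: N_def add_pos_nonneg)
  \<comment> \<open>\<open>None\<close> is the index of \<open>y\<close>, which has weight one
    before normalisation, and \<open>Some b\<close> is the index of \<open>x b\<close>.\<close>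
  define I where "I = insert None (Some ` S)"
  define a where "a = (\<lambda>i. case i of None \<Rightarrow> inverse N | Some b \<Rightarrow> inverse N * w b)"
  define z where "z = (\<lambda>i. case i of None \<Rightarrow> y | Some b \<Rightarrow> x b)"
  have split: "(\<Sum>i\<in>I. h i) = h None + (\<Sum>b\<in>S. h (Some b))" for h :: "_ \<Rightarrow> 'z::comm_monoid_add"
    unfolding I_def using S by (subst sum.insert) (auto simp: sum.reindex)
  have "sum a I = 1"
    using N by (simp add: split a_def N_def flip: sum_distrib_left) (simp add: field_simps)
  moreover have "\<And>i. i \<in> I \<Longrightarrow> a i \<ge> 0" "\<And>i. i \<in> I \<Longrightarrow> z i \<in> D" "finite I"
    using w x y N S by (auto simp: a_def z_def I_def)
  ultimately have "\<phi> (\<Sum>i\<in>I. a i *\<^sub>R z i) = (\<Sum>i\<in>I. a i *\<^sub>R \<phi> (z i))"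
    by (intro affine_map_on_convex_combination [OF D]) auto
  then show ?thesis
    by (simp add: split a_def z_def N_def scaleR_add_right scaleR_sum_right)
qed

text \<open>\<open>affine_map_on\<close> speaks of convex combinations only. Coefficients of any
  sign occur as soon as a point is expressed in a basis of differences.\<close>

lemma affine_map_on_affine_relation:
  assumes D: "convex D" "affine_map_on D \<phi>" and S: "finite S" and z: "z0 \<in> D" "z \<in> D"
    and p: "\<And>b. b \<in> S \<Longrightarrow> p b \<in> D" and eq: "z - z0 = (\<Sum>b\<in>S. c b *\<^sub>R (p b - z0))"
  shows "\<phi> z - \<phi> z0 = (\<Sum>b\<in>S. c b *\<^sub>R (\<phi> (p b) - \<phi> z0))"
proof -
  \<comment> \<open>Moving the terms with negative coefficient to the other side turns the relation into an equality
    of two convex combinations.\<close>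
  define w where "w = (\<lambda>b. \<bar>c b\<bar>)"
  define l where "l = (\<lambda>b. if c b > 0 then z0 else p b)"
  define r where "r = (\<lambda>b. if c b > 0 then p b else z0)"
  have lr: "w b *\<^sub>R (h (r b) - h (l b)) = c b *\<^sub>R (h (p b) - h z0)" for b and h :: "_ \<Rightarrow> 'z::real_vector"
    by (auto simp: w_def l_def r_def abs_if not_less algebra_simps)
  have "(\<Sum>b\<in>S. w b *\<^sub>R r b) - (\<Sum>b\<in>S. w b *\<^sub>R l b) = z - z0"
    unfolding eq sum_subtractf [symmetric] scaleR_diff_right [symmetric]
    using lr [of _ "\<lambda>x. x"] by simp
  then have "z + (\<Sum>b\<in>S. w b *\<^sub>R l b) = z0 + (\<Sum>b\<in>S. w b *\<^sub>R r b)"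
    by (simp add: algebra_simps)
  moreover have "\<phi> (inverse (1 + sum w S) *\<^sub>R (z + (\<Sum>b\<in>S. w b *\<^sub>R l b))) =
      inverse (1 + sum w S) *\<^sub>R (\<phi> z + (\<Sum>b\<in>S. w b *\<^sub>R \<phi> (l b)))"
    by (rule affine_map_on_weighted_mean [OF D S z(2)]) (use p z in \<open>auto simp: w_def l_def\<close>)
  moreover have "\<phi> (inverse (1 + sum w S) *\<^sub>R (z0 + (\<Sum>b\<in>S. w b *\<^sub>R r b))) =
      inverse (1 + sum w S) *\<^sub>R (\<phi> z0 + (\<Sum>b\<in>S. w b *\<^sub>R \<phi> (r b)))"
    by (rule affine_map_on_weighted_mean [OF D S z(1)]) (use p z in \<open>auto simp: w_def r_def\<close>)
  moreover have "1 + sum w S > 0"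
    by (simp add: w_def add_pos_nonneg sum_nonneg)
  ultimately have "\<phi> z + (\<Sum>b\<in>S. w b *\<^sub>R \<phi> (l b)) = \<phi> z0 + (\<Sum>b\<in>S. w b *\<^sub>R \<phi> (r b))"
    by simp
  then have "\<phi> z - \<phi> z0 = (\<Sum>b\<in>S. w b *\<^sub>R \<phi> (r b)) - (\<Sum>b\<in>S. w b *\<^sub>R \<phi> (l b))"
    by (simp add: algebra_simps)
  also have "\<dots> = (\<Sum>b\<in>S. c b *\<^sub>R (\<phi> (p b) - \<phi> z0))"
    unfolding sum_subtractf [symmetric] scaleR_diff_right [symmetric] lr ..
  finally show ?thesis .
qed

text \<open>A basis of the span of the differences \<open>z - z0\<close> can be chosen among these
  differences, and on them the values of \<open>g\<close> are prescribed by \<phi>.\<close>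

lemma affine_map_on_linear_extension:
  assumes D: "convex D" "affine_map_on D \<phi>" and z0: "z0 \<in> D"
  obtains g where "linear g" "\<And>z. z \<in> D \<Longrightarrow> \<phi> z - \<phi> z0 = g (z - z0)"
proof -
  obtain B where B: "B \<subseteq> (\<lambda>z. z - z0) ` D" "independent B" "(\<lambda>z. z - z0) ` D \<subseteq> span B"
    using maximal_independent_subset by blast
  obtain g where g: "linear g" "\<And>b. b \<in> B \<Longrightarrow> g b = \<phi> (z0 + b) - \<phi> z0"
    using linear_independent_extend [OF B(2), of "\<lambda>b. \<phi> (z0 + b) - \<phi> z0"] by blast
  show ?thesis
  proof (rule that [OF g(1)])
    fix z assume z: "z \<in> D"
    then have "z - z0 \<in> span B"
      using B(3) by blast
    then obtain S c where S: "finite S" "S \<subseteq> B" and c: "z - z0 = (\<Sum>b\<in>S. c b *\<^sub>R b)"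
      unfolding span_explicit by auto
    have p: "z0 + b \<in> D" if "b \<in> S" for b
      using that S(2) B(1) by auto
    have "\<phi> z - \<phi> z0 = (\<Sum>b\<in>S. c b *\<^sub>R (\<phi> (z0 + b) - \<phi> z0))"
      by (rule affine_map_on_affine_relation [OF D S(1) z0 z p]) (simp_all add: c)
    also have "\<dots> = (\<Sum>b\<in>S. c b *\<^sub>R g b)"
      using S(2) g(2) by (intro sum.cong) auto
    also have "\<dots> = g (z - z0)"
      unfolding c by (simp add: linear_sum [OF g(1)] linear_scale [OF g(1)])
    finally show "\<phi> z - \<phi> z0 = g (z - z0)" .
  qed
qed

text \<open>The image of the piece has affine dimension at most \<open>card s - 1\<close>, and the
  apex \<open>q\<close> adds at most one direction. For a face with fewer than \<open>d\<close>
  vertices, the cone over its image from \<open>q\<close> thus lies in a proper affine subspace of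
  the chart.\<close>

lemma affine_image_cone_span:
  fixes \<phi> :: "('v \<Rightarrow>\<^sub>0 real) \<Rightarrow> 'b::real_vector"
  assumes D: "convex D" "affine_map_on D \<phi>" and s: "finite s"
    and sub: "\<And>z. z \<in> D \<Longrightarrow> Poly_Mapping.keys z \<subseteq> s \<and> mass z = 1"
  obtains B where "finite B" "card B \<le> card s" "\<And>z. z \<in> D \<Longrightarrow> \<phi> z - q \<in> span B"
proof (cases "D = {}")
  case True
  then show ?thesis
    using that [of "{}"] by simp
next
  case False
  then obtain z0 where z0: "z0 \<in> D"
    by blast
  have "s \<noteq> {}"
    using sub [OF z0] by (auto simp: mass_def)
  then obtain a where a: "a \<in> s"
    by blast
  obtain g where g: "linear g" "\<And>z. z \<in> D \<Longrightarrow> \<phi> z - \<phi> z0 = g (z - z0)"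
    using affine_map_on_linear_extension [OF D z0] by blast
  define B where "B = insert (\<phi> z0 - q) ((\<lambda>i. g (unit_vec i - unit_vec a)) ` (s - {a}))"
  show ?thesis
  proof (rule that)
    show "finite B"
      using s by (simp add: B_def)
    have "card B \<le> Suc (card (s - {a}))"
      unfolding B_def using s by (intro order_trans [OF card_insert_le_m1]) (auto simp: card_insert_if intro: card_image_le le_SucI)
    then show "card B \<le> card s"
      using card_Suc_Diff1 [OF s a] by simp
    fix z assume z: "z \<in> D"
    define l where "l = Poly_Mapping.lookup (z - z0)"
    have keys: "Poly_Mapping.keys (z - z0) \<subseteq> s"
      using sub [OF z] sub [OF z0] keys_diff [of z z0] by blast
    have "(\<Sum>i\<in>s. l i) = 0"
      using mass_eq_sum [OF s keys] sub [OF z] sub [OF z0] by (simp add: l_def mass_minus)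
    then have "(\<Sum>i\<in>s. l i *\<^sub>R unit_vec a) = 0"
      by (simp flip: scaleR_left.sum)
    moreover have "z - z0 = (\<Sum>i\<in>s. l i *\<^sub>R unit_vec i)"
      using sum_unit_vec [OF s keys] by (simp add: l_def)
    ultimately have "z - z0 = (\<Sum>i\<in>s. l i *\<^sub>R (unit_vec i - unit_vec a))"
      by (simp add: scaleR_diff_right sum_subtractf)
    then have "g (z - z0) = (\<Sum>i\<in>s. l i *\<^sub>R g (unit_vec i - unit_vec a))"
      by (simp add: linear_sum [OF g(1)] linear_scale [OF g(1)])
    moreover have "g (unit_vec i - unit_vec a) \<in> span B" if "i \<in> s" for i
    proof (cases "i = a")
      case True
      then show ?thesis
        by (simp add: linear_0 [OF g(1)] span_zero)
    next
      case False
      then show ?thesis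
        using that by (intro span_base) (auto simp: B_def)
    qed
    ultimately have "g (z - z0) \<in> span B"
      by (auto intro: span_sum span_scale)
    moreover have "\<phi> z0 - q \<in> span B"
      by (intro span_base) (simp add: B_def)
    ultimately have "g (z - z0) + (\<phi> z0 - q) \<in> span B"
      by (rule span_add)
    then show "\<phi> z - q \<in> span B"
      using g(2) [OF z] by (simp add: algebra_simps)
  qed
qed

text \<open>A real vector space is not a finite union of proper subspaces. In the induction step, if
  \<open>w\<close> lies in the new subspace, the line through \<open>w\<close> in a direction
  \<open>u\<close> outside it leaves it for every nonzero \<open>t\<close> and meets each earlier
  subspace at most once.\<close>

lemma vector_avoiding_subspaces:
  fixes E :: "'b::real_vector set"
  assumes E: "subspace E" and fin: "finite \<D>" and D: "\<And>D. D \<in> \<D> \<Longrightarrow> subspace D \<and> \<not> E \<subseteq> D"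
  obtains w where "w \<in> E" "\<And>D. D \<in> \<D> \<Longrightarrow> w \<notin> D"
proof -
  have "\<exists>w\<in>E. \<forall>D\<in>\<D>. w \<notin> D"
    using fin D
  proof (induction \<D> rule: finite_induct)
    case empty
    then show ?case
      using subspace_0 [OF E] by blast
  next
    case (insert D \<D>)
    then obtain w where w: "w \<in> E" "\<And>D. D \<in> \<D> \<Longrightarrow> w \<notin> D"
      by blast
    show ?case
    proof (cases "w \<in> D")
      case False
      then show ?thesis
        using w by blast
    next
      case True
      obtain u where u: "u \<in> E" "u \<notin> D"
        using insert.prems by blast
      have one: "finite {t. w + t *\<^sub>R u \<in> D'}" if "D' \<in> \<D>" for D'
      proof -
        have sub: "subspace D'"
          using insert.prems that by blast
        have "t = t'" if t: "w + t *\<^sub>R u \<in> D'" "w + t' *\<^sub>R u \<in> D'" for t t'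
        proof (rule ccontr)
          assume "t \<noteq> t'"
          have "(w + t *\<^sub>R u) - (w + t' *\<^sub>R u) \<in> D'"
            using sub t by (rule subspace_diff)
          then have "(t - t') *\<^sub>R u \<in> D'"
            by (simp add: scaleR_diff_left)
          then have "inverse (t - t') *\<^sub>R ((t - t') *\<^sub>R u) \<in> D'"
            by (rule subspace_scale [OF sub])
          then have "u \<in> D'"
            using \<open>t \<noteq> t'\<close> by simp
          then have "(w + t *\<^sub>R u) - t *\<^sub>R u \<in> D'"
            using sub t by (intro subspace_diff subspace_scale)
          then show False
            using w(2) \<open>D' \<in> \<D>\<close> by simp
        qed
        then have "{t. w + t *\<^sub>R u \<in> D'} = {} \<or> (\<exists>t. {t. w + t *\<^sub>R u \<in> D'} = {t})"
          by blast
        then show ?thesis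
          by auto
      qed
      have "finite (insert 0 (\<Union>D'\<in>\<D>. {t. w + t *\<^sub>R u \<in> D'}))"
        using insert.hyps one by simp
      then obtain t where t: "t \<notin> insert 0 (\<Union>D'\<in>\<D>. {t. w + t *\<^sub>R u \<in> D'})"
        using ex_new_if_finite [OF infinite_UNIV_char_0] by blast
      have sub: "subspace D"
        using insert.prems by blast
      have "w + t *\<^sub>R u \<notin> D"
      proof
        assume "w + t *\<^sub>R u \<in> D"
        then have "t *\<^sub>R u \<in> D"
          using subspace_diff [OF sub _ True] by fastforce
        then have "inverse t *\<^sub>R (t *\<^sub>R u) \<in> D"
          by (rule subspace_scale [OF sub])
        then show False
          using t u by simp
      qed
      moreover have "w + t *\<^sub>R u \<in> E"
        using E w u by (simp add: subspace_add subspace_scale)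
      ultimately show ?thesis
        using t by auto
    qed
  qed
  then show ?thesis
    using that by blast
qed

text \<open>A line whose direction avoids all the subspaces meets each of their translates by
  \<open>q\<close> at most once, so only finitely many points of a short segment inside
  \<open>P\<close> are bad.\<close>

lemma open_point_avoiding_subspaces:
  fixes E :: "'b::real_normed_vector set"
  assumes E: "subspace E" and fin: "finite \<D>" and D: "\<And>D. D \<in> \<D> \<Longrightarrow> subspace D \<and> \<not> E \<subseteq> D"
    and P: "openin (top_of_set E) P" "P \<noteq> {}"
  obtains p where "p \<in> P" "\<And>D. D \<in> \<D> \<Longrightarrow> p - q \<notin> D"
proof -
  obtain w where w: "w \<in> E" "\<And>D. D \<in> \<D> \<Longrightarrow> w \<notin> D"
    using vector_avoiding_subspaces [OF E fin D] by blast
  obtain p0 where p0: "p0 \<in> P"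
    using P by blast
  obtain e where e: "e > 0" "\<And>t. \<bar>t\<bar> < e \<Longrightarrow> p0 + t *\<^sub>R w \<in> P"
    using openin_subspace_line [OF P(1) E p0 w(1)] by blast
  have one: "finite {t. p0 + t *\<^sub>R w - q \<in> D}" if "D \<in> \<D>" for D
  proof -
    have sub: "subspace D"
      using D that by blast
    have "t = t'" if t: "p0 + t *\<^sub>R w - q \<in> D" "p0 + t' *\<^sub>R w - q \<in> D" for t t'
    proof (rule ccontr)
      assume "t \<noteq> t'"
      have "(p0 + t *\<^sub>R w - q) - (p0 + t' *\<^sub>R w - q) \<in> D"
        using sub t by (rule subspace_diff)
      then have "(t - t') *\<^sub>R w \<in> D"
        by (simp add: scaleR_diff_left)
      then have "inverse (t - t') *\<^sub>R ((t - t') *\<^sub>R w) \<in> D"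
        by (rule subspace_scale [OF sub])
      then show False
        using \<open>t \<noteq> t'\<close> w(2) \<open>D \<in> \<D>\<close> by simp
    qed
    then have "{t. p0 + t *\<^sub>R w - q \<in> D} = {} \<or> (\<exists>t. {t. p0 + t *\<^sub>R w - q \<in> D} = {t})"
      by blast
    then show ?thesis
      by auto
  qed
  have "finite (\<Union>D\<in>\<D>. {t. p0 + t *\<^sub>R w - q \<in> D})"
    using fin one by simp
  moreover have "infinite {0<..<e}"
    using e(1) by (simp add: infinite_Ioo)
  ultimately obtain t where t: "t \<in> {0<..<e}" "t \<notin> (\<Union>D\<in>\<D>. {t. p0 + t *\<^sub>R w - q \<in> D})"
    by (meson finite_subset subsetI)
  show ?thesis
    by (rule that [of "p0 + t *\<^sub>R w"]) (use t e(2) [of t] in auto)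
qed

lemma coord_space_not_subset_span:
  fixes B :: "('v \<Rightarrow>\<^sub>0 real) set"
  assumes I: "finite I" and B: "finite B" "card B < card I"
  shows "\<not> coord_space I \<subseteq> span B"
proof
  assume sub: "coord_space I \<subseteq> span B"
  have inj: "inj_on unit_vec I"
    by (rule inj_onI) (metis keys_unit_vec singleton_inject)
  have "independent (unit_vec ` I :: ('v \<Rightarrow>\<^sub>0 real) set)"
  proof (rule independent_if_scalars_zero)
    show "finite (unit_vec ` I :: ('v \<Rightarrow>\<^sub>0 real) set)"
      using I by simp
    fix f and x :: "'v \<Rightarrow>\<^sub>0 real"
    assume f: "(\<Sum>x\<in>unit_vec ` I. f x *\<^sub>R x) = 0" and "x \<in> unit_vec ` I"
    then obtain i where i: "i \<in> I" "x = unit_vec i"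
      by blast
    have "(\<Sum>j\<in>I. f (unit_vec j) *\<^sub>R (unit_vec j :: 'v \<Rightarrow>\<^sub>0 real)) = 0"
      using f by (simp add: sum.reindex [OF inj])
    then have "Poly_Mapping.lookup (\<Sum>j\<in>I. f (unit_vec j) *\<^sub>R (unit_vec j :: 'v \<Rightarrow>\<^sub>0 real)) i = 0"
      by simp
    then show "f x = 0"
      using sum_unit_vec_lookup [OF I, of "\<lambda>j. f (unit_vec j)" i] i by simp
  qed
  moreover have "unit_vec ` I \<subseteq> span B"
    using sub by (auto simp: coord_space_iff lookup_unit_vec)
  ultimately have "card (unit_vec ` I :: ('v \<Rightarrow>\<^sub>0 real) set) \<le> card B"
    using independent_span_bound [OF B(1)] by blast
  then show False
    using B(2) card_image [OF inj] by simp
qed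

definition facet_adjacency :: "nat \<Rightarrow> 'v set set \<Rightarrow> ('v set \<times> 'v set) set" where
  "facet_adjacency d T = {(\<sigma>, \<tau>). facet d T \<sigma> \<and> facet d T \<tau> \<and> card (\<sigma> \<inter> \<tau>) = d}"

context triangulated_manifold
begin

text \<open>Moving \<open>x\<close> slightly towards the barycentre of \<sigma> makes all weights on
  \<sigma> positive.\<close>

lemma facet_interior_near:
  assumes \<sigma>: "facet d T \<sigma>" and x: "x \<in> X" "Poly_Mapping.keys x \<subseteq> \<sigma>"
    and N: "openin (top_of_set X) N" "x \<in> N"
  obtains y where "y \<in> N" "Poly_Mapping.keys y = \<sigma>"
proof -
  have fin: "finite \<sigma>" and ne: "\<sigma> \<noteq> {}" and \<sigma>T: "\<sigma> \<in> T"
    using \<sigma> finite_complex_finite [OF cpx] by (auto simp: facet_def)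
  obtain O' where O': "open O'" "N = X \<inter> O'"
    using N(1) by (auto simp: openin_open)
  obtain \<epsilon> where \<epsilon>: "\<epsilon> > 0" "\<And>t. \<bar>t\<bar> < \<epsilon> \<Longrightarrow> x + t *\<^sub>R (bary \<sigma> - x) \<in> O'"
    using openin_subspace_line [of UNIV O' x "bary \<sigma> - x"] O' N(2) by auto
  define t where "t = min (\<epsilon> / 2) (1 / 2)"
  have t: "0 < t" "t < 1" "\<bar>t\<bar> < \<epsilon>"
    using \<epsilon>(1) by (auto simp: t_def)
  define y where "y = x + t *\<^sub>R (bary \<sigma> - x)"
  have lookup_y: "Poly_Mapping.lookup y i = (1 - t) * Poly_Mapping.lookup x i + (if i \<in> \<sigma> then t / card \<sigma> else 0)" for i
    using fin by (simp add: y_def lookup_add lookup_minus lookup_bary algebra_simps)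
  have nn: "Poly_Mapping.lookup x i \<ge> 0" for i
    using x by (simp add: mem_X)
  have pos: "Poly_Mapping.lookup y i > 0" if "i \<in> \<sigma>" for i
    using that t nn [of i] fin ne by (simp add: lookup_y add_nonneg_pos card_gt_0_iff)
  have zero: "Poly_Mapping.lookup y i = 0" if "i \<notin> \<sigma>" for i
    using that x(2) by (auto simp: lookup_y subset_iff in_keys_iff)
  have keys: "Poly_Mapping.keys y = \<sigma>"
  proof (rule Set.set_eqI)
    show "i \<in> Poly_Mapping.keys y \<longleftrightarrow> i \<in> \<sigma>" for i
      using pos [of i] zero [of i] by (cases "i \<in> \<sigma>") (auto simp: in_keys_iff)
  qed
  have "Poly_Mapping.lookup y i \<ge> 0" for i
    using pos [of i] zero [of i] by (cases "i \<in> \<sigma>") auto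
  moreover have "mass y = 1"
    using x fin ne by (simp add: y_def mass_add mass_scaleR mass_minus mass_bary mem_X)
  ultimately have "y \<in> N"
    using \<epsilon>(2) [OF t(3)] O'(2) keys \<sigma>T by (simp add: mem_X y_def)
  then show ?thesis
    using that keys by blast
qed

text \<open>A face common to a reachable and an unreachable facet has at most \<open>d - 1\<close>
  vertices. Its affine pieces in a chart have dimension at most \<open>d - 2\<close>, and the cones
  over them from a fixed \<open>q\<close> dimension at most \<open>d - 1\<close>. Hence
  \<open>q\<close> may be any nearby point inside a facet of one class, and only \<open>p\<close>,
  inside a facet of the other, has to be generic.\<close>

lemma strongly_connected_facets:
  assumes \<sigma>: "facet d T \<sigma>" and \<tau>: "facet d T \<tau>"
  shows "(\<sigma>, \<tau>) \<in> (facet_adjacency d T)\<^sup>*"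
proof (rule ccontr)
  assume not: "(\<sigma>, \<tau>) \<notin> (facet_adjacency d T)\<^sup>*"
  define A where "A = {s. facet d T s \<and> (\<sigma>, s) \<in> (facet_adjacency d T)\<^sup>*}"
  define B where "B = {s. facet d T s \<and> (\<sigma>, s) \<notin> (facet_adjacency d T)\<^sup>*}"
  have finT: "finite T"
    using cpx by (simp add: finite_complex_def)
  have AT: "A \<subseteq> T" "B \<subseteq> T"
    by (auto simp: A_def B_def facet_def)
  then have finAB: "finite A" "finite B"
    using finT finite_subset by blast+
  have small: "card (s \<inter> t) < d" if st: "s \<in> A" "t \<in> B" for s t
  proof -
    have f: "facet d T s" "facet d T t"
      using st by (simp_all add: A_def B_def)
    have fin: "finite s" "finite t"
      using f finite_complex_finite [OF cpx] by (auto simp: facet_def)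
    have "s \<noteq> t"
      using st by (auto simp: A_def B_def)
    then have "\<not> s \<subseteq> t"
      using facet_maximal [OF f(1)] f(2) by (auto simp: facet_def)
    then have "s \<inter> t \<subset> s"
      by blast
    then have "card (s \<inter> t) < d + 1"
      using psubset_card_mono [OF fin(1)] f by (auto simp: facet_def)
    moreover have "card (s \<inter> t) \<noteq> d"
    proof
      assume "card (s \<inter> t) = d"
      then have "(s, t) \<in> facet_adjacency d T"
        using f by (simp add: facet_adjacency_def)
      then show False
        using st by (auto simp: A_def B_def intro: rtrancl_into_rtrancl)
    qed
    ultimately show ?thesis
      by simp
  qed
  define XA where "XA = (\<Union>s\<in>A. convex hull (unit_vec ` s))"
  define XB where "XB = (\<Union>s\<in>B. convex hull (unit_vec ` s))"
  have in_hull: "x \<in> convex hull (unit_vec ` s) \<longleftrightarrow> x \<in> X \<and> Poly_Mapping.keys x \<subseteq> s" if "s \<in> T" for x s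
    using that finite_complex_finite [OF cpx that] finite_complex_downward [OF cpx that]
    by (auto simp: convex_hull_unit_vec mem_X)
  have XA: "x \<in> XA \<longleftrightarrow> x \<in> X \<and> (\<exists>s\<in>A. Poly_Mapping.keys x \<subseteq> s)" for x
    unfolding XA_def using AT(1) in_hull by blast
  have XB: "x \<in> XB \<longleftrightarrow> x \<in> X \<and> (\<exists>s\<in>B. Poly_Mapping.keys x \<subseteq> s)" for x
    unfolding XB_def using AT(2) in_hull by blast
  have closed: "closed XA" "closed XB"
    unfolding XA_def XB_def using finAB AT finite_complex_finite [OF cpx]
    by (intro closed_UN compact_imp_closed finite_imp_compact_convex_hull; auto)+
  have cover: "X \<subseteq> XA \<union> XB"
  proof
    fix x assume x: "x \<in> X"
    then obtain s where "facet d T s" "Poly_Mapping.keys x \<subseteq> s"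
      using subset_facet [of "Poly_Mapping.keys x"] by (auto simp: mem_X)
    then show "x \<in> XA \<union> XB"
      using x by (auto simp: XA XB A_def B_def)
  qed
  have bar: "bary s \<in> X" "Poly_Mapping.keys (bary s) = s" if "facet d T s" for s
  proof -
    have "s \<in> T" "finite s" "s \<noteq> {}"
      using that finite_complex_finite [OF cpx] by (auto simp: facet_def)
    then show "bary s \<in> X" "Poly_Mapping.keys (bary s) = s"
      using bary_mem_realization [OF cpx] keys_bary by auto
  qed
  have "\<sigma> \<in> A" "\<tau> \<in> B"
    using \<sigma> \<tau> not by (auto simp: A_def B_def)
  then have "bary \<sigma> \<in> XA \<inter> X" "bary \<tau> \<in> XB \<inter> X"
    using bar \<sigma> \<tau> by (auto simp: XA XB)
  then obtain x where x: "x \<in> X" "x \<in> XA" "x \<in> XB"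
    using connected_closedD [OF X_connected _ cover closed] by blast
  then obtain \<sigma>' \<tau>' where \<sigma>': "\<sigma>' \<in> A" "Poly_Mapping.keys x \<subseteq> \<sigma>'" and \<tau>': "\<tau>' \<in> B" "Poly_Mapping.keys x \<subseteq> \<tau>'"
    by (auto simp: XA XB)
  have f': "facet d T \<sigma>'" "facet d T \<tau>'"
    using \<sigma>' \<tau>' by (simp_all add: A_def B_def)
  obtain U W \<phi> \<psi> F where U: "openin (top_of_set X) U" "x \<in> U"
    and V: "openin (top_of_set (real_space d)) (\<phi> ` U)" and hom: "homeomorphism U (\<phi> ` U) \<phi> \<psi>"
    and F: "finite F" "\<And>D. D \<in> F \<Longrightarrow> convex D \<and> D \<subseteq> U \<and> affine_map_on D \<phi>"
    and W: "openin (top_of_set X) W" "x \<in> W" "W \<subseteq> \<Union>F"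
    using pl_chart [OF x(1)] by metis
  have inv: "\<psi> (\<phi> u) = u" if "u \<in> U" for u
    using hom that by (simp add: homeomorphism_def)
  have UX: "U \<subseteq> X"
    using U openin_imp_subset by blast
  have open_img: "openin (top_of_set (real_space d)) (\<phi> ` S)" if S: "openin (top_of_set X) S" "S \<subseteq> U" for S
  proof -
    have "openin (top_of_set U) S"
      using openin_subset_trans [OF S UX] .
    then have "openin (top_of_set (\<phi> ` U)) (\<phi> ` S)"
      by (rule homeomorphism_imp_open_map [OF hom])
    then show ?thesis
      using V by (rule openin_trans)
  qed
  have E: "subspace (real_space d)"
    by (simp add: real_space_eq subspace_coord_space)
  have "openin (top_of_set (real_space d)) (\<phi> ` (U \<inter> W))"
    using U W by (intro open_img openin_Int) auto
  moreover have "\<phi> x \<in> \<phi> ` (U \<inter> W)"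
    using U W by blast
  ultimately obtain r where r: "r > 0" "ball (\<phi> x) r \<inter> real_space d \<subseteq> \<phi> ` (U \<inter> W)"
    unfolding openin_contains_ball by blast
  \<comment> \<open>Cut out by a ball, so that segments between its points stay where the chart is
    inverted and covered by affine pieces.\<close>
  define V' where "V' = ball (\<phi> x) r \<inter> real_space d"
  have conv: "convex V'"
    unfolding V'_def using E by (intro convex_Int convex_ball subspace_imp_convex)
  define N where "N = U \<inter> \<phi> -` V'"
  have "openin (top_of_set U) N"
  proof -
    have "openin (top_of_set (\<phi> ` U)) V'"
    proof (rule openin_subset_trans)
      show "openin (top_of_set (real_space d)) V'"
        by (auto simp: V'_def openin_open)
      show "V' \<subseteq> \<phi> ` U"
        using r(2) by (auto simp: V'_def)
      show "\<phi> ` U \<subseteq> real_space d"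
        using V openin_imp_subset by blast
    qed
    then show ?thesis
      using hom unfolding N_def homeomorphism_def by (metis continuous_on_open)
  qed
  then have N: "openin (top_of_set X) N"
    using U(1) by (rule openin_trans)
  have xN: "x \<in> N"
    using U V r(1) openin_imp_subset [OF V] by (auto simp: N_def V'_def)
  have \<psi>V: "\<psi> y \<in> U \<inter> W" "\<phi> (\<psi> y) = y" if "y \<in> V'" for y
    using that r(2) inv by (auto simp: V'_def)
  obtain z where z: "z \<in> N" "Poly_Mapping.keys z = \<tau>'"
    using facet_interior_near [OF f'(2) x(1) \<tau>'(2) N xN] .
  obtain y0 where y0: "y0 \<in> N" "Poly_Mapping.keys y0 = \<sigma>'"
    using facet_interior_near [OF f'(1) x(1) \<sigma>'(2) N xN] .
  define q where "q = \<phi> z"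
  \<comment> \<open>The points \<open>p\<close> for which the segment from \<open>q\<close> to \<open>p\<close> meets the image of a small face lie in finitely
    many proper affine subspaces through \<open>q\<close>.\<close>
  have "\<exists>B'. finite B' \<and> card B' < d \<and> (\<forall>y\<in>D. Poly_Mapping.keys y \<subseteq> s \<inter> t \<longrightarrow> \<phi> y - q \<in> span B')"
    if D: "D \<in> F" and st: "s \<in> A" "t \<in> B" for D s t
  proof -
    have fin: "finite (s \<inter> t)"
      using st AT finite_complex_finite [OF cpx] by auto
    define D' where "D' = D \<inter> convex hull (unit_vec ` (s \<inter> t))"
    have "convex D'" "affine_map_on D' \<phi>"
      using F(2) [OF D] by (auto simp: D'_def intro: convex_Int affine_map_on_subset)
    moreover have "Poly_Mapping.keys y \<subseteq> s \<inter> t \<and> mass y = 1" if "y \<in> D'" for y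
      using that by (auto simp: D'_def convex_hull_unit_vec [OF fin])
    ultimately obtain B' where B': "finite B'" "card B' \<le> card (s \<inter> t)" "\<And>y. y \<in> D' \<Longrightarrow> \<phi> y - q \<in> span B'"
      using affine_image_cone_span [OF _ _ fin] by metis
    have "y \<in> D'" if "y \<in> D" "Poly_Mapping.keys y \<subseteq> s \<inter> t" for y
    proof -
      have "y \<in> X"
        using that F(2) [OF D] UX by blast
      then show ?thesis
        using that by (simp add: D'_def convex_hull_unit_vec [OF fin] mem_X)
    qed
    then show ?thesis
      using B' small [OF st] by (intro exI [of _ B']) auto
  qed
  then obtain B' where B': "\<And>D s t. D \<in> F \<Longrightarrow> s \<in> A \<Longrightarrow> t \<in> B \<Longrightarrow> finite (B' D s t) \<and> card (B' D s t) < d \<and>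
      (\<forall>y\<in>D. Poly_Mapping.keys y \<subseteq> s \<inter> t \<longrightarrow> \<phi> y - q \<in> span (B' D s t))"
    by metis
  define \<D> where "\<D> = (\<lambda>(D, s, t). span (B' D s t)) ` (F \<times> A \<times> B)"
  have fin\<D>: "finite \<D>"
    using F(1) finAB by (simp add: \<D>_def)
  have proper: "subspace D \<and> \<not> real_space d \<subseteq> D" if "D \<in> \<D>" for D
    using that B' coord_space_not_subset_span [of "{..<d}"] by (auto simp: \<D>_def real_space_eq)
  \<comment> \<open>Open in \<open>X\<close>, because a simplex containing the facet
    \<open>\<sigma>'\<close> equals it. Its image is therefore an open set of candidates for
    \<open>p\<close>.\<close>
  define P where "P = {y \<in> N. Poly_Mapping.keys y = \<sigma>'}"
  have "openin (top_of_set X) P"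
  proof -
    have fin: "finite \<sigma>'"
      using f'(1) finite_complex_finite [OF cpx] by (auto simp: facet_def)
    have "P = N \<inter> {y \<in> X. \<forall>i\<in>\<sigma>'. Poly_Mapping.lookup y i > 0}"
    proof (intro equalityI subsetI)
      fix y assume y: "y \<in> P"
      then have yX: "y \<in> X"
        using openin_imp_subset [OF N] by (auto simp: P_def)
      have "Poly_Mapping.lookup y i > 0" if "i \<in> \<sigma>'" for i
      proof -
        have "Poly_Mapping.lookup y i \<noteq> 0"
          using y that by (auto simp: P_def simp flip: in_keys_iff)
        moreover have "Poly_Mapping.lookup y i \<ge> 0"
          using yX by (simp add: mem_X)
        ultimately show ?thesis
          by simp
      qed
      then show "y \<in> N \<inter> {y \<in> X. \<forall>i\<in>\<sigma>'. Poly_Mapping.lookup y i > 0}"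
        using y yX by (simp add: P_def)
    next
      fix y assume y: "y \<in> N \<inter> {y \<in> X. \<forall>i\<in>\<sigma>'. Poly_Mapping.lookup y i > 0}"
      then have "\<sigma>' \<subseteq> Poly_Mapping.keys y"
        by (force simp: in_keys_iff)
      then have "Poly_Mapping.keys y = \<sigma>'"
        using y facet_maximal [OF f'(1)] by (auto simp: mem_X)
      then show "y \<in> P"
        using y by (simp add: P_def)
    qed
    then show ?thesis
      using N openin_star [OF fin] by (simp add: openin_Int)
  qed
  then have "openin (top_of_set (real_space d)) (\<phi> ` P)"
    by (rule open_img) (auto simp: P_def N_def)
  moreover have "\<phi> ` P \<noteq> {}"
    using y0 by (auto simp: P_def)
  ultimately obtain p where p: "p \<in> \<phi> ` P" "\<And>D. D \<in> \<D> \<Longrightarrow> p - q \<notin> D"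
    using open_point_avoiding_subspaces [OF E fin\<D> proper] by metis
  obtain y where y: "y \<in> P" "p = \<phi> y"
    using p(1) by blast
  have pqV: "p \<in> V'" "q \<in> V'"
    using y z by (auto simp: P_def N_def q_def)
  then have seg: "closed_segment q p \<subseteq> V'"
    using conv by (simp add: closed_segment_subset)
  define Y where "Y = \<psi> ` closed_segment q p"
  have "connected Y"
    unfolding Y_def
  proof (rule connected_continuous_image)
    show "continuous_on (closed_segment q p) \<psi>"
    proof (rule continuous_on_subset)
      show "continuous_on (\<phi> ` U) \<psi>"
        using hom by (simp add: homeomorphism_def)
      show "closed_segment q p \<subseteq> \<phi> ` U"
        using seg r(2) by (auto simp: V'_def)
    qed
  qed simp
  moreover have YX: "Y \<subseteq> X"
    using seg \<psi>V UX by (auto simp: Y_def)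
  moreover have "y \<in> XA \<inter> Y" "z \<in> XB \<inter> Y"
  proof -
    have "\<psi> p = y" "\<psi> q = z"
      using y z inv by (auto simp: P_def N_def q_def)
    then have "y \<in> Y" "z \<in> Y"
      by (auto simp: Y_def)
    then show "y \<in> XA \<inter> Y" "z \<in> XB \<inter> Y"
      using YX y z \<sigma>' \<tau>' by (auto simp: XA XB P_def)
  qed
  ultimately obtain u where u: "u \<in> Y" "u \<in> XA" "u \<in> XB"
    using connected_closedD [of Y XA XB] closed cover by blast
  then obtain s t where st: "s \<in> A" "t \<in> B" "Poly_Mapping.keys u \<subseteq> s \<inter> t"
    by (auto simp: XA XB)
  obtain w where w: "w \<in> closed_segment q p" "u = \<psi> w"
    using u(1) by (auto simp: Y_def)
  obtain m where "0 \<le> m" "m \<le> 1" and wm: "w = (1 - m) *\<^sub>R q + m *\<^sub>R p"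
    using w(1) unfolding in_segment by blast
  then have m: "0 \<le> m" "m \<le> 1" "u = \<psi> ((1 - m) *\<^sub>R q + m *\<^sub>R p)"
      "(1 - m) *\<^sub>R q + m *\<^sub>R p \<in> V'"
    using w seg by auto
  have uW: "u \<in> U" "u \<in> W" and \<phi>u: "\<phi> u = (1 - m) *\<^sub>R q + m *\<^sub>R p"
    using \<psi>V [OF m(4)] m(3) by auto
  obtain D where D: "D \<in> F" "u \<in> D"
    using uW(2) W(3) by blast
  have "\<phi> u - q \<in> span (B' D s t)"
    using B' [OF D(1) st(1,2)] D(2) st(3) by blast
  then have in_span: "m *\<^sub>R (p - q) \<in> span (B' D s t)"
    unfolding \<phi>u by (simp add: algebra_simps)
  show False
  \<comment> \<open>At \<open>m = 0\<close> the cone with apex \<open>q\<close> gives no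
    information, but there the point is \<open>z\<close>, whose support is a whole facet of the
    second class. Otherwise the direction \<open>p - q\<close> itself lies in one of the avoided
    subspaces.\<close>
  proof (cases "m = 0")
    case True
    then have "u = z"
      using m(3) z inv by (simp add: q_def N_def)
    then have "\<tau>' \<subseteq> s"
      using st(3) z(2) by blast
    then have "s = \<tau>'"
      using facet_maximal [OF f'(2)] AT st(1) by blast
    then show False
      using st(1) \<tau>'(1) by (auto simp: A_def B_def)
  next
    case False
    then have "p - q \<in> span (B' D s t)"
      using span_scale [OF in_span, of "inverse m"] by simp
    moreover have "span (B' D s t) \<in> \<D>"
      using D(1) st by (auto simp: \<D>_def)
    ultimately show False
      using p(2) by blast
  qed
qed

end

section \<open>Subdivisions and bistellar moves\<close>

lemma isomorphic_complex_refl: "isomorphic_complex S S"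
  unfolding isomorphic_complex_def by (rule exI [of _ id]) auto

lemma isomorphic_complex_sym:
  assumes "isomorphic_complex S T"
  shows "isomorphic_complex T S"
proof -
  obtain f where f: "bij_betw f (\<Union>S) (\<Union>T)" "T = (`) f ` S"
    using assms by (auto simp: isomorphic_complex_def)
  let ?g = "inv_into (\<Union>S) f"
  have "?g ` f ` s = s" if "s \<in> S" for s
    using that f(1) by (intro inv_into_image_cancel) (auto simp: bij_betw_def)
  then have "(`) ?g ` T = S"
    unfolding f(2) image_image by simp
  then show ?thesis
    using bij_betw_inv_into [OF f(1)] unfolding isomorphic_complex_def by metis
qed

lemma isomorphic_complex_trans:
  assumes "isomorphic_complex R S" "isomorphic_complex S T"
  shows "isomorphic_complex R T"
proof -
  obtain f where f: "bij_betw f (\<Union>R) (\<Union>S)" "S = (`) f ` R"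
    using assms by (auto simp: isomorphic_complex_def)
  obtain g where g: "bij_betw g (\<Union>S) (\<Union>T)" "T = (`) g ` S"
    using assms by (auto simp: isomorphic_complex_def)
  have "T = (`) (g \<circ> f) ` R"
    unfolding g(2) f(2) image_image image_comp [symmetric] ..
  then show ?thesis
    using bij_betw_trans [OF f(1) g(1)] unfolding isomorphic_complex_def by metis
qed

lemma iso_class_eq: "isomorphic_complex S T \<Longrightarrow> iso_class S = iso_class T"
  unfolding iso_class_def using isomorphic_complex_sym isomorphic_complex_trans by blast

lemma mem_iso_class: "T \<in> iso_class T"
  by (simp add: iso_class_def isomorphic_complex_refl)

lemma iso_class_mem: "S \<in> iso_class T \<Longrightarrow> iso_class T = iso_class S"
  by (rule iso_class_eq) (simp add: iso_class_def)

lemma isomorphic_complex_card: "isomorphic_complex S T \<Longrightarrow> card (\<Union>S) = card (\<Union>T)"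
  by (auto simp: isomorphic_complex_def dest: bij_betw_same_card)

text \<open>The proper faces of \<sigma> are removed with the old ball and return with the new one.
  On balance \<sigma> alone is replaced, by the cone from \<open>v\<close> over its
  boundary.\<close>

lemma facet_subdivision_eq:
  assumes "finite_complex T" "\<sigma> \<in> T"
  shows "facet_subdivision T \<sigma> v = (T - {\<sigma>}) \<union> insert v ` {s. s \<subset> \<sigma>}"
proof -
  define P where "P = {s. s \<subset> \<sigma>}"
  have "boundary {v} = {{}}"
    by (auto simp: boundary_def)
  then have "simplicial_join (Pow \<sigma>) (boundary {v}) = insert \<sigma> P"
    by (auto simp: simplicial_join_def P_def)
  moreover have "simplicial_join P (Pow {v}) = P \<union> insert v ` P"
  proof -
    have "simplicial_join P (Pow {v}) = (\<Union>t\<in>Pow {v}. (\<lambda>s. s \<union> t) ` P)"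
      unfolding simplicial_join_def by blast
    moreover have pow: "Pow {v} = {{}, {v}}"
      by auto
    ultimately show ?thesis
      unfolding pow by (simp add: Un_commute)
  qed
  moreover have "P \<subseteq> T" "\<sigma> \<notin> P"
    using finite_complex_downward [OF assms] by (auto simp: P_def)
  moreover have "boundary \<sigma> = P"
    by (simp add: boundary_def P_def)
  ultimately have "facet_subdivision T \<sigma> v = (T - insert \<sigma> P) \<union> (P \<union> insert v ` P)"
    by (simp add: facet_subdivision_def bistellar_move_def)
  also have "\<dots> = (T - {\<sigma>}) \<union> insert v ` P"
    using \<open>P \<subseteq> T\<close> \<open>\<sigma> \<notin> P\<close> by blast
  finally show ?thesis
    by (simp add: P_def)
qed

text \<open>By the link condition, the simplices of \<open>T\<close> above \<alpha> are the unions
  of \<alpha> with proper subsets of \<beta>, and all of them are removed. Every other removed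
  simplex returns as part of the new ball.\<close>

lemma bistellar_move_eq:
  assumes T: "finite_complex T" and link: "link T \<alpha> = boundary \<beta>"
  shows "bistellar_move T \<alpha> \<beta> = {x \<in> T. \<not> \<alpha> \<subseteq> x} \<union> simplicial_join (boundary \<alpha>) (Pow \<beta>)"
proof -
  have "x \<in> simplicial_join (Pow \<alpha>) (boundary \<beta>)" if x: "x \<in> T" "\<alpha> \<subseteq> x" for x
  proof -
    have "x - \<alpha> \<in> link T \<alpha>"
      using x finite_complex_downward [OF T x(1), of "x - \<alpha>"] by (auto simp: link_def Un_absorb2)
    then have "x = \<alpha> \<union> (x - \<alpha>) \<and> \<alpha> \<in> Pow \<alpha> \<and> x - \<alpha> \<in> boundary \<beta>"
      using x(2) link by auto
    then show ?thesis
      unfolding simplicial_join_def by blast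
  qed
  moreover have "x \<in> simplicial_join (boundary \<alpha>) (Pow \<beta>)"
    if "x \<in> simplicial_join (Pow \<alpha>) (boundary \<beta>)" "\<not> \<alpha> \<subseteq> x" for x
    using that unfolding simplicial_join_def boundary_def by blast
  ultimately show ?thesis
    unfolding bistellar_move_def by blast
qed

lemma Union_facet_subdivision:
  assumes "finite_complex T" "\<sigma> \<in> T" "card \<sigma> \<ge> 2"
  shows "\<Union>(facet_subdivision T \<sigma> v) = insert v (\<Union>T)"
proof -
  have "\<sigma> \<noteq> {}"
    using assms(3) by auto
  then have "insert v {} \<in> facet_subdivision T \<sigma> v"
    unfolding facet_subdivision_eq [OF assms(1,2)] by blast
  moreover have "{x} \<in> facet_subdivision T \<sigma> v" if "x \<in> \<Union>T" for x
  proof -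
    have "{x} \<in> T"
      using that finite_complex_downward [OF assms(1)] by blast
    moreover have "{x} \<noteq> \<sigma>"
      using assms(3) by auto
    ultimately show ?thesis
      unfolding facet_subdivision_eq [OF assms(1,2)] by blast
  qed
  ultimately have "insert v (\<Union>T) \<subseteq> \<Union>(facet_subdivision T \<sigma> v)"
    by blast
  moreover have "\<Union>(facet_subdivision T \<sigma> v) \<subseteq> insert v (\<Union>T)"
    using assms(2) unfolding facet_subdivision_eq [OF assms(1,2)] by auto
  ultimately show ?thesis
    by blast
qed

lemma Union_stellar_subdivision:
  assumes "finite_complex T" "\<alpha> \<in> T" "card \<alpha> \<ge> 2"
  shows "\<Union>(stellar_subdivision T \<alpha> v) = insert v (\<Union>T)"
proof -
  have "\<alpha> \<noteq> {}" "{} \<in> T"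
    using assms by (auto simp: finite_complex_def)
  then have "insert v {} \<in> stellar_subdivision T \<alpha> v"
    using assms(2) unfolding stellar_subdivision_def by auto
  moreover have "{x} \<in> stellar_subdivision T \<alpha> v" if "x \<in> \<Union>T" for x
  proof -
    have "{x} \<in> T"
      using that finite_complex_downward [OF assms(1)] by blast
    moreover have "\<not> \<alpha> \<subseteq> {x}"
      using assms(3) card_mono [of "{x}" \<alpha>] by auto
    ultimately show ?thesis
      unfolding stellar_subdivision_def by blast
  qed
  ultimately show ?thesis
    unfolding stellar_subdivision_def by blast
qed

text \<open>The isomorphism is extended by sending one new vertex to the other. Taking
  \<open>f\<close> to be the identity covers a mere change of the label \<open>v\<close>.\<close>

lemma facet_subdivision_isomorphic:
  assumes T: "finite_complex T" and f: "bij_betw f (\<Union>T) (\<Union>T')" "T' = (`) f ` T"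
    and \<sigma>: "\<sigma> \<in> T" "card \<sigma> \<ge> 2" and v: "v \<notin> \<Union>T" "v' \<notin> \<Union>T'"
  shows "isomorphic_complex (facet_subdivision T \<sigma> v) (facet_subdivision T' (f ` \<sigma>) v')"
proof -
  have inj: "inj_on f (\<Union>T)"
    using f(1) by (rule bij_betw_imp_inj_on)
  have T': "finite_complex T'" "f ` \<sigma> \<in> T'"
    using finite_complex_image [OF T] f(2) \<sigma> by auto
  have "card (f ` \<sigma>) = card \<sigma>"
    by (rule card_image) (use inj \<sigma> in \<open>auto intro: inj_on_subset\<close>)
  then have U': "\<Union>(facet_subdivision T' (f ` \<sigma>) v') = insert v' (\<Union>T')"
    using Union_facet_subdivision [OF T'] \<sigma> by simp
  define h where "h = f(v := v')"
  have hf: "h ` s = f ` s" if "s \<subseteq> \<Union>T" for s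
    using that v(1) by (auto simp: h_def)
  have hv: "h v = v'"
    by (simp add: h_def)
  have "bij_betw h (\<Union>T) (\<Union>T') \<longleftrightarrow> bij_betw f (\<Union>T) (\<Union>T')"
    using v(1) by (intro bij_betw_cong) (auto simp: h_def)
  then have "bij_betw h (\<Union>T) (\<Union>T')"
    using f(1) by simp
  then have bij: "bij_betw h (insert v (\<Union>T)) (insert v' (\<Union>T'))"
    using v by (intro bij_betw_combine [of h "{v}" "{v'}" "\<Union>T" "\<Union>T'", simplified]) (auto simp: h_def)
  have "(`) h ` (T - {\<sigma>}) = T' - {f ` \<sigma>}"
  proof -
    have "(`) h ` (T - {\<sigma>}) = (`) f ` (T - {\<sigma>})"
    proof (rule image_cong [OF refl])
      fix s assume "s \<in> T - {\<sigma>}"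
      then show "h ` s = f ` s"
        by (intro hf) blast
    qed
    also have "\<dots> = T' - {f ` \<sigma>}"
    proof -
      have "s = \<sigma>" if "s \<in> T" "f ` s = f ` \<sigma>" for s
        using inj_on_image_eq_iff [OF inj, of s \<sigma>] that \<sigma> by blast
      then show ?thesis
        unfolding f(2) using \<sigma> by blast
    qed
    finally show ?thesis .
  qed
  moreover have "(`) h ` insert v ` {s. s \<subset> \<sigma>} = insert v' ` {s. s \<subset> f ` \<sigma>}"
  proof -
    have "h ` insert v s = insert v' (f ` s)" if "s \<subset> \<sigma>" for s
    proof -
      have "s \<subseteq> \<Union>T"
        using that \<sigma> by blast
      then show ?thesis
        using hf hv by simp
    qed
    then have "(`) h ` insert v ` {s. s \<subset> \<sigma>} = insert v' ` (`) f ` {s. s \<subset> \<sigma>}"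
      unfolding image_image by (intro image_cong) auto
    also have "(`) f ` {s. s \<subset> \<sigma>} = {s. s \<subset> f ` \<sigma>}"
    proof -
      have inj\<sigma>: "inj_on f \<sigma>"
        using inj \<sigma> by (auto intro: inj_on_subset)
      have "f ` s \<subset> f ` \<sigma>" if "s \<subset> \<sigma>" for s
        using that inj_on_image_eq_iff [OF inj\<sigma>, of s \<sigma>] by blast
      moreover have "t \<in> (`) f ` {s. s \<subset> \<sigma>}" if t: "t \<subset> f ` \<sigma>" for t
      proof -
        obtain s where "s \<subseteq> \<sigma>" "t = f ` s"
          using t by (meson psubset_imp_subset subset_imageE)
        moreover from this have "s \<noteq> \<sigma>"
          using t by blast
        ultimately show ?thesis
          by blast
      qed
      ultimately show ?thesis
        by (intro equalityI subsetI) (elim imageE, simp_all)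
    qed
    finally show ?thesis .
  qed
  ultimately have "facet_subdivision T' (f ` \<sigma>) v' = (`) h ` facet_subdivision T \<sigma> v"
    unfolding facet_subdivision_eq [OF T \<sigma>(1)] facet_subdivision_eq [OF T'] image_Un by simp
  then show ?thesis
    unfolding isomorphic_complex_def
    using bij U' Union_facet_subdivision [OF T \<sigma>, of v] by metis
qed

context triangulated_manifold
begin

lemma facet_mem: "facet d T \<sigma> \<Longrightarrow> \<sigma> \<in> T" and facet_card: "facet d T \<sigma> \<Longrightarrow> card \<sigma> = d + 1"
  by (simp_all add: facet_def)

text \<open>The open star of a facet is the facet alone. The PL invariance of stellar subdivisions
  thus applies to facet subdivisions.\<close>

lemma facet_subdivision_stellar:
  assumes \<sigma>: "facet d T \<sigma>"
  shows "facet_subdivision T \<sigma> v = stellar_subdivision T \<sigma> v"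
proof -
  have max: "t = \<sigma>" if "t \<in> T" "\<sigma> \<subseteq> t" for t
    using facet_maximal [OF \<sigma> that] .
  have "{s \<in> T. \<not> \<sigma> \<subseteq> s} = T - {\<sigma>}"
    using max by blast
  moreover have "{s \<in> T. \<not> \<sigma> \<subseteq> s \<and> s \<union> \<sigma> \<in> T} = {s. s \<subset> \<sigma>}"
  proof (intro equalityI subsetI)
    fix s assume s: "s \<in> {s \<in> T. \<not> \<sigma> \<subseteq> s \<and> s \<union> \<sigma> \<in> T}"
    then have "s \<union> \<sigma> = \<sigma>"
      using max by blast
    then show "s \<in> {s. s \<subset> \<sigma>}"
      using s by blast
  next
    fix s assume s: "s \<in> {s. s \<subset> \<sigma>}"
    then have "s \<union> \<sigma> = \<sigma>"
      by blast
    then show "s \<in> {s \<in> T. \<not> \<sigma> \<subseteq> s \<and> s \<union> \<sigma> \<in> T}"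
      using s finite_complex_downward [OF cpx facet_mem [OF \<sigma>]] facet_mem [OF \<sigma>] by auto
  qed
  ultimately show ?thesis
    unfolding facet_subdivision_eq [OF cpx facet_mem [OF \<sigma>]] stellar_subdivision_def by simp
qed

lemma stellar_class:
  assumes "\<alpha> \<in> T" "card \<alpha> \<ge> 2" "v \<notin> \<Union>T"
  shows "iso_class (stellar_subdivision T \<alpha> v) \<in> triangulation_classes M (card (\<Union>T) + 1)"
proof -
  have "\<alpha> \<noteq> {}"
    using assms(2) by auto
  then have "triangulation M (stellar_subdivision T \<alpha> v)"
    using triangulation_stellar_subdivision [OF tri assms(1) _ assms(3)] by blast
  moreover have "card (\<Union>(stellar_subdivision T \<alpha> v)) = card (\<Union>T) + 1"
    using finite_complex_vertices [OF cpx] assms by (simp add: Union_stellar_subdivision [OF cpx])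
  ultimately show ?thesis
    unfolding triangulation_classes_def by blast
qed

lemma facet_subdivision_class:
  assumes "facet d T \<sigma>" "v \<notin> \<Union>T"
  shows "iso_class (facet_subdivision T \<sigma> v) \<in> triangulation_classes M (card (\<Union>T) + 1)"
  unfolding facet_subdivision_stellar [OF assms(1)]
  using assms facet_mem facet_card d2 by (intro stellar_class) auto

text \<open>
  The subdivisions of two adjacent facets have a common neighbour in the flip graph: the stellar
  subdivision of the common ridge.
\<close>

lemma adjacent_facet_subdivision_move:
  assumes st: "facet d T \<sigma>" "facet d T \<tau>" "card (\<sigma> \<inter> \<tau>) = d" and v: "v \<notin> \<Union>T"
  shows "proper_move d (facet_subdivision T \<sigma> v) (stellar_subdivision T (\<sigma> \<inter> \<tau>) v)"
proof -
  define \<rho> where "\<rho> = \<sigma> \<inter> \<tau>"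
  have \<sigma>T: "\<sigma> \<in> T" "\<tau> \<in> T"
    using st facet_mem by auto
  have fin: "finite \<sigma>" "finite \<tau>"
    using \<sigma>T finite_complex_finite [OF cpx] by auto
  have \<rho>: "\<rho> \<in> T" "card \<rho> = d" "finite \<rho>"
    using st(3) \<sigma>T finite_complex_downward [OF cpx] fin by (auto simp: \<rho>_def)
  have "card (\<sigma> - \<rho>) = 1" "card (\<tau> - \<rho>) = 1"
    using card_Diff_subset [OF \<rho>(3), of \<sigma>] card_Diff_subset [OF \<rho>(3), of \<tau>] \<rho>(2)
      facet_card [OF st(1)] facet_card [OF st(2)] by (simp_all add: \<rho>_def)
  then obtain a b where ab: "\<sigma> - \<rho> = {a}" "\<tau> - \<rho> = {b}"
    by (metis One_nat_def card_1_singletonE)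
  then have \<sigma>: "\<sigma> = insert a \<rho>" "a \<notin> \<rho>" and \<tau>: "\<tau> = insert b \<rho>" "b \<notin> \<rho>" and "a \<noteq> b"
    by (auto simp: \<rho>_def)
  \<comment> \<open>The ridge lies in exactly two facets, so \<open>a\<close> and \<open>b\<close>
    are all the vertices that extend it.\<close>
  have A: "{x. x \<notin> \<rho> \<and> insert x \<rho> \<in> T} = {a, b}"
  proof -
    obtain a' b' where "{x. x \<notin> \<rho> \<and> insert x \<rho> \<in> T} = {a', b'}"
      using ridge_facets [OF \<rho>(1,2)] by metis
    moreover have "a \<in> {x. x \<notin> \<rho> \<and> insert x \<rho> \<in> T}" "b \<in> {x. x \<notin> \<rho> \<and> insert x \<rho> \<in> T}"
      using \<sigma>T \<sigma> \<tau> by auto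
    ultimately show ?thesis
      using \<open>a \<noteq> b\<close> by auto
  qed
  have above: "x = \<rho> \<or> x = \<sigma> \<or> x = \<tau>" if x: "x \<in> T" "\<rho> \<subseteq> x" for x
  proof (cases "x = \<rho>")
    case False
    then obtain c where c: "c \<in> x" "c \<notin> \<rho>"
      using x(2) by blast
    then have "insert c \<rho> \<in> T"
      using finite_complex_downward [OF cpx x(1), of "insert c \<rho>"] x(2) by simp
    then have "c = a \<or> c = b"
      using A c(2) by blast
    then have "\<sigma> \<subseteq> x \<or> \<tau> \<subseteq> x"
      using c x(2) \<sigma> \<tau> by blast
    then show ?thesis
      using facet_maximal [OF st(1) x(1)] facet_maximal [OF st(2) x(1)] by blast
  qed simp
  have vn: "v \<notin> \<rho>" "v \<noteq> b" "v \<noteq> a" "v \<notin> \<sigma>" "v \<notin> \<tau>" "\<And>s. s \<in> T \<Longrightarrow> v \<notin> s"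
    using v \<sigma>T \<rho> \<sigma> \<tau> by auto
  let ?S = "facet_subdivision T \<sigma> v"
  have S: "?S = (T - {\<sigma>}) \<union> insert v ` {s. s \<subset> \<sigma>}"
    by (rule facet_subdivision_eq [OF cpx \<sigma>T(1)])
  have "\<sigma> \<noteq> {}" "\<rho> \<noteq> {}"
    using \<sigma> \<rho> d2 by auto
  then have S_cpx: "finite_complex ?S"
    unfolding facet_subdivision_stellar [OF st(1)] by (intro finite_complex_stellar_subdivision cpx)
  have \<rho>S: "\<rho> \<in> ?S"
    using \<rho>(1) \<sigma> unfolding S by blast
  \<comment> \<open>The subdivision of \<sigma> replaces the apex \<open>a\<close> over \<rho> by
    \<open>v\<close>, so that the ridge can be exchanged for the edge \<open>{v, b}\<close>.\<close>
  have link: "link ?S \<rho> = boundary {v, b}"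
  proof (intro equalityI subsetI)
    fix \<gamma> assume "\<gamma> \<in> link ?S \<rho>"
    then have \<gamma>: "\<gamma> \<inter> \<rho> = {}" "\<gamma> \<union> \<rho> \<in> ?S"
      by (auto simp: link_def)
    from \<gamma>(2) have "\<gamma> = {} \<or> \<gamma> = {b} \<or> \<gamma> = {v}"
      unfolding S
    proof (elim UnE imageE)
      assume "\<gamma> \<union> \<rho> \<in> T - {\<sigma>}"
      then have "\<gamma> \<union> \<rho> = \<rho> \<or> \<gamma> \<union> \<rho> = insert b \<rho>"
        using above [of "\<gamma> \<union> \<rho>"] \<tau>(1) by blast
      then show ?thesis
        using \<gamma>(1) \<tau>(2) by blast
    next
      fix s assume s: "\<gamma> \<union> \<rho> = insert v s" "s \<in> {s. s \<subset> \<sigma>}"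
      from s(1) have "\<rho> \<subseteq> insert v s"
        by blast
      then have "\<rho> \<subseteq> s"
        using vn(1) by (simp add: subset_insert)
      then have "s = \<rho>"
        using s(2) \<sigma> by blast
      then show ?thesis
        using s(1) \<gamma>(1) vn(1) by blast
    qed
    then show "\<gamma> \<in> boundary {v, b}"
      using vn(2) by (auto simp: boundary_def)
  next
    fix \<gamma> assume "\<gamma> \<in> boundary {v, b}"
    then have "\<gamma> = {} \<or> \<gamma> = {b} \<or> \<gamma> = {v}"
      by (auto simp: boundary_def)
    moreover have "{} \<in> ?S"
      using S_cpx by (simp add: finite_complex_def)
    moreover have b\<rho>: "{b} \<union> \<rho> \<in> ?S"
      using \<sigma>T(2) \<tau> \<sigma> \<open>a \<noteq> b\<close> unfolding S by auto
    moreover have v\<rho>: "{v} \<union> \<rho> \<in> ?S"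
      using \<sigma> unfolding S by auto
    moreover have "{b} \<in> ?S" "{v} \<in> ?S"
      using finite_complex_downward [OF S_cpx b\<rho>] finite_complex_downward [OF S_cpx v\<rho>] by auto
    ultimately show "\<gamma> \<in> link ?S \<rho>"
      using \<tau>(2) vn(1) \<rho>S by (auto simp: link_def)
  qed
  have "bistellar_pair d ?S \<rho> {v, b}"
    unfolding bistellar_pair_def
  proof (intro conjI)
    show "card \<rho> + card {v, b} = d + 2"
      using \<rho>(2) vn(2) by simp
    show "{v, b} \<notin> ?S"
    proof
      assume "{v, b} \<in> ?S"
      then have "{v, b} \<in> T \<or> (\<exists>s\<subset>\<sigma>. {v, b} = insert v s)"
        unfolding S by auto
      moreover have "{v, b} \<notin> T"
        using vn(6) by blast
      ultimately obtain s where s: "s \<subset> \<sigma>" "{v, b} = insert v s"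
        by blast
      then have "b \<in> s"
        using vn(2) by (metis insert_iff singletonI)
      then show False
        using s(1) \<sigma>(1) \<tau>(2) \<open>a \<noteq> b\<close> by blast
    qed
  qed (use \<rho> \<rho>S vn \<tau>(2) \<open>\<rho> \<noteq> {}\<close> link in auto)
  moreover have "bistellar_move ?S \<rho> {v, b} = stellar_subdivision T \<rho> v"
  proof -
    have old: "{x \<in> ?S. \<not> \<rho> \<subseteq> x} = {x \<in> T. \<not> \<rho> \<subseteq> x} \<union> insert v ` {s. s \<subset> \<sigma> \<and> \<not> \<rho> \<subseteq> s}"
      unfolding S using \<sigma>(1) vn(1) by blast
    \<comment> \<open>The new ball contains, besides the cone from \<open>v\<close> over faces of
      \<tau>, also simplices without \<open>v\<close>. Those already belong to \<open>T\<close>, so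
      the union is not changed by them and two inclusions suffice in place of an equation.\<close>
    have join: "simplicial_join (boundary \<rho>) (Pow {v, b}) \<subseteq>
        {x \<in> T. \<not> \<rho> \<subseteq> x} \<union> insert v ` {s. s \<subseteq> \<tau> \<and> \<not> \<rho> \<subseteq> s}"
    proof
      fix x assume "x \<in> simplicial_join (boundary \<rho>) (Pow {v, b})"
      then obtain s t where x: "x = s \<union> t" "s \<subset> \<rho>" "t \<subseteq> {v, b}"
        by (auto simp: simplicial_join_def boundary_def)
      have t: "s \<union> (t - {v}) \<subseteq> \<tau>" "\<not> \<rho> \<subseteq> s \<union> (t - {v})"
        using x(2,3) \<tau> by blast+
      show "x \<in> {x \<in> T. \<not> \<rho> \<subseteq> x} \<union> insert v ` {s. s \<subseteq> \<tau> \<and> \<not> \<rho> \<subseteq> s}"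
      proof (cases "v \<in> t")
        case True
        then have "x = insert v (s \<union> (t - {v}))"
          using x(1) by blast
        then show ?thesis
          using t by blast
      next
        case False
        then have "x = s \<union> (t - {v})"
          using x(1) by blast
        then show ?thesis
          using t finite_complex_downward [OF cpx \<sigma>T(2)] by blast
      qed
    qed
    have join': "insert v ` {s. s \<subseteq> \<tau> \<and> \<not> \<rho> \<subseteq> s} \<subseteq> simplicial_join (boundary \<rho>) (Pow {v, b})"
    proof
      fix x assume "x \<in> insert v ` {s. s \<subseteq> \<tau> \<and> \<not> \<rho> \<subseteq> s}"
      then obtain s where s: "x = insert v s" "s \<subseteq> \<tau>" "\<not> \<rho> \<subseteq> s"
        by blast
      then have "s - {b} \<subset> \<rho>" "x = (s - {b}) \<union> insert v (s \<inter> {b})" "insert v (s \<inter> {b}) \<subseteq> {v, b}"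
        using \<tau> by auto
      then show "x \<in> simplicial_join (boundary \<rho>) (Pow {v, b})"
        unfolding simplicial_join_def boundary_def by blast
    qed
    have star: "{s \<in> T. \<not> \<rho> \<subseteq> s \<and> s \<union> \<rho> \<in> T} = {s. s \<subset> \<sigma> \<and> \<not> \<rho> \<subseteq> s} \<union> {s. s \<subseteq> \<tau> \<and> \<not> \<rho> \<subseteq> s}"
    proof (intro equalityI subsetI)
      fix s assume s: "s \<in> {s \<in> T. \<not> \<rho> \<subseteq> s \<and> s \<union> \<rho> \<in> T}"
      then have "s \<union> \<rho> = \<rho> \<or> s \<union> \<rho> = \<sigma> \<or> s \<union> \<rho> = \<tau>"
        using above by blast
      then have "s \<subseteq> \<sigma> \<or> s \<subseteq> \<tau>"
        using \<sigma>(1) by blast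
      moreover have "s \<noteq> \<sigma>"
        using s \<sigma>(1) by blast
      ultimately show "s \<in> {s. s \<subset> \<sigma> \<and> \<not> \<rho> \<subseteq> s} \<union> {s. s \<subseteq> \<tau> \<and> \<not> \<rho> \<subseteq> s}"
        using s by blast
    next
      fix s assume s: "s \<in> {s. s \<subset> \<sigma> \<and> \<not> \<rho> \<subseteq> s} \<union> {s. s \<subseteq> \<tau> \<and> \<not> \<rho> \<subseteq> s}"
      then have "s \<in> T"
        using finite_complex_downward [OF cpx \<sigma>T(1)] finite_complex_downward [OF cpx \<sigma>T(2)] by blast
      moreover have "s \<union> \<rho> \<in> T"
        using s \<sigma>(1) \<tau>(1) finite_complex_downward [OF cpx \<sigma>T(1), of "s \<union> \<rho>"]
          finite_complex_downward [OF cpx \<sigma>T(2), of "s \<union> \<rho>"] by blast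
      ultimately show "s \<in> {s \<in> T. \<not> \<rho> \<subseteq> s \<and> s \<union> \<rho> \<in> T}"
        using s by blast
    qed
    have "A \<union> C \<union> J = A \<union> (C \<union> B)" if "J \<subseteq> A \<union> B" "B \<subseteq> J" for A B C J :: "nat set set"
      using that by blast
    then show ?thesis
      unfolding bistellar_move_eq [OF S_cpx link] stellar_subdivision_def old star image_Un
      using join join' by simp
  qed
  \<comment> \<open>The sizes are \<open>d\<close> and 2, both within range because
    \<open>d \<ge> 2\<close>.\<close>
  moreover have "card \<rho> \<in> {2..d}" "card {v, b} \<in> {2..d}"
    using \<rho>(2) d2 vn(2) by auto
  ultimately show ?thesis
    unfolding proper_move_def \<rho>_def by metis
qed

text \<open>Omitting one vertex \<open>x\<close> from \<alpha> and one vertex \<open>y\<close> from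
  \<beta> gives a ridge on the boundary of the ball. One of the two vertices that extend this ridge
  differs from \<open>x\<close>; the facet obtained with it misses \<open>x\<close> and so does not
  contain \<alpha>.\<close>

lemma facet_avoiding_simplex:
  assumes pair: "bistellar_pair d T \<alpha> \<beta>"
  obtains \<sigma> where "facet d T \<sigma>" "\<not> \<alpha> \<subseteq> \<sigma>"
proof -
  have \<alpha>\<beta>: "finite \<alpha>" "finite \<beta>" "\<alpha> \<inter> \<beta> = {}" "card \<alpha> + card \<beta> = d + 2" "link T \<alpha> = boundary \<beta>"
    using pair by (auto simp: bistellar_pair_def)
  obtain x y where xy: "x \<in> \<alpha>" "y \<in> \<beta>"
    using pair by (auto simp: bistellar_pair_def)
  define \<rho> where "\<rho> = (\<alpha> - {x}) \<union> (\<beta> - {y})"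
  have "\<beta> - {y} \<in> link T \<alpha>"
    using xy(2) unfolding \<alpha>\<beta>(5) by (auto simp: boundary_def)
  then have top: "(\<beta> - {y}) \<union> \<alpha> \<in> T"
    by (simp add: link_def)
  then have \<rho>T: "\<rho> \<in> T"
    by (rule finite_complex_downward [OF cpx]) (auto simp: \<rho>_def)
  have "card \<rho> = card (\<alpha> - {x}) + card (\<beta> - {y})"
    unfolding \<rho>_def using \<alpha>\<beta>(1-3) by (intro card_Un_disjoint) auto
  then have card: "card \<rho> = d"
    using \<alpha>\<beta>(4) card_Suc_Diff1 [OF \<alpha>\<beta>(1) xy(1)] card_Suc_Diff1 [OF \<alpha>\<beta>(2) xy(2)] by linarith
  have x\<rho>: "x \<notin> \<rho>"
    using xy \<alpha>\<beta>(3) by (auto simp: \<rho>_def)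
  have fin\<rho>: "finite \<rho>"
    using \<alpha>\<beta> by (simp add: \<rho>_def)
  obtain a b where "a \<noteq> b" "{x. x \<notin> \<rho> \<and> insert x \<rho> \<in> T} = {a, b}"
    using ridge_facets [OF \<rho>T card] .
  then obtain c where c: "c \<noteq> x" "c \<notin> \<rho>" "insert c \<rho> \<in> T"
    by (metis (mono_tags, lifting) insertCI mem_Collect_eq)
  show ?thesis
  proof (rule that)
    show "facet d T (insert c \<rho>)"
      using c card fin\<rho> by (simp add: facet_def)
    show "\<not> \<alpha> \<subseteq> insert c \<rho>"
      using xy(1) x\<rho> c(1) by blast
  qed
qed

text \<open>A move sees only the simplices above \<alpha>. Subdividing a facet that does not contain
  \<alpha> neither removes nor adds such a simplex, so the same pair is admissible
  afterwards.\<close>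

lemma facet_subdivision_proper_move:
  assumes pair: "bistellar_pair d T \<alpha> \<beta>" and card: "card \<alpha> \<in> {2..d}" "card \<beta> \<in> {2..d}"
    and T': "finite_complex (bistellar_move T \<alpha> \<beta>)"
    and \<sigma>: "facet d T \<sigma>" "\<not> \<alpha> \<subseteq> \<sigma>" and v: "v \<notin> \<Union>T" "v \<notin> \<beta>"
  shows "facet d (bistellar_move T \<alpha> \<beta>) \<sigma>"
    and "proper_move d (facet_subdivision T \<sigma> v) (facet_subdivision (bistellar_move T \<alpha> \<beta>) \<sigma> v)"
proof -
  have \<alpha>\<beta>: "finite \<alpha>" "finite \<beta>" "\<alpha> \<inter> \<beta> = {}" "card \<alpha> + card \<beta> = d + 2" "\<alpha> \<in> T" "\<beta> \<notin> T"
    and link: "link T \<alpha> = boundary \<beta>"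
    using pair by (auto simp: bistellar_pair_def)
  define J where "J = simplicial_join (boundary \<alpha>) (Pow \<beta>)"
  have eq: "bistellar_move T \<alpha> \<beta> = {x \<in> T. \<not> \<alpha> \<subseteq> x} \<union> J"
    unfolding J_def by (rule bistellar_move_eq [OF cpx link])
  have \<sigma>T: "\<sigma> \<in> T"
    using \<sigma>(1) by (rule facet_mem)
  show facet': "facet d (bistellar_move T \<alpha> \<beta>) \<sigma>"
    using \<sigma> unfolding eq facet_def by blast
  \<comment> \<open>A simplex of the new ball that does not contain \<beta> misses a vertex of
    \<alpha> and a vertex of \<beta>, and so has at most \<open>d\<close> vertices, one fewer than a
    facet.\<close>
  have \<sigma>J: "\<sigma> \<notin> J"
  proof
    assume "\<sigma> \<in> J"
    then obtain s t where s: "s \<subset> \<alpha>" "t \<subseteq> \<beta>" "\<sigma> = s \<union> t"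
      by (auto simp: J_def simplicial_join_def boundary_def)
    have "t \<noteq> \<beta>"
      using s(3) \<alpha>\<beta>(6) finite_complex_downward [OF cpx \<sigma>T, of \<beta>] by blast
    then have "card s < card \<alpha>" "card t < card \<beta>"
      using s \<alpha>\<beta>(1,2) by (auto intro!: psubset_card_mono)
    moreover have "card \<sigma> \<le> card s + card t"
      unfolding s(3) by (rule card_Un_le)
    ultimately show False
      using \<alpha>\<beta>(4) facet_card [OF \<sigma>(1)] by linarith
  qed
  have v\<alpha>: "v \<notin> \<alpha>"
    using v(1) \<alpha>\<beta>(5) by blast
  let ?S = "facet_subdivision T \<sigma> v"
  have S: "?S = (T - {\<sigma>}) \<union> insert v ` {s. s \<subset> \<sigma>}"
    by (rule facet_subdivision_eq [OF cpx \<sigma>T])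
  have new: "\<not> \<alpha> \<subseteq> insert v s" if "s \<subset> \<sigma>" for s
    using that \<sigma>(2) v\<alpha> by blast
  have "\<sigma> \<noteq> {}"
    using facet_card [OF \<sigma>(1)] by auto
  then have S_cpx: "finite_complex ?S"
    unfolding facet_subdivision_stellar [OF \<sigma>(1)] by (intro finite_complex_stellar_subdivision cpx)
  have S_above: "x \<in> ?S \<longleftrightarrow> x \<in> T" if "\<alpha> \<subseteq> x" for x
    unfolding S using that new \<sigma>(2) by blast
  have linkS: "link ?S \<alpha> = boundary \<beta>"
  proof -
    have "\<gamma> \<in> ?S \<longleftrightarrow> \<gamma> \<in> T" if "\<gamma> \<union> \<alpha> \<in> T" for \<gamma>
    proof
      show "\<gamma> \<in> T"
        using finite_complex_downward [OF cpx that, of \<gamma>] by blast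
      show "\<gamma> \<in> ?S"
        using finite_complex_downward [OF S_cpx, of "\<gamma> \<union> \<alpha>" \<gamma>] S_above [of "\<gamma> \<union> \<alpha>"] that by blast
    qed
    then have "link ?S \<alpha> = link T \<alpha>"
      unfolding link_def using S_above by blast
    then show ?thesis
      using link by simp
  qed
  have "\<beta> \<notin> ?S"
    unfolding S using \<alpha>\<beta>(6) v(2) by blast
  then have "bistellar_pair d ?S \<alpha> \<beta>"
    using pair S_above [of \<alpha>] linkS by (auto simp: bistellar_pair_def)
  moreover have "bistellar_move ?S \<alpha> \<beta> = facet_subdivision (bistellar_move T \<alpha> \<beta>) \<sigma> v"
  proof -
    have "facet_subdivision (bistellar_move T \<alpha> \<beta>) \<sigma> v =
        (bistellar_move T \<alpha> \<beta> - {\<sigma>}) \<union> insert v ` {s. s \<subset> \<sigma>}"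
      using facet_subdivision_eq [OF T'] facet' by (simp add: facet_def)
    also have "\<dots> = {x \<in> ?S. \<not> \<alpha> \<subseteq> x} \<union> J"
      unfolding eq S using \<sigma>J new by blast
    also have "\<dots> = bistellar_move ?S \<alpha> \<beta>"
      unfolding J_def by (rule bistellar_move_eq [OF S_cpx linkS, symmetric])
    finally show ?thesis ..
  qed
  ultimately show "proper_move d ?S (facet_subdivision (bistellar_move T \<alpha> \<beta>) \<sigma> v)"
    unfolding proper_move_def using card by metis
qed

text \<open>Members of a lift fiber come with arbitrary representatives and labels. Normalising both
  allows two members to be compared inside one complex with one new vertex.\<close>

lemma lift_fiber_representative:
  assumes "L \<in> lift_fiber d (iso_class T)" and v: "v \<notin> \<Union>T"
  obtains \<sigma> where "facet d T \<sigma>" "L = iso_class (facet_subdivision T \<sigma> v)"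
proof -
  obtain T' \<sigma>' v' where T': "T' \<in> iso_class T" and \<sigma>': "facet d T' \<sigma>'" and v': "v' \<notin> \<Union>T'"
    and L: "L = iso_class (facet_subdivision T' \<sigma>' v')"
    using assms(1) by (auto simp: lift_fiber_def)
  obtain f where f: "bij_betw f (\<Union>T) (\<Union>T')" "T' = (`) f ` T"
    using T' by (auto simp: iso_class_def isomorphic_complex_def)
  obtain \<sigma> where \<sigma>: "\<sigma> \<in> T" "\<sigma>' = f ` \<sigma>"
    using \<sigma>' f(2) by (auto simp: facet_def)
  have "card \<sigma>' = card \<sigma>"
    unfolding \<sigma>(2) using f(1) \<sigma>(1)
    by (intro card_image) (auto simp: bij_betw_def intro: inj_on_subset)
  then have fac: "facet d T \<sigma>"
    using \<sigma>' \<sigma>(1) by (simp add: facet_def)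
  have "isomorphic_complex (facet_subdivision T \<sigma> v) (facet_subdivision T' \<sigma>' v')"
    unfolding \<sigma>(2) using facet_card [OF fac] d2
    by (intro facet_subdivision_isomorphic [OF cpx f \<sigma>(1) _ v v']) simp
  then have "L = iso_class (facet_subdivision T \<sigma> v)"
    unfolding L by (simp add: iso_class_eq)
  then show ?thesis
    using that fac by blast
qed

end

section \<open>Lift fibers and the component graph\<close>

lemma flip_graph_arc:
  assumes "iso_class S \<in> triangulation_classes M n" "iso_class T \<in> triangulation_classes M n"
    and "proper_move d S T"
  shows "(iso_class S, iso_class T) \<in> parcs (flip_graph d M n)"
  using assms mem_iso_class by (auto simp: flip_graph_def)

lemma flip_graph_connected_sym:
  assumes "(P, Q) \<in> (parcs (flip_graph d M n))\<^sup>*"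
  shows "(Q, P) \<in> (parcs (flip_graph d M n))\<^sup>*"
proof -
  have "sym (parcs (flip_graph d M n))"
    by (rule symI) (auto simp: flip_graph_def)
  then show ?thesis
    using assms sym_rtrancl symD by metis
qed

lemma triangulation_classes_card:
  assumes "iso_class T \<in> triangulation_classes M n"
  shows "triangulation M T" "card (\<Union>T) = n"
proof -
  obtain T' where T': "iso_class T = iso_class T'" "triangulation M T'" "card (\<Union>T') = n"
    using assms by (auto simp: triangulation_classes_def)
  then have "isomorphic_complex T' T"
    using mem_iso_class [of T] by (simp add: iso_class_def)
  then show "triangulation M T" "card (\<Union>T) = n"
    using T' triangulation_isomorphic isomorphic_complex_card by metis+
qed

context triangulated_manifold
begin

text \<open>Each step between adjacent facets becomes a path of two arcs through the stellar
  subdivision of their common ridge, the second arc being traversed backwards.\<close>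

lemma facet_subdivisions_connected:
  assumes "facet d T \<sigma>" "facet d T \<tau>" and v: "v \<notin> \<Union>T"
  shows "(iso_class (facet_subdivision T \<sigma> v), iso_class (facet_subdivision T \<tau> v))
    \<in> (parcs (flip_graph d M (card (\<Union>T) + 1)))\<^sup>*"
  using strongly_connected_facets [OF assms(1,2)]
proof (induction rule: rtrancl_induct)
  case (step \<tau> \<tau>')
  then have \<tau>: "facet d T \<tau>" "facet d T \<tau>'" "card (\<tau> \<inter> \<tau>') = d" "card (\<tau>' \<inter> \<tau>) = d"
    by (auto simp: facet_adjacency_def Int_commute)
  have "\<tau> \<inter> \<tau>' \<in> T"
    using finite_complex_downward [OF cpx facet_mem [OF \<tau>(1)]] by blast
  then have mid: "iso_class (stellar_subdivision T (\<tau> \<inter> \<tau>') v) \<in> triangulation_classes M (card (\<Union>T) + 1)"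
    using stellar_class v \<tau>(3) d2 by simp
  have "(iso_class (facet_subdivision T \<tau> v), iso_class (stellar_subdivision T (\<tau> \<inter> \<tau>') v))
      \<in> parcs (flip_graph d M (card (\<Union>T) + 1))"
    by (intro flip_graph_arc mid facet_subdivision_class adjacent_facet_subdivision_move \<tau> v)
  moreover have "(iso_class (facet_subdivision T \<tau>' v), iso_class (stellar_subdivision T (\<tau> \<inter> \<tau>') v))
      \<in> parcs (flip_graph d M (card (\<Union>T) + 1))"
    using adjacent_facet_subdivision_move [OF \<tau>(2,1,4) v]
    by (intro flip_graph_arc mid facet_subdivision_class \<tau> v) (simp add: Int_commute)
  ultimately show ?case
    using step.IH flip_graph_connected_sym [OF r_into_rtrancl] by (meson rtrancl.rtrancl_into_rtrancl rtrancl_trans)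
qed simp

lemma fresh_vertex:
  obtains v where "v \<notin> \<Union>T"
  by (rule exE [OF ex_new_if_finite [OF infinite_UNIV_nat finite_complex_vertices [OF cpx]]])

lemma lift_fiber_connected:
  assumes "L \<in> lift_fiber d (iso_class T)" "L' \<in> lift_fiber d (iso_class T)"
  shows "(L, L') \<in> (parcs (flip_graph d M (card (\<Union>T) + 1)))\<^sup>*"
proof -
  obtain v where v: "v \<notin> \<Union>T"
    by (rule fresh_vertex)
  obtain \<sigma> where \<sigma>: "facet d T \<sigma>" "L = iso_class (facet_subdivision T \<sigma> v)"
    by (rule lift_fiber_representative [OF assms(1) v])
  obtain \<tau> where \<tau>: "facet d T \<tau>" "L' = iso_class (facet_subdivision T \<tau> v)"
    by (rule lift_fiber_representative [OF assms(2) v])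
  show ?thesis
    unfolding \<sigma>(2) \<tau>(2) by (rule facet_subdivisions_connected [OF \<sigma>(1) \<tau>(1) v])
qed

lemma facet_subdivision_in_lift_fiber:
  "facet d T \<sigma> \<Longrightarrow> v \<notin> \<Union>T \<Longrightarrow> iso_class (facet_subdivision T \<sigma> v) \<in> lift_fiber d (iso_class T)"
  unfolding lift_fiber_def by (intro CollectI exI [of _ T] exI [of _ \<sigma>] exI [of _ v]) (simp add: mem_iso_class)

lemma lift_fiber_nonempty: "lift_fiber d (iso_class T) \<noteq> {}"
proof -
  have "{} \<in> T"
    using cpx by (simp add: finite_complex_def)
  then show ?thesis
    using subset_facet fresh_vertex facet_subdivision_in_lift_fiber by (metis empty_iff)
qed

lemma lift_fiber_classes: "lift_fiber d (iso_class T) \<subseteq> triangulation_classes M (card (\<Union>T) + 1)"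
proof
  fix L assume L: "L \<in> lift_fiber d (iso_class T)"
  obtain v where v: "v \<notin> \<Union>T"
    by (rule fresh_vertex)
  obtain \<sigma> where "facet d T \<sigma>" "L = iso_class (facet_subdivision T \<sigma> v)"
    by (rule lift_fiber_representative [OF L v])
  then show "L \<in> triangulation_classes M (card (\<Union>T) + 1)"
    using facet_subdivision_class v by simp
qed

lemma lift_fibers_adjacent:
  assumes T': "triangulation M T'" "card (\<Union>T') = card (\<Union>T)" and move: "proper_move d T T'"
  shows "\<exists>L\<in>lift_fiber d (iso_class T). \<exists>L'\<in>lift_fiber d (iso_class T').
    (L, L') \<in> parcs (flip_graph d M (card (\<Union>T) + 1))"
proof -
  interpret T': triangulated_manifold d M T'
    using d2 mfd T' by unfold_locales
  obtain \<alpha> \<beta> where pair: "bistellar_pair d T \<alpha> \<beta>" and card: "card \<alpha> \<in> {2..d}" "card \<beta> \<in> {2..d}"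
    and eq: "T' = bistellar_move T \<alpha> \<beta>"
    using move by (auto simp: proper_move_def)
  obtain \<sigma> where \<sigma>: "facet d T \<sigma>" "\<not> \<alpha> \<subseteq> \<sigma>"
    using facet_avoiding_simplex [OF pair] .
  \<comment> \<open>The same label has to be new for \<open>T\<close> and for \<open>T'\<close>, and
    must avoid \<beta> so that \<beta> is still a missing face after the subdivision.\<close>
  have "finite (\<Union>T \<union> \<Union>T' \<union> \<beta>)"
    using pair finite_complex_vertices [OF cpx] finite_complex_vertices [OF T'.cpx]
    by (simp add: bistellar_pair_def)
  then obtain v where "v \<notin> \<Union>T \<union> \<Union>T' \<union> \<beta>"
    by (rule exE [OF ex_new_if_finite [OF infinite_UNIV_nat]])
  then have v: "v \<notin> \<Union>T" "v \<notin> \<Union>T'" "v \<notin> \<beta>"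
    by auto
  have \<sigma>': "facet d T' \<sigma>" and mv: "proper_move d (facet_subdivision T \<sigma> v) (facet_subdivision T' \<sigma> v)"
    using facet_subdivision_proper_move [OF pair card _ \<sigma> v(1,3)] T'.cpx unfolding eq by auto
  have "(iso_class (facet_subdivision T \<sigma> v), iso_class (facet_subdivision T' \<sigma> v))
      \<in> parcs (flip_graph d M (card (\<Union>T) + 1))"
    using facet_subdivision_class [OF \<sigma>(1) v(1)] T'.facet_subdivision_class [OF \<sigma>' v(2)] T'(2) mv
    by (intro flip_graph_arc) simp_all
  then show ?thesis
    using facet_subdivision_in_lift_fiber [OF \<sigma>(1) v(1)] T'.facet_subdivision_in_lift_fiber [OF \<sigma>' v(2)]
    by blast
qed

end

lemma lift_fibers_connected:
  fixes M :: "'a::euclidean_space set"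
  assumes d: "d \<ge> 2" and M: "closed_connected_pl_manifold d M"
    and P: "P \<in> triangulation_classes M n" and PQ: "(P, Q) \<in> (parcs (flip_graph d M n))\<^sup>*"
    and L: "L \<in> lift_fiber d P" "L' \<in> lift_fiber d Q"
  shows "(L, L') \<in> (parcs (flip_graph d M (n + 1)))\<^sup>*"
proof -
  have same: "(L, L') \<in> (parcs (flip_graph d M (n + 1)))\<^sup>*"
    if P: "P \<in> triangulation_classes M n" "L \<in> lift_fiber d P" "L' \<in> lift_fiber d P" for P L L'
  proof -
    obtain T where T: "P = iso_class T" "triangulation M T" "card (\<Union>T) = n"
      using P(1) by (auto simp: triangulation_classes_def)
    interpret triangulated_manifold d M T
      using d M T by unfold_locales
    show ?thesis
      using lift_fiber_connected P T by simp
  qed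
  have move: "\<exists>L\<in>lift_fiber d P. \<exists>L'\<in>lift_fiber d Q. (L, L') \<in> parcs (flip_graph d M (n + 1))"
    if P: "P \<in> triangulation_classes M n" and Q: "Q \<in> triangulation_classes M n"
      and ST: "S \<in> P" "T \<in> Q" "proper_move d S T" for P Q S T
  proof -
    have "P = iso_class S" "Q = iso_class T"
      using P Q ST iso_class_mem by (auto simp: triangulation_classes_def)
    then have S: "triangulation M S" "card (\<Union>S) = n" and T: "triangulation M T" "card (\<Union>T) = n"
      using P Q triangulation_classes_card by metis+
    interpret triangulated_manifold d M S
      using d M S by unfold_locales
    show ?thesis
      using lift_fibers_adjacent [OF T(1) _ ST(3)] S T \<open>P = iso_class S\<close> \<open>Q = iso_class T\<close> by simp
  qed
  \<comment> \<open>Quantifying over the whole fiber of the end point lets the induction pass from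
    the member that a path has reached to the member where the next arc departs.\<close>
  from PQ have "Q \<in> triangulation_classes M n \<and>
      (\<forall>L'\<in>lift_fiber d Q. (L, L') \<in> (parcs (flip_graph d M (n + 1)))\<^sup>*)"
  proof (induction rule: rtrancl_induct)
    case base
    then show ?case
      using P L(1) same by blast
  next
    case (step Q R)
    then have Q: "Q \<in> triangulation_classes M n" and R: "R \<in> triangulation_classes M n"
      and mv: "\<exists>S\<in>Q. \<exists>T\<in>R. proper_move d S T \<or> proper_move d T S"
      by (auto simp: flip_graph_def)
    obtain L1 L2 where L12: "L1 \<in> lift_fiber d Q" "L2 \<in> lift_fiber d R"
        "(L1, L2) \<in> (parcs (flip_graph d M (n + 1)))\<^sup>*"
      using mv move [OF Q R] move [OF R Q] flip_graph_connected_sym [OF r_into_rtrancl] by (meson r_into_rtrancl)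
    show ?case
      using step.IH L12 same [OF R L12(2)] R by (meson rtrancl_trans)
  qed
  then show ?thesis
    using L(2) by blast
qed

text \<open>Arcs of a pair digraph are pairs of vertices, so the out-degree of \<open>U\<close>
  counts target components. One exists because lift fibers are nonempty, and any two coincide
  because all fibers over \<open>U\<close> lie in a common component.\<close>

theorem theorem1:
  fixes d :: nat and M :: "'a::euclidean_space set"
  assumes "d \<ge> 2" and "closed_connected_pl_manifold d M"
  shows "(\<forall>U \<in> pverts (component_graph d M). out_degree (with_proj (component_graph d M)) U = 1) \<and>
    (\<forall>n. \<forall>U \<in> flip_components d M n. \<forall>P\<in>U. \<forall>Q\<in>U.
      \<exists>V \<in> flip_components d M (n + 1). lift_fiber d P \<union> lift_fiber d Q \<subseteq> V)"
proof -
  define R where "R = (\<lambda>n. (parcs (flip_graph d M n))\<^sup>*)"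
  have verts: "pverts (flip_graph d M n) = triangulation_classes M n" for n
    by (simp add: flip_graph_def)
  have R_sym: "(Q, P) \<in> R n" if "(P, Q) \<in> R n" for P Q n
    using flip_graph_connected_sym that by (auto simp: R_def)
  have R_trans: "(P, S) \<in> R n" if "(P, Q) \<in> R n" "(Q, S) \<in> R n" for P Q S n
    using that by (auto simp: R_def)
  have R_classes: "Q \<in> triangulation_classes M n" if "P \<in> triangulation_classes M n" "(P, Q) \<in> R n" for P Q n
    using that(2,1) unfolding R_def by (induction rule: rtrancl_induct) (auto simp: flip_graph_def)
  have comp: "U = R n `` {P} \<and> P \<in> triangulation_classes M n" if "U \<in> flip_components d M n" "P \<in> U" for U P n
  proof -
    obtain P0 where P0: "P0 \<in> triangulation_classes M n" "U = R n `` {P0}"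
      using \<open>U \<in> flip_components d M n\<close> by (auto simp: flip_components_def verts R_def elim: quotientE)
    then show ?thesis
      using \<open>P \<in> U\<close> R_sym R_trans R_classes by blast
  qed
  have class_comp: "R n `` {P} \<in> flip_components d M n" "P \<in> R n `` {P}" if "P \<in> triangulation_classes M n" for P n
    using that by (auto simp: flip_components_def verts R_def quotientI)
  have lift: "lift_fiber d P \<noteq> {}" "lift_fiber d P \<subseteq> triangulation_classes M (n + 1)"
    if "P \<in> triangulation_classes M n" for P n
  proof -
    obtain T where T: "P = iso_class T" "triangulation M T" "card (\<Union>T) = n"
      using \<open>P \<in> triangulation_classes M n\<close> by (auto simp: triangulation_classes_def)
    interpret triangulated_manifold d M T
      using assms T by unfold_locales
    show "lift_fiber d P \<noteq> {}" "lift_fiber d P \<subseteq> triangulation_classes M (n + 1)"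
      using lift_fiber_nonempty lift_fiber_classes T by auto
  qed
  have main: "\<exists>V \<in> flip_components d M (n + 1). lift_fiber d P \<union> lift_fiber d Q \<subseteq> V"
    if U: "U \<in> flip_components d M n" and PQ: "P \<in> U" "Q \<in> U" for n U P Q
  proof -
    have P: "P \<in> triangulation_classes M n" "(P, P) \<in> R n" "(P, Q) \<in> R n"
      using comp [OF U PQ(1)] PQ by (auto simp: R_def)
    obtain L where L: "L \<in> lift_fiber d P"
      using lift(1) [OF P(1)] by blast
    have "lift_fiber d P \<union> lift_fiber d Q \<subseteq> R (n + 1) `` {L}"
      using lift_fibers_connected [OF assms P(1) _ L] P(2,3) unfolding R_def by blast
    moreover have "R (n + 1) `` {L} \<in> flip_components d M (n + 1)"
      using L lift(2) [OF P(1)] class_comp(1) by blast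
    ultimately show ?thesis
      by blast
  qed
  have "out_degree (with_proj (component_graph d M)) U = 1" if vertex: "U \<in> pverts (component_graph d M)" for U
  proof -
    obtain n where U: "U \<in> flip_components d M n"
      using vertex by (auto simp: component_graph_def)
    then obtain P where P: "P \<in> U" "P \<in> triangulation_classes M n"
      by (auto simp: flip_components_def verts elim!: quotientE)
    obtain V where V: "V \<in> flip_components d M (n + 1)" "lift_fiber d P \<subseteq> V"
      using main [OF U P(1) P(1)] by blast
    have arc: "(U, V) \<in> parcs (component_graph d M)"
      using U V P lift(1) [OF P(2)] by (auto simp: component_graph_def)
    have unique: "V' = V" if UV': "(U, V') \<in> parcs (component_graph d M)" for V'
    proof -
      obtain n' P' L' where n': "U \<in> flip_components d M n'" "V' \<in> flip_components d M (n' + 1)"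
        and P': "P' \<in> U" "L' \<in> lift_fiber d P'" "L' \<in> V'"
        using UV' by (auto simp: component_graph_def)
      have "P \<in> triangulation_classes M n'"
        using comp [OF n'(1) P(1)] by blast
      \<comment> \<open>The number of vertices is an invariant of the class \<open>P\<close>, so a
        component belongs to one level only and its arcs all lead to the next one.\<close>
      then have "n' = n"
        using P(2) triangulation_classes_card(2) by (auto simp: triangulation_classes_def)
      obtain W where W: "W \<in> flip_components d M (n + 1)" "lift_fiber d P \<union> lift_fiber d P' \<subseteq> W"
        using main [OF U P(1) P'(1)] by blast
      obtain L where L: "L \<in> lift_fiber d P"
        using lift(1) [OF P(2)] by blast
      \<comment> \<open>Components with a common member coincide: \<open>W\<close> shares
        \<open>L'\<close> with \<open>V'\<close>, and it shares every member of the fiber of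
        \<open>P\<close> with \<open>V\<close>.\<close>
      have "W = V'"
        using comp [OF W(1), of L'] comp [OF n'(2) P'(3)] W(2) P'(2) \<open>n' = n\<close> by blast
      moreover have "W = V"
        using comp [OF W(1), of L] comp [OF V(1), of L] W(2) V(2) L by blast
      ultimately show ?thesis
        by simp
    qed
    have "out_arcs (with_proj (component_graph d M)) U = {(U, V)}"
    proof (intro equalityI subsetI)
      fix e assume e: "e \<in> out_arcs (with_proj (component_graph d M)) U"
      obtain U' V' where "e = (U', V')"
        by (cases e)
      then show "e \<in> {(U, V)}"
        using e unique by auto
    qed (use arc in simp)
    then show ?thesis
      by (simp add: out_degree_def)
  qed
  then show ?thesis
    using main by blast
qed

end
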